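(* Let $d\ge3$, $\Omega\subset\mathbb{R}^d$ a bounded domain with smooth boundary, $m_s=(d-2)/(d+2)<m<1$, $\mathbf c>0$, and let $S_{c,m}$ be a positive classical solution of $-\Delta S^m=\mathbf c\,S$ in $\Omega$, $S=0$ on $\partial\Omega$. Let $S_m=\mu S_{c,m}$ be the positive multiple with $\|S_m\|_{L^{1+m}(\Omega)}=1$ (it solves $-\Delta S_m^m=\lambda_mS_m$ for some $\lambda_m>0$), and let $0<k_0\le k_1$ be constants with $k_0\Phi_1\le S_m^m\le k_1\Phi_1$ on $\Omega$. Then for every $f\in W^{1,2}_0(\Omega)$ and $g=f/\Phi_1$, $$\frac{(\lambda_2-\lambda_1)\,k_0^2}{k_1^2\,\|S_{c,m}\|_\infty^{1-m}}\int_\Omega|g-\overline g|^2S_{c,m}^{1+m}dx\le\int_\Omega|\nabla g|^2S_{c,m}^{2m}dx,\qquad\overline g=\frac{\int_\Omega gS_{c,m}^{1+m}dx}{\int_\Omega S_{c,m}^{1+m}dx}.$$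
   Context: $0<\lambda_1<\lambda_2$ are the first two Dirichlet eigenvalues of $-\Delta$ on $\Omega$, $\Phi_1>0$ the first eigenfunction with $\|\Phi_1\|_2=1$. *)

theory Defs
  imports "HOL-Analysis.Analysis"
begin

definition pdiff :: "'a::euclidean_space \<Rightarrow> ('a \<Rightarrow> real) \<Rightarrow> 'a \<Rightarrow> real" where
  "pdiff b u x = frechet_derivative u (at x) b"

definition cgrad :: "('a::euclidean_space \<Rightarrow> real) \<Rightarrow> 'a \<Rightarrow> 'a" where
  "cgrad u x = (\<Sum>b\<in>Basis. pdiff b u x *\<^sub>R b)"

definition laplacian :: "('a::euclidean_space \<Rightarrow> real) \<Rightarrow> 'a \<Rightarrow> real" where
  "laplacian u x = (\<Sum>b\<in>Basis. pdiff b (pdiff b u) x)"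

text \<open>C^infinity on an open set: differentiable, continuous, and all partial derivatives
  again C^infinity (greatest fixed point, i.e. derivatives of all orders).\<close>
coinductive smooth_on :: "'a::euclidean_space set \<Rightarrow> ('a \<Rightarrow> real) \<Rightarrow> bool" for S where
  "\<lbrakk> \<forall>x\<in>S. u differentiable (at x); continuous_on S u;
     \<forall>b\<in>Basis. smooth_on S (pdiff b u) \<rbrakk> \<Longrightarrow> smooth_on S u"

definition C1_on :: "'a::euclidean_space set \<Rightarrow> ('a \<Rightarrow> real) \<Rightarrow> bool" where
  "C1_on S u \<longleftrightarrow> (\<forall>x\<in>S. u differentiable (at x)) \<and> continuous_on S u \<and>
     (\<forall>b\<in>Basis. continuous_on S (pdiff b u))"

definition C2_on :: "'a::euclidean_space set \<Rightarrow> ('a \<Rightarrow> real) \<Rightarrow> bool" where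
  "C2_on S u \<longleftrightarrow> C1_on S u \<and> (\<forall>b\<in>Basis. C1_on S (pdiff b u))"

definition bounded_domain :: "'a::euclidean_space set \<Rightarrow> bool" where
  "bounded_domain \<Omega> \<longleftrightarrow> open \<Omega> \<and> connected \<Omega> \<and> bounded \<Omega> \<and> \<Omega> \<noteq> {}"

text \<open>Locally, after choosing a unit direction \<nu>, the domain is the supergraph of a
  C^infinity function gamma of the coordinates orthogonal to \<nu>.\<close>
definition smooth_boundary :: "'a::euclidean_space set \<Rightarrow> bool" where
  "smooth_boundary \<Omega> \<longleftrightarrow> (\<forall>p\<in>frontier \<Omega>. \<exists>\<nu> r \<gamma>. norm \<nu> = 1 \<and> r > 0 \<and>
      smooth_on UNIV \<gamma> \<and>
      (\<forall>x\<in>ball p r. x \<in> \<Omega> \<longleftrightarrow> x \<bullet> \<nu> > \<gamma> (x - (x \<bullet> \<nu>) *\<^sub>R \<nu>)))"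

definition test_fun :: "'a::euclidean_space set \<Rightarrow> ('a \<Rightarrow> real) \<Rightarrow> bool" where
  "test_fun \<Omega> \<phi> \<longleftrightarrow> smooth_on UNIV \<phi> \<and> compact (closure {x. \<phi> x \<noteq> 0}) \<and>
      closure {x. \<phi> x \<noteq> 0} \<subseteq> \<Omega>"

definition L2_on :: "'a::euclidean_space set \<Rightarrow> ('a \<Rightarrow> real) \<Rightarrow> bool" where
  "L2_on \<Omega> u \<longleftrightarrow> (\<lambda>x. indicator \<Omega> x * u x) \<in> borel_measurable lebesgue \<and>
      set_integrable lebesgue \<Omega> (\<lambda>x. (u x)\<^sup>2)"

definition weak_grad :: "'a::euclidean_space set \<Rightarrow> ('a \<Rightarrow> real) \<Rightarrow> ('a \<Rightarrow> 'a) \<Rightarrow> bool" where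
  "weak_grad \<Omega> u G \<longleftrightarrow>
     (\<forall>K. compact K \<and> K \<subseteq> \<Omega> \<longrightarrow> set_integrable lebesgue K u \<and> set_integrable lebesgue K G) \<and>
     (\<forall>\<phi>. test_fun \<Omega> \<phi> \<longrightarrow> (\<forall>b\<in>Basis.
        (LINT x:\<Omega>|lebesgue. u x * pdiff b \<phi> x) = - (LINT x:\<Omega>|lebesgue. (G x \<bullet> b) * \<phi> x)))"

definition H10_grad :: "'a::euclidean_space set \<Rightarrow> ('a \<Rightarrow> real) \<Rightarrow> ('a \<Rightarrow> 'a) \<Rightarrow> bool" where
  "H10_grad \<Omega> u G \<longleftrightarrow> weak_grad \<Omega> u G \<and> L2_on \<Omega> u \<and> L2_on \<Omega> (\<lambda>x. norm (G x)) \<and>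
     (\<exists>\<phi>s. (\<forall>n. test_fun \<Omega> (\<phi>s n)) \<and>
        (\<lambda>n. LINT x:\<Omega>|lebesgue. (\<phi>s n x - u x)\<^sup>2) \<longlonglongrightarrow> 0 \<and>
        (\<lambda>n. LINT x:\<Omega>|lebesgue. (norm (cgrad (\<phi>s n) x - G x))\<^sup>2) \<longlonglongrightarrow> 0)"

definition H10 :: "'a::euclidean_space set \<Rightarrow> ('a \<Rightarrow> real) \<Rightarrow> bool" where
  "H10 \<Omega> u \<longleftrightarrow> (\<exists>G. H10_grad \<Omega> u G)"

definition dirichlet_eigenfun :: "'a::euclidean_space set \<Rightarrow> real \<Rightarrow> ('a \<Rightarrow> real) \<Rightarrow> bool" where
  "dirichlet_eigenfun \<Omega> lam u \<longleftrightarrow> (\<exists>G. H10_grad \<Omega> u G \<and>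
     \<not> (AE x in lebesgue. x \<in> \<Omega> \<longrightarrow> u x = 0) \<and>
     (\<forall>\<phi>. test_fun \<Omega> \<phi> \<longrightarrow>
        (LINT x:\<Omega>|lebesgue. G x \<bullet> cgrad \<phi> x) = lam * (LINT x:\<Omega>|lebesgue. u x * \<phi> x)))"

definition dirichlet_eigenvalue :: "'a::euclidean_space set \<Rightarrow> real \<Rightarrow> bool" where
  "dirichlet_eigenvalue \<Omega> lam \<longleftrightarrow> (\<exists>u. dirichlet_eigenfun \<Omega> lam u)"

end

(*
  Write g = u / \<Phi> with \<Phi> the first eigenfunction. Testing the eigenvalue equation of \<Phi> with
  \<phi>^2 / \<Phi> (Picone) gives \<integral> |\<nabla>u|^2 - lam1 \<integral> u^2 = \<integral> |\<nabla>g|^2 \<Phi>^2 for u in W_0^{1,2}. Hence a first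
  eigenfunction u has \<nabla>g = 0, so lam1 is simple because the domain is connected. By Rellich
  compactness the Rayleigh quotient attains its infimum on the complement of \<Phi>, the infimum is an
  eigenvalue, and simplicity makes it at least lam2; so (lam2 - lam1) \<integral> |g - a|^2 \<Phi>^2 \<le> \<integral> |\<nabla>g|^2 \<Phi>^2
  for some constant a. The bounds k0 \<Phi> \<le> S_m^m \<le> k1 \<Phi> replace \<Phi>^2 by S^{2m} at the cost of
  (k0 / k1)^2, S^{1+m} \<le> ||S||^{1-m} S^{2m}, and the weighted mean is the best constant.
  No regularity of \<Phi> is used: only that it is bounded below on compact subsets.
*)
theory Submission
  imports Defs "HOL-Complex_Analysis.Great_Picard" "HOL-Library.Diagonal_Subsequence"
begin


section \<open>Square integrable functions\<close>

text \<open>The obstacle is that \<Phi> is known only as a limit of test functions in the Sobolev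
  norm, so \<phi>^2 / \<Phi> is not a test function. It becomes admissible through a positive lower
  bound of \<Phi> on each compact subset, which comes from the solution S: it is continuous and
  positive, and (\<mu> S)^m \<le> k1 \<Phi>. The quotient is then reached through the bounded
  regularization s / (s^2 + \<delta>) of 1 / s. Passing from test functions to u in the Picone
  identity by Fatou yields only one inequality, whereas the weighted estimate needs the other one
  too; it follows by applying the inequality already known to the approximation error. Simplicity
  rests on the fact that a vanishing weak gradient forces a constant, which is derived here from
  translation invariance and Fubini instead of mollification. Since G is an arbitrary weak gradient
  of f / \<Phi>, it has to be identified almost everywhere with the field in the Picone identity.
  The scaling \<mu> disappears from the constant because \<mu>^(2m) enters the comparison of weights
  once on each side.\<close>

definition sq_int :: "'b measure \<Rightarrow> ('b \<Rightarrow> 'c::euclidean_space) \<Rightarrow> bool" where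
  "sq_int M u \<longleftrightarrow> u \<in> borel_measurable M \<and> integrable M (\<lambda>x. (norm (u x))\<^sup>2)"

definition ip :: "'b measure \<Rightarrow> ('b \<Rightarrow> 'c::euclidean_space) \<Rightarrow> ('b \<Rightarrow> 'c) \<Rightarrow> real" where
  "ip M u v = (\<integral>x. u x \<bullet> v x \<partial>M)"

definition l2 :: "'b measure \<Rightarrow> ('b \<Rightarrow> 'c::euclidean_space) \<Rightarrow> real" where
  "l2 M u = sqrt (\<integral>x. (norm (u x))\<^sup>2 \<partial>M)"

lemma sq_int_measurable: "sq_int M u \<Longrightarrow> u \<in> borel_measurable M"
  and sq_int_integrable: "sq_int M u \<Longrightarrow> integrable M (\<lambda>x. (norm (u x))\<^sup>2)"
  by (auto simp: sq_int_def)

text \<open>The target spaces may differ, so that a vector field can be dominated by a scalar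
  function and conversely.\<close>

lemma sq_int_bound:
  fixes u :: "'b \<Rightarrow> 'c::euclidean_space" and v :: "'b \<Rightarrow> 'd::euclidean_space"
  assumes "sq_int M v" "u \<in> borel_measurable M" "AE x in M. norm (u x) \<le> C * norm (v x)"
  shows "sq_int M u"
proof -
  have "integrable M (\<lambda>x. (norm (u x))\<^sup>2)"
  proof (rule Bochner_Integration.integrable_bound[where f="\<lambda>x. C\<^sup>2 * (norm (v x))\<^sup>2"])
    show "integrable M (\<lambda>x. C\<^sup>2 * (norm (v x))\<^sup>2)"
      using assms(1) by (auto simp: sq_int_def)
    show "AE x in M. norm ((norm (u x))\<^sup>2) \<le> norm (C\<^sup>2 * (norm (v x))\<^sup>2)"
      using assms(3)
    proof eventually_elim
      case (elim x)
      then have "(norm (u x))\<^sup>2 \<le> (C * norm (v x))\<^sup>2" by (intro power_mono) auto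
      then show ?case by (simp add: power_mult_distrib)
    qed
  qed (use assms(2) in measurable)
  then show ?thesis using assms by (simp add: sq_int_def)
qed

lemma sq_int_zero [simp]: "sq_int M (\<lambda>x. 0)"
  by (simp add: sq_int_def)

lemma sq_int_scaleR: "sq_int M u \<Longrightarrow> sq_int M (\<lambda>x. c *\<^sub>R u x)"
  by (rule sq_int_bound[where C="\<bar>c\<bar>"]) (auto simp: sq_int_def)

lemma sq_int_minus: "sq_int M u \<Longrightarrow> sq_int M (\<lambda>x. - u x)"
  by (auto simp: sq_int_def)

lemma norm_add_sq_le: "(norm (a + b))\<^sup>2 \<le> 2 * (norm a)\<^sup>2 + 2 * (norm b)\<^sup>2"
  for a b :: "'a::real_normed_vector"
proof -
  have "(norm (a + b))\<^sup>2 \<le> (norm a + norm b)\<^sup>2"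
    by (intro power_mono norm_triangle_ineq) auto
  also have "\<dots> \<le> 2 * (norm a)\<^sup>2 + 2 * (norm b)\<^sup>2"
    using sum_squares_bound[of "norm a" "norm b"] by (simp add: power2_sum)
  finally show ?thesis .
qed

lemma sq_int_add:
  assumes "sq_int M u" "sq_int M v"
  shows "sq_int M (\<lambda>x. u x + v x)"
proof -
  note [measurable] = assms[THEN sq_int_measurable]
  have "integrable M (\<lambda>x. (norm (u x + v x))\<^sup>2)"
  proof (rule Bochner_Integration.integrable_bound[where f="\<lambda>x. 2 * (norm (u x))\<^sup>2 + 2 * (norm (v x))\<^sup>2"])
    show "integrable M (\<lambda>x. 2 * (norm (u x))\<^sup>2 + 2 * (norm (v x))\<^sup>2)"
      using assms by (auto simp: sq_int_def)
  qed (use norm_add_sq_le in \<open>auto intro!: AE_I2\<close>)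
  then show ?thesis by (simp add: sq_int_def)
qed

lemma sq_int_diff: "sq_int M u \<Longrightarrow> sq_int M v \<Longrightarrow> sq_int M (\<lambda>x. u x - v x)"
  using sq_int_add[of M u "\<lambda>x. - v x"] sq_int_minus[of M v] by simp

lemma sq_int_norm: "sq_int M u \<Longrightarrow> sq_int M (\<lambda>x. norm (u x))"
  by (auto simp: sq_int_def)

lemma sq_int_mult_integrable:
  fixes u v :: "'b \<Rightarrow> real"
  assumes "sq_int M u" "sq_int M v"
  shows "integrable M (\<lambda>x. u x * v x)"
proof -
  note [measurable] = assms[THEN sq_int_measurable]
  show ?thesis
  proof (rule Bochner_Integration.integrable_bound[where f="\<lambda>x. (norm (u x))\<^sup>2 + (norm (v x))\<^sup>2"])
    show "integrable M (\<lambda>x. (norm (u x))\<^sup>2 + (norm (v x))\<^sup>2)"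
      using assms by (auto simp: sq_int_def)
    have "\<bar>a * b\<bar> \<le> a\<^sup>2 + b\<^sup>2" for a b :: real
    proof -
      have "0 \<le> \<bar>a\<bar> * \<bar>b\<bar>" by simp
      then show ?thesis
        using sum_squares_bound[of "\<bar>a\<bar>" "\<bar>b\<bar>"] unfolding abs_mult power2_abs by linarith
    qed
    then show "AE x in M. norm (u x * v x) \<le> norm ((norm (u x))\<^sup>2 + (norm (v x))\<^sup>2)"
      by (auto intro!: AE_I2)
  qed simp
qed

lemma sq_int_inner_integrable:
  assumes "sq_int M u" "sq_int M v"
  shows "integrable M (\<lambda>x. u x \<bullet> v x)"
proof (rule Bochner_Integration.integrable_bound[OF sq_int_mult_integrable[OF assms[THEN sq_int_norm]]])
  show "(\<lambda>x. u x \<bullet> v x) \<in> borel_measurable M"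
    using assms[THEN sq_int_measurable] by measurable
qed (auto intro!: AE_I2 simp: Cauchy_Schwarz_ineq2)

section \<open>Inner product and norm of square integrable functions\<close>

lemma ip_commute: "ip M u v = ip M v u"
  by (simp add: ip_def inner_commute)

lemma ip_add_left: "sq_int M u \<Longrightarrow> sq_int M v \<Longrightarrow> sq_int M w \<Longrightarrow>
    ip M (\<lambda>x. u x + v x) w = ip M u w + ip M v w"
  by (simp add: ip_def inner_add_left sq_int_inner_integrable)

lemma ip_diff_left: "sq_int M u \<Longrightarrow> sq_int M v \<Longrightarrow> sq_int M w \<Longrightarrow>
    ip M (\<lambda>x. u x - v x) w = ip M u w - ip M v w"
  by (simp add: ip_def inner_diff_left sq_int_inner_integrable)

lemma ip_scaleR_left: "ip M (\<lambda>x. c *\<^sub>R u x) w = c * ip M u w"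
  by (simp add: ip_def)

lemma ip_add_right: "sq_int M u \<Longrightarrow> sq_int M v \<Longrightarrow> sq_int M w \<Longrightarrow>
    ip M w (\<lambda>x. u x + v x) = ip M w u + ip M w v"
  by (simp add: ip_def inner_add_right sq_int_inner_integrable)

lemma ip_scaleR_right: "ip M w (\<lambda>x. c *\<^sub>R u x) = c * ip M w u"
  by (simp add: ip_def)

lemma ip_self_nonneg: "0 \<le> ip M u u"
  by (simp add: ip_def)

lemma l2_power2: "(l2 M u)\<^sup>2 = ip M u u"
  by (simp add: l2_def ip_def power2_norm_eq_inner)

lemma l2_nonneg [simp]: "0 \<le> l2 M u"
  by (simp add: l2_def)

lemma l2_norm: "l2 M (\<lambda>x. norm (u x)) = l2 M u"
  by (simp add: l2_def)

lemma l2_zero [simp]: "l2 M (\<lambda>x. 0) = 0"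
  by (simp add: l2_def)

lemma l2_scaleR: "l2 M (\<lambda>x. c *\<^sub>R u x) = \<bar>c\<bar> * l2 M u"
  by (simp add: l2_def power_mult_distrib real_sqrt_mult)

lemma l2_minus_commute: "l2 M (\<lambda>x. u x - v x) = l2 M (\<lambda>x. v x - u x)"
  by (simp add: l2_def norm_minus_commute)

lemma ip_add_scaled:
  assumes "sq_int M u" "sq_int M v"
  shows "ip M (\<lambda>x. u x + t *\<^sub>R v x) (\<lambda>x. u x + t *\<^sub>R v x) =
    ip M u u + 2 * t * ip M u v + t\<^sup>2 * ip M v v"
  using assms
  by (simp add: ip_add_left ip_add_right sq_int_add sq_int_scaleR ip_scaleR_left ip_scaleR_right
      ip_commute[of M v u] power2_eq_square algebra_simps)

text \<open>The quadratic is evaluated at its vertex \<open>- b / c\<close>; if it degenerates to an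
  affine function, nonnegativity forces the slope to vanish. This yields Cauchy-Schwarz and, with
  \<open>a = 0\<close>, the Euler-Lagrange equation of a minimizer.\<close>

lemma quadratic_nonneg_discriminant:
  fixes a b c :: real
  assumes "\<And>t. 0 \<le> a + 2 * t * b + t\<^sup>2 * c" "0 \<le> c"
  shows "b\<^sup>2 \<le> a * c"
proof (cases "c = 0")
  case True
  have "b = 0"
  proof (rule ccontr)
    assume "b \<noteq> 0"
    then show False
      \<comment> \<open>At this \<open>t\<close> the affine function takes the value -1.\<close>
      using assms(1)[of "- (a + 1) / (2 * b)"] True by (simp add: field_simps)
  qed
  then show ?thesis using True by simp
next
  case False
  then have "c > 0" using assms(2) by simp
  then have "0 \<le> (a + 2 * (- b / c) * b + (- b / c)\<^sup>2 * c) * c"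
    using assms(1)[of "- b / c"] by (intro mult_nonneg_nonneg) auto
  also have "\<dots> = a * c - b\<^sup>2"
    using \<open>c > 0\<close> by (simp add: field_simps power2_eq_square)
  finally show ?thesis by simp
qed

lemma ip_Cauchy_Schwarz:
  assumes "sq_int M u" "sq_int M v"
  shows "\<bar>ip M u v\<bar> \<le> l2 M u * l2 M v"
proof -
  have "(ip M u v)\<^sup>2 \<le> ip M u u * ip M v v"
  proof (rule quadratic_nonneg_discriminant)
    fix t :: real
    show "0 \<le> ip M u u + 2 * t * ip M u v + t\<^sup>2 * ip M v v"
      using ip_self_nonneg[of M "\<lambda>x. u x + t *\<^sub>R v x"] unfolding ip_add_scaled[OF assms] .
  qed (rule ip_self_nonneg)
  also have "\<dots> = (l2 M u * l2 M v)\<^sup>2"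
    by (simp add: l2_power2 power_mult_distrib)
  finally show ?thesis
    by (metis abs_le_square_iff abs_of_nonneg l2_nonneg mult_nonneg_nonneg)
qed

lemma l2_triangle:
  assumes "sq_int M u" "sq_int M v"
  shows "l2 M (\<lambda>x. u x + v x) \<le> l2 M u + l2 M v"
proof (rule power2_le_imp_le)
  have "(l2 M (\<lambda>x. u x + v x))\<^sup>2 = ip M u u + 2 * ip M u v + ip M v v"
    using ip_add_scaled[OF assms, of 1] by (simp add: l2_power2)
  also have "\<dots> \<le> (l2 M u + l2 M v)\<^sup>2"
    using ip_Cauchy_Schwarz[OF assms] by (simp add: power2_sum l2_power2)
  finally show "(l2 M (\<lambda>x. u x + v x))\<^sup>2 \<le> (l2 M u + l2 M v)\<^sup>2" .
qed simp

lemma l2_triangle_diff: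
  assumes "sq_int M u" "sq_int M v" "sq_int M w"
  shows "l2 M (\<lambda>x. u x - w x) \<le> l2 M (\<lambda>x. u x - v x) + l2 M (\<lambda>x. v x - w x)"
  using l2_triangle[of M "\<lambda>x. u x - v x" "\<lambda>x. v x - w x"] assms by (simp add: sq_int_diff)

lemma l2_le_diff:
  assumes "sq_int M u" "sq_int M v"
  shows "l2 M u \<le> l2 M v + l2 M (\<lambda>x. u x - v x)"
  using l2_triangle[of M v "\<lambda>x. u x - v x"] assms by (simp add: sq_int_diff)

lemma l2_eq_0:
  assumes "sq_int M u" "l2 M u = 0"
  shows "AE x in M. u x = 0"
proof -
  have "(\<integral>x. (norm (u x))\<^sup>2 \<partial>M) = 0" using assms(2) by (simp add: l2_def)
  then have "AE x in M. (norm (u x))\<^sup>2 = 0"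
    using integral_nonneg_eq_0_iff_AE[of M "\<lambda>x. (norm (u x))\<^sup>2"] assms(1) by (simp add: sq_int_def)
  then show ?thesis by simp
qed

lemma l2_mono:
  assumes "sq_int M v" "u \<in> borel_measurable M" "AE x in M. norm (u x) \<le> norm (v x)"
  shows "l2 M u \<le> l2 M v"
proof -
  have "sq_int M u" using sq_int_bound[of M v u 1] assms by simp
  moreover have "AE x in M. (norm (u x))\<^sup>2 \<le> (norm (v x))\<^sup>2"
    using assms(3) by eventually_elim (simp add: power_mono)
  ultimately show ?thesis
    using assms(1) unfolding l2_def sq_int_def by (intro real_sqrt_le_mono integral_mono_AE) auto
qed

lemma l2_bound:
  assumes "sq_int M v" "u \<in> borel_measurable M" "AE x in M. norm (u x) \<le> C * norm (v x)"
  shows "l2 M u \<le> \<bar>C\<bar> * l2 M v"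
proof -
  have "l2 M u \<le> l2 M (\<lambda>x. C *\<^sub>R v x)"
  proof (rule l2_mono[OF sq_int_scaleR[OF assms(1)] assms(2)])
    show "AE x in M. norm (u x) \<le> norm (C *\<^sub>R v x)"
      using assms(3)
    proof eventually_elim
      case (elim x)
      also have "C * norm (v x) \<le> \<bar>C\<bar> * norm (v x)" by (intro mult_right_mono) auto
      finally show ?case by simp
    qed
  qed
  then show ?thesis by (simp add: l2_scaleR)
qed

lemma l2_tendsto_ip:
  assumes "\<And>n. sq_int M (u n)" "sq_int M v" "sq_int M w" "(\<lambda>n. l2 M (\<lambda>x. u n x - v x)) \<longlonglongrightarrow> 0"
  shows "(\<lambda>n. ip M (u n) w) \<longlonglongrightarrow> ip M v w"
proof -
  have "(\<lambda>n. ip M (u n) w - ip M v w) \<longlonglongrightarrow> 0"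
  proof (rule Lim_null_comparison)
    show "\<forall>\<^sub>F n in sequentially. norm (ip M (u n) w - ip M v w) \<le> l2 M (\<lambda>x. u n x - v x) * l2 M w"
    proof (intro always_eventually allI)
      fix n
      have "ip M (u n) w - ip M v w = ip M (\<lambda>x. u n x - v x) w"
        using assms by (simp add: ip_diff_left)
      then show "norm (ip M (u n) w - ip M v w) \<le> l2 M (\<lambda>x. u n x - v x) * l2 M w"
        using ip_Cauchy_Schwarz[OF sq_int_diff[OF assms(1)[of n] assms(2)] assms(3)] by simp
    qed
    show "(\<lambda>n. l2 M (\<lambda>x. u n x - v x) * l2 M w) \<longlonglongrightarrow> 0"
      using tendsto_mult_left_zero[OF assms(4)] by simp
  qed
  then show ?thesis by (simp add: LIM_zero_iff)
qed

lemma l2_tendsto_l2: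
  assumes "\<And>n. sq_int M (u n)" "sq_int M v" "(\<lambda>n. l2 M (\<lambda>x. u n x - v x)) \<longlonglongrightarrow> 0"
  shows "(\<lambda>n. l2 M (u n)) \<longlonglongrightarrow> l2 M v"
proof -
  have "(\<lambda>n. l2 M (u n) - l2 M v) \<longlonglongrightarrow> 0"
  proof (rule Lim_null_comparison[OF _ assms(3)], intro always_eventually allI)
    fix n
    show "norm (l2 M (u n) - l2 M v) \<le> l2 M (\<lambda>x. u n x - v x)"
      using l2_le_diff[OF assms(1)[of n] assms(2)] l2_le_diff[OF assms(2) assms(1)[of n]]
        l2_minus_commute[of M "u n" v] by simp
  qed
  then show ?thesis by (simp add: LIM_zero_iff)
qed

section \<open>Almost everywhere limits, Fatou's lemma and completeness\<close>

lemma l2_tendsto_AE_subseq: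
  assumes "\<And>n. sq_int M (u n)" "sq_int M v" "(\<lambda>n. l2 M (\<lambda>x. u n x - v x)) \<longlonglongrightarrow> 0"
  obtains r :: "nat \<Rightarrow> nat" where "strict_mono r" "AE x in M. (\<lambda>n. u (r n) x) \<longlonglongrightarrow> v x"
proof -
  have "(\<lambda>n. (l2 M (\<lambda>x. u n x - v x))\<^sup>2) \<longlonglongrightarrow> 0"
    using tendsto_power[OF assms(3), of 2] by simp
  then have "(\<lambda>n. \<integral>x. norm ((norm (u n x - v x))\<^sup>2) \<partial>M) \<longlonglongrightarrow> 0"
    by (simp add: l2_def)
  moreover have "integrable M (\<lambda>x. (norm (u n x - v x))\<^sup>2)" for n
    using sq_int_diff[OF assms(1)[of n] assms(2)] by (simp add: sq_int_def)
  ultimately obtain r :: "nat \<Rightarrow> nat" where r: "strict_mono r"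
      "AE x in M. (\<lambda>n. (norm (u (r n) x - v x))\<^sup>2) \<longlonglongrightarrow> 0"
    using tendsto_L1_AE_subseq[of M "\<lambda>n x. (norm (u n x - v x))\<^sup>2"] by blast
  have "AE x in M. (\<lambda>n. u (r n) x) \<longlonglongrightarrow> v x"
    using r(2)
  proof eventually_elim
    case (elim x)
    then have "(\<lambda>n. norm (u (r n) x - v x)) \<longlonglongrightarrow> 0"
      using tendsto_real_sqrt[OF elim] by simp
    then show ?case using LIM_zero_iff tendsto_norm_zero_iff by blast
  qed
  then show ?thesis using r(1) that by blast
qed

text \<open>Square integrability of the limit is part of the conclusion. The bound is asked only
  from \<open>N\<close> on, because in the applications it holds only for late members of a
  convergent sequence.\<close>

lemma l2_Fatou:
  fixes u :: "nat \<Rightarrow> 'b \<Rightarrow> 'c::euclidean_space"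
  assumes "\<And>n. sq_int M (u n)" "v \<in> borel_measurable M" "AE x in M. (\<lambda>n. u n x) \<longlonglongrightarrow> v x"
    "\<And>n. n \<ge> N \<Longrightarrow> l2 M (u n) \<le> B"
  shows "sq_int M v" "l2 M v \<le> B"
proof -
  note [measurable] = assms(1)[THEN sq_int_measurable] assms(2)
  have B: "0 \<le> B" using order_trans[OF l2_nonneg assms(4)[OF order_refl]] .
  have "(\<integral>\<^sup>+x. ennreal ((norm (v x))\<^sup>2) \<partial>M) = (\<integral>\<^sup>+x. liminf (\<lambda>n. ennreal ((norm (u n x))\<^sup>2)) \<partial>M)"
  proof (rule nn_integral_cong_AE)
    show "AE x in M. ennreal ((norm (v x))\<^sup>2) = liminf (\<lambda>n. ennreal ((norm (u n x))\<^sup>2))"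
      using assms(3)
    proof eventually_elim
      case (elim x)
      then have "(\<lambda>n. ennreal ((norm (u n x))\<^sup>2)) \<longlonglongrightarrow> ennreal ((norm (v x))\<^sup>2)"
        by (intro tendsto_intros)
      then show ?case by (metis lim_imp_Liminf trivial_limit_sequentially)
    qed
  qed
  also have "\<dots> \<le> liminf (\<lambda>n. \<integral>\<^sup>+x. ennreal ((norm (u n x))\<^sup>2) \<partial>M)"
    by (rule nn_integral_liminf) measurable
  also have "\<dots> \<le> ennreal (B\<^sup>2)"
  proof -
    have "(\<integral>\<^sup>+x. ennreal ((norm (u n x))\<^sup>2) \<partial>M) \<le> ennreal (B\<^sup>2)" if "n \<ge> N" for n
    proof -
      have "(\<integral>\<^sup>+x. ennreal ((norm (u n x))\<^sup>2) \<partial>M) = ennreal ((l2 M (u n))\<^sup>2)"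
        using assms(1)[of n] by (simp add: sq_int_def l2_def nn_integral_eq_integral)
      also have "\<dots> \<le> ennreal (B\<^sup>2)"
        using assms(4)[OF that] by (intro ennreal_leI power_mono) auto
      finally show ?thesis .
    qed
    then show ?thesis
      by (intro Liminf_le) (auto simp: eventually_sequentially intro!: exI[of _ N])
  qed
  finally have *: "(\<integral>\<^sup>+x. ennreal ((norm (v x))\<^sup>2) \<partial>M) \<le> ennreal (B\<^sup>2)" .
  then have int: "integrable M (\<lambda>x. (norm (v x))\<^sup>2)"
    by (intro integrableI_bounded) (auto simp: less_top[symmetric] top_unique)
  then show "sq_int M v" by (simp add: sq_int_def)
  have "(\<integral>x. (norm (v x))\<^sup>2 \<partial>M) \<le> B\<^sup>2"
    using * nn_integral_eq_integral[OF int] by (simp add: ennreal_le_iff)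
  then show "l2 M v \<le> B"
    unfolding l2_def using B real_le_lsqrt by auto
qed

lemma (in finite_measure) sq_int_bounded:
  assumes "u \<in> borel_measurable M" "AE x in M. norm (u x) \<le> C"
  shows "sq_int M u"
proof (rule sq_int_bound[where v="\<lambda>x. 1 :: real"])
  show "sq_int M (\<lambda>x. 1 :: real)" by (simp add: sq_int_def)
  show "AE x in M. norm (u x) \<le> C * norm (1 :: real)" using assms(2) by simp
qed fact

lemma (in finite_measure) sq_int_imp_integrable:
  assumes "sq_int M u" shows "integrable M u"
proof -
  have "integrable M (\<lambda>x. norm (u x) * 1)"
    by (rule sq_int_mult_integrable[OF sq_int_norm[OF assms]]) (simp add: sq_int_def)
  then show ?thesis
    using assms by (simp add: sq_int_def integrable_norm_iff)
qed

text \<open>Cauchy-Schwarz against the constant 1; it turns small increments in the square norm into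
  small increments of integrals.\<close>

lemma (in finite_measure) integral_norm_le_l2:
  assumes "sq_int M u"
  shows "(\<integral>x. norm (u x) \<partial>M) \<le> sqrt (measure M (space M)) * l2 M u"
proof -
  have "ip M (\<lambda>x. norm (u x)) (\<lambda>x. 1) \<le> l2 M (\<lambda>x. norm (u x)) * l2 M (\<lambda>x. 1 :: real)"
    using ip_Cauchy_Schwarz[OF sq_int_norm[OF assms], of "\<lambda>x. 1"] by (simp add: sq_int_def)
  then show ?thesis by (simp add: l2_norm l2_def ip_def mult.commute)
qed

text \<open>Riesz--Fischer. A subsequence with summable increments converges almost everywhere.\<close>
lemma (in finite_measure) l2_complete:
  fixes u :: "nat \<Rightarrow> 'a \<Rightarrow> 'c::euclidean_space"
  assumes sq: "\<And>n. sq_int M (u n)"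
    and cau: "\<And>e. 0 < e \<Longrightarrow> \<exists>N. \<forall>m\<ge>N. \<forall>n\<ge>N. l2 M (\<lambda>x. u m x - u n x) < e"
  obtains v where "sq_int M v" "(\<lambda>n. l2 M (\<lambda>x. u n x - v x)) \<longlonglongrightarrow> 0"
proof -
  note [measurable] = sq[THEN sq_int_measurable]
  have "\<exists>N. \<forall>m\<ge>N. \<forall>n\<ge>N. l2 M (\<lambda>x. u m x - u n x) < (1/2)^k" for k :: nat
    by (rule cau) simp
  then obtain N where N: "\<And>k m n. m \<ge> N k \<Longrightarrow> n \<ge> N k \<Longrightarrow> l2 M (\<lambda>x. u m x - u n x) < (1/2)^k"
    by metis
  \<comment> \<open>The sum makes \<open>r n\<close> at least \<open>N n\<close>, the summand
    \<open>n\<close> makes \<open>r\<close> strictly increasing.\<close>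
  define r where "r n = (\<Sum>i\<le>n. N i) + n" for n
  have r: "strict_mono r" by (auto simp: r_def strict_mono_Suc_iff)
  have rN: "r n \<ge> N n" for n unfolding r_def by (simp add: sum.atMost_Suc trans_le_add1 member_le_sum)
  define d where "d n x = norm (u (r (Suc n)) x - u (r n) x)" for n x
  have d_int: "integrable M (d n)" for n
    unfolding d_def using sq_int_imp_integrable[OF sq_int_diff[OF sq sq]] by auto
  have d_nonneg: "0 \<le> d n x" for n x by (simp add: d_def)
  define C where "C = sqrt (measure M (space M))"
  have "C \<ge> 0" by (simp add: C_def)
  have d_le: "(\<integral>x. d n x \<partial>M) \<le> C * (1/2)^n" for n
  proof -
    have "(\<integral>x. d n x \<partial>M) \<le> C * l2 M (\<lambda>x. u (r (Suc n)) x - u (r n) x)"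
      unfolding d_def C_def by (rule integral_norm_le_l2[OF sq_int_diff[OF sq sq]])
    also have "\<dots> \<le> C * (1/2)^n"
    proof (rule mult_left_mono[OF less_imp_le[OF N] \<open>C \<ge> 0\<close>])
      show "N n \<le> r (Suc n)" using rN[of n] r by (meson le_SucI lessI less_imp_le order_trans strict_monoD)
    qed (rule rN)
    finally show ?thesis .
  qed
  \<comment> \<open>The integrals of the increments are dominated by a geometric series, so the
    series of increments is finite almost everywhere.\<close>
  have "AE x in M. (\<Sum>n. ennreal (d n x)) \<noteq> \<infinity>"
  proof (rule nn_integral_PInf_AE)
    have dm [measurable]: "d n \<in> borel_measurable M" for n unfolding d_def by measurable
    show "(\<lambda>x. \<Sum>n. ennreal (d n x)) \<in> borel_measurable M" by measurable
    have "(\<integral>\<^sup>+x. (\<Sum>n. ennreal (d n x)) \<partial>M) = (\<Sum>n. \<integral>\<^sup>+x. ennreal (d n x) \<partial>M)"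
      by (rule nn_integral_suminf) measurable
    also have "\<dots> \<le> (\<Sum>n. ennreal (C * (1/2)^n))"
    proof (rule suminf_le)
      fix n show "(\<integral>\<^sup>+x. ennreal (d n x) \<partial>M) \<le> ennreal (C * (1/2)^n)"
        using ennreal_leI[OF d_le[of n]] nn_integral_eq_integral[OF d_int, of n] d_nonneg by simp
    qed auto
    also have "\<dots> = ennreal (\<Sum>n. C * (1/2)^n)"
      using \<open>C \<ge> 0\<close> by (intro suminf_ennreal2 summable_mult summable_geometric) auto
    finally show "(\<integral>\<^sup>+x. (\<Sum>n. ennreal (d n x)) \<partial>M) \<noteq> \<infinity>"
      by (auto simp: top_unique)
  qed
  then have conv: "AE x in M. convergent (\<lambda>n. u (r n) x)"
  proof eventually_elim
    case (elim x)
    have "summable (\<lambda>n. d n x)"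
      using elim by (intro summable_suminf_not_top) (auto simp: d_def)
    then have "summable (\<lambda>n. u (r (Suc n)) x - u (r n) x)"
      unfolding d_def by (rule summable_norm_cancel)
    then show ?case
      by (simp add: summable_iff_convergent sum_lessThan_telescope[of "\<lambda>n. u (r n) x"]
          convergent_diff_const_right_iff)
  qed
  define v where "v x = lim (\<lambda>n. u (r n) x)" for x
  have [measurable]: "v \<in> borel_measurable M" unfolding v_def by measurable
  have lim: "AE x in M. (\<lambda>n. u (r n) x) \<longlonglongrightarrow> v x"
    using conv by eventually_elim (simp add: v_def convergent_LIMSEQ_iff)
  \<comment> \<open>Here \<open>m\<close> is fixed and only the second index runs along the
    subsequence; Fatou then controls the whole sequence, not just the subsequence.\<close>
  have fat: "sq_int M (\<lambda>x. u m x - v x)" "l2 M (\<lambda>x. u m x - v x) \<le> (1/2)^k" if "m \<ge> N k" for m k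
  proof -
    have lm: "AE x in M. (\<lambda>n. u m x - u (r n) x) \<longlonglongrightarrow> u m x - v x"
      using lim by eventually_elim (intro tendsto_intros)
    have le: "l2 M (\<lambda>x. u m x - u (r n) x) \<le> (1/2)^k" if "n \<ge> k" for n
    proof (rule less_imp_le[OF N[OF \<open>m \<ge> N k\<close>]])
      show "N k \<le> r n" using rN[of k] r that by (meson order_trans strict_mono_less_eq)
    qed
    show "sq_int M (\<lambda>x. u m x - v x)" "l2 M (\<lambda>x. u m x - v x) \<le> (1/2)^k"
      using l2_Fatou[of M "\<lambda>n x. u m x - u (r n) x" "\<lambda>x. u m x - v x" k "(1/2)^k", OF _ _ lm le]
      by (auto intro: sq_int_diff sq)
  qed
  have "sq_int M v"
    using sq_int_diff[OF sq[of "N 0"] fat(1)[of 0 "N 0"]] by simp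
  moreover have "(\<lambda>n. l2 M (\<lambda>x. u n x - v x)) \<longlonglongrightarrow> 0"
  proof (rule LIMSEQ_I)
    fix e :: real assume "0 < e"
    then obtain k :: nat where "(1/2)^k < e" using real_arch_pow_inv[of e "1/2"] by auto
    then show "\<exists>no. \<forall>n\<ge>no. norm (l2 M (\<lambda>x. u n x - v x) - 0) < e"
      using fat(2) by (intro exI[of _ "N k"]) fastforce
  qed
  ultimately show ?thesis using that by blast
qed

lemma l2_dominated_tendsto:
  fixes u :: "nat \<Rightarrow> 'b \<Rightarrow> 'c::euclidean_space" and w :: "'b \<Rightarrow> real"
  assumes "\<And>n. u n \<in> borel_measurable M" "sq_int M w" "\<And>n. AE x in M. norm (u n x) \<le> w x"
    and lim: "AE x in M. (\<lambda>n. u n x) \<longlonglongrightarrow> 0"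
  shows "(\<lambda>n. l2 M (u n)) \<longlonglongrightarrow> 0"
proof -
  have "(\<lambda>n. \<integral>x. (norm (u n x))\<^sup>2 \<partial>M) \<longlonglongrightarrow> (\<integral>x. 0 \<partial>M)"
  proof (rule integral_dominated_convergence[where w="\<lambda>x. (norm (w x))\<^sup>2"])
    show "AE x in M. (\<lambda>n. (norm (u n x))\<^sup>2) \<longlonglongrightarrow> 0"
      using lim by eventually_elim (simp add: tendsto_norm_zero_iff power_tendsto_0_iff)
    show "AE x in M. norm ((norm (u n x))\<^sup>2) \<le> (norm (w x))\<^sup>2" for n
      using assms(3)[of n]
    proof eventually_elim
      case (elim x)
      then have "(norm (u n x))\<^sup>2 \<le> (w x)\<^sup>2" by (intro power_mono) auto
      then show ?case by simp
    qed
  qed (use assms(1) sq_int_integrable[OF assms(2)] sq_int_measurable[OF assms(2)] in auto)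
  then show ?thesis unfolding l2_def using tendsto_real_sqrt by fastforce
qed


section \<open>Smooth functions and test functions\<close>

lemma pdiff_eqI: "(u has_derivative D) (at x) \<Longrightarrow> pdiff b u x = D b"
  unfolding pdiff_def using frechet_derivative_at by metis

text \<open>For \<open>k = 0\<close> the classical flat function; the other \<open>k\<close> make the family closed under
  differentiation.\<close>
definition flat :: "nat \<Rightarrow> real \<Rightarrow> real" where
  "flat k s = (if s > 0 then exp (- 1 / s) / s ^ k else 0)"

lemma flat_tendsto_0: "(flat k \<longlongrightarrow> 0) (at_right 0)"
proof -
  have "((\<lambda>y::real. y ^ k / exp y) \<longlongrightarrow> 0) at_top" by (rule tendsto_power_div_exp_0)
  then have "((\<lambda>s::real. (inverse s) ^ k / exp (inverse s)) \<longlongrightarrow> 0) (at_right 0)"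
    by (rule filterlim_compose[OF _ filterlim_inverse_at_top_right])
  moreover have "\<forall>\<^sub>F s in at_right 0. (inverse s) ^ k / exp (inverse s) = flat k s"
    using eventually_at_right_less[of "0::real"]
    by eventually_elim (simp add: flat_def exp_minus field_simps)
  ultimately show ?thesis by (rule Lim_transform_eventually)
qed

lemma flat_deriv: "(flat k has_real_derivative (flat (k + 2) s - real k * flat (Suc k) s)) (at s)"
proof -
  consider "s > 0" | "s < 0" | "s = 0" by linarith
  then show ?thesis
  proof cases
    case 1
    have "((\<lambda>s. exp (- 1 / s) / s ^ k) has_real_derivative
        (flat (k + 2) s - real k * flat (Suc k) s)) (at s)"
      using 1
      by (auto intro!: derivative_eq_intros simp: flat_def field_simps power2_eq_square)
        (cases k; cases "k - 1"; simp)
    then show ?thesis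
      by (rule has_field_derivative_transform_within[where d=s]) (use 1 in \<open>auto simp: flat_def dist_real_def\<close>)
  next
    case 2
    have "((\<lambda>s::real. 0::real) has_real_derivative 0) (at s)" by simp
    then have "(flat k has_real_derivative 0) (at s)"
      by (rule has_field_derivative_transform_within[where d="-s"]) (use 2 in \<open>auto simp: flat_def dist_real_def\<close>)
    then show ?thesis using 2 by (simp add: flat_def)
  next
    case 3
    have "((\<lambda>h. (flat k h - flat k 0) / (h - 0)) \<longlongrightarrow> 0) (at 0)"
    proof (rule filterlim_split_at)
      show "((\<lambda>h. (flat k h - flat k 0) / (h - 0)) \<longlongrightarrow> 0) (at_left 0)"
      proof (rule Lim_transform_eventually)
        show "\<forall>\<^sub>F x in at_left 0. 0 = (flat k x - flat k 0) / (x - 0)"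
          using eventually_at_left_real[of "-1" "0::real"] by (simp add: eventually_at_filter flat_def)
      qed simp
      show "((\<lambda>h. (flat k h - flat k 0) / (h - 0)) \<longlongrightarrow> 0) (at_right 0)"
      \<comment> \<open>The difference quotient of \<open>flat k\<close> at 0 is
        \<open>flat (Suc k)\<close> itself, which tends to 0.\<close>
      proof (rule Lim_transform_eventually[OF flat_tendsto_0[of "Suc k"]])
        show "\<forall>\<^sub>F x in at_right 0. flat (Suc k) x = (flat k x - flat k 0) / (x - 0)"
          using eventually_at_right_less[of "0::real"] by eventually_elim (simp add: flat_def)
      qed
    qed
    then have "(flat k has_real_derivative 0) (at 0)"
      by (simp add: has_field_derivative_iff)
    then show ?thesis using 3 by (simp add: flat_def)
  qed
qed

text \<open>An inductively generated algebra that is closed under partial derivatives; its members are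
  smooth by coinduction.\<close>
inductive smooth_alg :: "('a::euclidean_space \<Rightarrow> real) \<Rightarrow> bool" where
  base: "smooth_on UNIV u \<Longrightarrow> smooth_alg u"
| const: "smooth_alg (\<lambda>x. c)"
| flat: "smooth_alg (\<lambda>x. flat k (x \<bullet> a + t))"
| add: "smooth_alg u \<Longrightarrow> smooth_alg v \<Longrightarrow> smooth_alg (\<lambda>x. u x + v x)"
| mult: "smooth_alg u \<Longrightarrow> smooth_alg v \<Longrightarrow> smooth_alg (\<lambda>x. u x * v x)"
| inverse: "smooth_alg u \<Longrightarrow> (\<And>x. u x \<noteq> 0) \<Longrightarrow> smooth_alg (\<lambda>x. inverse (u x))"
| shift: "smooth_alg u \<Longrightarrow> smooth_alg (\<lambda>x. u (x + z))"

lemma pdiff_differentiable: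
  assumes "u differentiable (at x)"
  shows "(u has_derivative (\<lambda>v. frechet_derivative u (at x) v)) (at x)"
  using assms frechet_derivative_works by blast

lemma shift_has_derivative: "((\<lambda>x. x + z) has_derivative (\<lambda>w. w)) (at x)"
  for z :: "'a::real_normed_vector"
  by (auto intro!: derivative_eq_intros)

lemma affine_has_derivative: "((\<lambda>x. x \<bullet> a + t) has_derivative (\<lambda>v. v \<bullet> a)) (at x)"
  for a :: "'a::real_inner"
  by (auto intro!: derivative_eq_intros)

text \<open>The invariant behind the coinduction: sum, product, reciprocal and chain rules express
  every partial derivative by the same generators. The derivative of a reciprocal is written with
  products only, and that of \<open>flat k\<close> uses the exponents \<open>k + 2\<close> and
  \<open>Suc k\<close>.\<close>

lemma smooth_alg_pdiff:
  assumes "smooth_alg u"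
  shows "(\<forall>x. u differentiable (at x)) \<and> (\<forall>b\<in>Basis. smooth_alg (pdiff b u))"
  using assms
proof induction
  case (base u)
  then show ?case by cases (auto intro: smooth_alg.base)
next
  case (const c)
  have "pdiff b (\<lambda>x::'a. c) = (\<lambda>x. 0)" for b :: 'a
    by (rule ext, rule pdiff_eqI[where D="\<lambda>_. 0"]) simp
  then show ?case using smooth_alg.const[of 0] by auto
next
  case (flat k a t)
  have D: "((\<lambda>x. flat k (x \<bullet> a + t)) has_derivative
      (\<lambda>v. (flat (k + 2) (x \<bullet> a + t) - real k * flat (Suc k) (x \<bullet> a + t)) * (v \<bullet> a))) (at x)" for x
    by (rule has_derivative_compose[OF affine_has_derivative flat_deriv[unfolded has_field_derivative_def]])
  have "pdiff b (\<lambda>x. flat k (x \<bullet> a + t)) =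
      (\<lambda>x. (flat (k + 2) (x \<bullet> a + t) + (- real k) * flat (Suc k) (x \<bullet> a + t)) * (b \<bullet> a))" for b
    by (rule ext) (simp add: pdiff_eqI[OF D])
  moreover have "smooth_alg (\<lambda>x. (flat (k + 2) (x \<bullet> a + t) + (- real k) * flat (Suc k) (x \<bullet> a + t)) * (b \<bullet> a))" for b
    by (intro smooth_alg.add smooth_alg.mult smooth_alg.const smooth_alg.flat)
  ultimately show ?case using D by (auto simp: differentiable_def)
next
  case (add u v)
  have d: "u differentiable (at x)" "v differentiable (at x)" for x using add by auto
  have D: "pdiff b (\<lambda>x. u x + v x) x = frechet_derivative u (at x) b + frechet_derivative v (at x) b" for b x
    by (rule pdiff_eqI[OF has_derivative_add[OF d[THEN pdiff_differentiable]]])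
  have "pdiff b (\<lambda>x. u x + v x) = (\<lambda>x. pdiff b u x + pdiff b v x)" for b
    by (rule ext) (simp add: D pdiff_def[of b u] pdiff_def[of b v])
  then show ?case using add by (auto intro: smooth_alg.add)
next
  case (mult u v)
  have d: "u differentiable (at x)" "v differentiable (at x)" for x using mult by auto
  have D: "pdiff b (\<lambda>x. u x * v x) x = u x * frechet_derivative v (at x) b + frechet_derivative u (at x) b * v x" for b x
    by (rule pdiff_eqI[OF has_derivative_mult[OF d[THEN pdiff_differentiable]]])
  have "pdiff b (\<lambda>x. u x * v x) = (\<lambda>x. u x * pdiff b v x + pdiff b u x * v x)" for b
    by (rule ext) (simp add: D pdiff_def[of b u] pdiff_def[of b v])
  then show ?case using mult by (auto intro!: smooth_alg.add smooth_alg.mult)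
next
  case (inverse u)
  have d: "u differentiable (at x)" for x using inverse by auto
  have D: "((\<lambda>x. inverse (u x)) has_derivative
      (\<lambda>w. - (inverse (u x) * frechet_derivative u (at x) w * inverse (u x)))) (at x)" for x
    by (rule Deriv.has_derivative_inverse[OF inverse(2) pdiff_differentiable[OF d]])
  have "pdiff b (\<lambda>x. inverse (u x)) = (\<lambda>x. (-1) * (inverse (u x) * pdiff b u x * inverse (u x)))" for b
    by (rule ext) (simp add: pdiff_eqI[OF D], simp add: pdiff_def)
  moreover have "smooth_alg (\<lambda>x. (-1) * (inverse (u x) * pdiff b u x * inverse (u x)))" if "b \<in> Basis" for b
    using inverse that by (intro smooth_alg.mult smooth_alg.const smooth_alg.inverse) auto
  ultimately show ?case using D by (auto simp: differentiable_def)
next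
  case (shift u z)
  have d: "u differentiable (at x)" for x using shift(2) by simp
  have D: "((\<lambda>x. u (x + z)) has_derivative (\<lambda>w. frechet_derivative u (at (x + z)) w)) (at x)" for x
    by (rule has_derivative_compose[OF shift_has_derivative pdiff_differentiable[OF d]])
  have "pdiff b (\<lambda>x. u (x + z)) = (\<lambda>x. pdiff b u (x + z))" for b
    by (rule ext) (simp add: pdiff_eqI[OF D], simp add: pdiff_def)
  moreover have "smooth_alg (\<lambda>x. pdiff b u (x + z))" if "b \<in> Basis" for b
    by (rule smooth_alg.shift) (use shift(2) that in simp)
  ultimately show ?case using D unfolding differentiable_def by metis
qed

text \<open>A class of differentiable functions that is closed under partial derivatives is a
  post-fixed point of the operator defining \<open>smooth_on\<close>; continuity follows from
  differentiability.\<close>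

lemma smooth_alg_smooth:
  assumes "smooth_alg u" shows "smooth_on UNIV u"
  using assms
proof (coinduction arbitrary: u)
  case smooth_on
  then show ?case
    using smooth_alg_pdiff[OF smooth_on]
    by (auto intro!: differentiable_imp_continuous_on simp: differentiable_on_def)
qed

lemma smooth_const: "smooth_on UNIV (\<lambda>x. c)"
  and smooth_flat: "smooth_on UNIV (\<lambda>x. flat k (x \<bullet> a + t))"
  by (intro smooth_alg_smooth smooth_alg.const smooth_alg.flat)+

lemma smooth_add: "smooth_on UNIV u \<Longrightarrow> smooth_on UNIV v \<Longrightarrow> smooth_on UNIV (\<lambda>x. u x + v x)"
  by (rule smooth_alg_smooth, rule smooth_alg.add; erule smooth_alg.base)

lemma smooth_mult: "smooth_on UNIV u \<Longrightarrow> smooth_on UNIV v \<Longrightarrow> smooth_on UNIV (\<lambda>x. u x * v x)"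
  by (rule smooth_alg_smooth, rule smooth_alg.mult; erule smooth_alg.base)

lemma smooth_inverse: "smooth_on UNIV u \<Longrightarrow> (\<And>x. u x \<noteq> 0) \<Longrightarrow> smooth_on UNIV (\<lambda>x. inverse (u x))"
  by (rule smooth_alg_smooth, rule smooth_alg.inverse, erule smooth_alg.base)

lemma smooth_shift: "smooth_on UNIV u \<Longrightarrow> smooth_on UNIV (\<lambda>x. u (x + z))"
  by (rule smooth_alg_smooth, rule smooth_alg.shift, erule smooth_alg.base)

lemma smooth_prod: "finite I \<Longrightarrow> (\<And>i. i \<in> I \<Longrightarrow> smooth_on UNIV (u i)) \<Longrightarrow> smooth_on UNIV (\<lambda>x. \<Prod>i\<in>I. u i x)"
  by (induction I rule: finite_induct) (auto intro: smooth_const smooth_mult)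

section \<open>Calculus of the classical gradient\<close>

lemma cgrad_inner_Basis: "b \<in> Basis \<Longrightarrow> cgrad u x \<bullet> b = pdiff b u x"
  by (simp add: cgrad_def inner_sum_left inner_Basis if_distrib cong: if_cong)

lemma cgrad_eqI:
  assumes "(u has_derivative (\<lambda>v. g \<bullet> v)) (at x)"
  shows "cgrad u x = g"
  by (rule euclidean_eqI) (simp add: cgrad_inner_Basis pdiff_eqI[OF assms])

lemma has_derivative_cgrad:
  assumes "u differentiable (at x)"
  shows "(u has_derivative (\<lambda>v. cgrad u x \<bullet> v)) (at x)"
proof -
  have D: "(u has_derivative frechet_derivative u (at x)) (at x)"
    using assms frechet_derivative_works by blast
  then have lin: "linear (frechet_derivative u (at x))"
    by (rule has_derivative_linear)
  have "frechet_derivative u (at x) v = cgrad u x \<bullet> v" for v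
  proof -
    have "frechet_derivative u (at x) v = frechet_derivative u (at x) (\<Sum>b\<in>Basis. (v \<bullet> b) *\<^sub>R b)"
      by (simp add: euclidean_representation)
    also have "\<dots> = (\<Sum>b\<in>Basis. (v \<bullet> b) * pdiff b u x)"
      by (simp add: linear_sum[OF lin] linear_cmul[OF lin] pdiff_def)
    also have "\<dots> = cgrad u x \<bullet> v"
      by (simp add: cgrad_def inner_sum_left inner_commute[of v] mult.commute)
    finally show ?thesis .
  qed
  then show ?thesis using D by (metis ext)
qed

lemma smooth_has_derivative:
  assumes "smooth_on UNIV u"
  shows "(u has_derivative (\<lambda>v. cgrad u x \<bullet> v)) (at x)"
  using assms by cases (auto intro: has_derivative_cgrad)

lemma smooth_continuous: "smooth_on UNIV u \<Longrightarrow> continuous_on UNIV u"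
  by (erule smooth_on.cases) auto

lemma smooth_cgrad_continuous:
  assumes "smooth_on UNIV u" shows "continuous_on UNIV (cgrad u)"
proof -
  have "\<forall>b\<in>Basis. continuous_on UNIV (pdiff b u)"
    using assms by cases (auto intro: smooth_continuous)
  then show ?thesis unfolding cgrad_def[abs_def] by (intro continuous_intros) auto
qed

lemma cgrad_add:
  assumes "smooth_on UNIV u" "smooth_on UNIV v"
  shows "cgrad (\<lambda>x. u x + v x) x = cgrad u x + cgrad v x"
  by (rule cgrad_eqI, rule has_derivative_eq_rhs,
      rule has_derivative_add[OF assms[THEN smooth_has_derivative]]) (simp add: inner_add_left)

lemma cgrad_mult:
  assumes "smooth_on UNIV u" "smooth_on UNIV v"
  shows "cgrad (\<lambda>x. u x * v x) x = u x *\<^sub>R cgrad v x + v x *\<^sub>R cgrad u x"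
  by (rule cgrad_eqI, rule has_derivative_eq_rhs,
      rule has_derivative_mult[OF assms[THEN smooth_has_derivative]]) (simp add: inner_add_left mult.commute)

lemma cgrad_const: "cgrad (\<lambda>x. c) x = 0"
  by (rule cgrad_eqI) simp

lemma cgrad_cmult: "smooth_on UNIV u \<Longrightarrow> cgrad (\<lambda>x. c * u x) x = c *\<^sub>R cgrad u x"
  using cgrad_mult[OF smooth_const[of c]] by (simp add: cgrad_const)

lemma cgrad_shift:
  assumes "smooth_on UNIV u"
  shows "cgrad (\<lambda>x. u (x + z)) x = cgrad u (x + z)"
proof (rule cgrad_eqI)
  show "((\<lambda>x. u (x + z)) has_derivative (\<bullet>) (cgrad u (x + z))) (at x)"
    using has_derivative_compose[where f="\<lambda>x. x + z" and f'="\<lambda>w. w" and g=u and x=x and s=UNIV,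
        OF shift_has_derivative smooth_has_derivative[OF assms]] .
qed

section \<open>Test functions and their supports\<close>

lemma test_funI:
  assumes "smooth_on UNIV \<phi>" "compact K" "K \<subseteq> \<Omega>" "\<And>x. x \<notin> K \<Longrightarrow> \<phi> x = 0"
  shows "test_fun \<Omega> \<phi>"
proof -
  have K: "{x. \<phi> x \<noteq> 0} \<subseteq> K" using assms(4) by auto
  then have "closure {x. \<phi> x \<noteq> 0} \<subseteq> K"
    by (rule closure_minimal) (rule compact_imp_closed[OF assms(2)])
  moreover have "compact (closure {x. \<phi> x \<noteq> 0})"
    using bounded_subset[OF compact_imp_bounded[OF assms(2)] K] compact_closure by blast
  ultimately show ?thesis using assms(1,3) unfolding test_fun_def by blast
qed

text \<open>The complement of the support is open and the function vanishes on it, hence so does the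
  gradient.\<close>

lemma test_funE:
  assumes "test_fun \<Omega> \<phi>"
  obtains K where "compact K" "K \<subseteq> \<Omega>" "\<And>x. x \<notin> K \<Longrightarrow> \<phi> x = 0" "\<And>x. x \<notin> K \<Longrightarrow> cgrad \<phi> x = 0"
proof -
  define K where "K = closure {x. \<phi> x \<noteq> 0}"
  have K: "compact K" "K \<subseteq> \<Omega>" using assms unfolding test_fun_def K_def by blast+
  have 0: "\<phi> x = 0" if "x \<notin> K" for x
    using that closure_subset[of "{x. \<phi> x \<noteq> 0}"] unfolding K_def by blast
  have "cgrad \<phi> x = 0" if x: "x \<notin> K" for x
  proof (rule cgrad_eqI)
    have "((\<lambda>y. 0::real) has_derivative (\<lambda>v. 0 \<bullet> v)) (at x)" by simp
    then show "(\<phi> has_derivative (\<lambda>v. 0 \<bullet> v)) (at x)"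
    proof (rule has_derivative_transform_within_open)
      show "open (- K)" using K(1) by (simp add: compact_imp_closed open_Compl)
    qed (use x 0 in auto)
  qed
  then show ?thesis using that K 0 by blast
qed

lemma test_fun_smooth: "test_fun \<Omega> \<phi> \<Longrightarrow> smooth_on UNIV \<phi>"
  by (simp add: test_fun_def)

lemma test_fun_mult:
  assumes "test_fun \<Omega> \<phi>" "smooth_on UNIV u" shows "test_fun \<Omega> (\<lambda>x. \<phi> x * u x)"
proof (rule test_funE[OF assms(1)])
  fix K assume K: "compact K" "K \<subseteq> \<Omega>" "\<And>x. x \<notin> K \<Longrightarrow> \<phi> x = 0"
  show "test_fun \<Omega> (\<lambda>x. \<phi> x * u x)"
    by (rule test_funI[OF smooth_mult[OF test_fun_smooth[OF assms(1)] assms(2)] K(1,2)]) (simp add: K(3))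
qed

lemma test_fun_add:
  assumes "test_fun \<Omega> \<phi>" "test_fun \<Omega> \<psi>" shows "test_fun \<Omega> (\<lambda>x. \<phi> x + \<psi> x)"
proof (rule test_funE[OF assms(1)], rule test_funE[OF assms(2)])
  fix K L assume K: "compact K" "K \<subseteq> \<Omega>" "\<And>x. x \<notin> K \<Longrightarrow> \<phi> x = 0"
    and L: "compact L" "L \<subseteq> \<Omega>" "\<And>x. x \<notin> L \<Longrightarrow> \<psi> x = 0"
  have "K \<union> L \<subseteq> \<Omega>" using K(2) L(2) by simp
  then show "test_fun \<Omega> (\<lambda>x. \<phi> x + \<psi> x)"
    by (rule test_funI[OF smooth_add[OF assms[THEN test_fun_smooth]] compact_Un[OF K(1) L(1)]])
      (simp add: K(3) L(3))
qed

lemma test_fun_cmult: "test_fun \<Omega> \<phi> \<Longrightarrow> test_fun \<Omega> (\<lambda>x. c * \<phi> x)"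
  using test_fun_mult[OF _ smooth_const[of c], of \<Omega> \<phi>] by (simp add: mult.commute)

lemma test_fun_mono: "test_fun U \<phi> \<Longrightarrow> U \<subseteq> \<Omega> \<Longrightarrow> test_fun \<Omega> \<phi>"
  unfolding test_fun_def by (meson order_trans)

text \<open>The bump \<open>n\<close> increases to the indicator of the open box \<open>box a c\<close> as \<open>n\<close> grows.\<close>
definition bump :: "'a::euclidean_space \<Rightarrow> 'a \<Rightarrow> nat \<Rightarrow> 'a \<Rightarrow> real" where
  "bump a c n x = (\<Prod>b\<in>Basis. flat 0 (x \<bullet> (real n *\<^sub>R b) + (- real n * (a \<bullet> b))) *
      flat 0 (x \<bullet> (- real n *\<^sub>R b) + real n * (c \<bullet> b)))"

lemma flat0_bounds: "0 \<le> flat 0 s" "flat 0 s \<le> 1"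
  by (auto simp: flat_def)

lemma flat0_scaled_tendsto:
  assumes "s > 0" shows "(\<lambda>n. flat 0 (real n * s)) \<longlonglongrightarrow> 1"
proof -
  have "(\<lambda>n. exp (- (1 / s) * inverse (real n))) \<longlonglongrightarrow> exp (- (1 / s) * 0)"
    by (intro tendsto_intros lim_inverse_n)
  moreover have "\<forall>\<^sub>F n in sequentially. exp (- (1 / s) * inverse (real n)) = flat 0 (real n * s)"
    using eventually_gt_at_top[of "0::nat"]
    by eventually_elim (use assms in \<open>simp add: flat_def field_simps\<close>)
  ultimately have "(\<lambda>n. flat 0 (real n * s)) \<longlonglongrightarrow> exp (- (1 / s) * 0)"
    by (rule Lim_transform_eventually)
  then show ?thesis by simp
qed

lemma bump_smooth: "smooth_on UNIV (bump a c n)"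
  unfolding bump_def by (intro smooth_prod smooth_mult smooth_flat finite_Basis)

lemma bump_bounds: "0 \<le> bump a c n x \<and> bump a c n x \<le> 1"
  unfolding bump_def
  by (intro conjI prod_nonneg prod_le_1) (simp_all add: flat0_bounds mult_le_one)

lemma bump_factor:
  "flat 0 (x \<bullet> (real n *\<^sub>R b) + (- real n * (a \<bullet> b))) = flat 0 (real n * (x \<bullet> b - a \<bullet> b))"
  "flat 0 (x \<bullet> (- real n *\<^sub>R b) + real n * (c \<bullet> b)) = flat 0 (real n * (c \<bullet> b - x \<bullet> b))"
  by (simp_all add: algebra_simps)

lemma bump_zero: assumes "x \<notin> box a c" shows "bump a c n x = 0"
proof -
  obtain b where b: "b \<in> Basis" "x \<bullet> b \<le> a \<bullet> b \<or> c \<bullet> b \<le> x \<bullet> b"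
    using assms by (auto simp: mem_box not_less)
  then have "flat 0 (real n * (x \<bullet> b - a \<bullet> b)) * flat 0 (real n * (c \<bullet> b - x \<bullet> b)) = 0"
    by (auto simp: flat_def zero_less_mult_iff)
  then show ?thesis
    unfolding bump_def bump_factor using b(1) by (meson finite_Basis prod_zero)
qed

lemma bump_pos: assumes "x \<in> box a c" "n > 0" shows "bump a c n x > 0"
  unfolding bump_def bump_factor using assms
  by (intro prod_pos mult_pos_pos) (auto simp: mem_box flat_def)

lemma bump_tendsto: "(\<lambda>n. bump a c n x) \<longlonglongrightarrow> indicator (box a c) x"
proof (cases "x \<in> box a c")
  case True
  have "(\<lambda>n. \<Prod>b\<in>Basis. flat 0 (real n * (x \<bullet> b - a \<bullet> b)) * flat 0 (real n * (c \<bullet> b - x \<bullet> b)))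
      \<longlonglongrightarrow> (\<Prod>b\<in>(Basis::'a set). 1 * 1)"
    using True by (intro tendsto_prod tendsto_mult flat0_scaled_tendsto) (auto simp: mem_box)
  then show ?thesis using True unfolding bump_def bump_factor by simp
qed (simp add: bump_zero)

lemma test_fun_bump: "cbox a c \<subseteq> \<Omega> \<Longrightarrow> test_fun \<Omega> (bump a c n)"
  using box_subset_cbox[of a c] bump_zero[of _ a c n]
  by (intro test_funI[of _ "cbox a c"]) (auto intro: bump_smooth)


section \<open>Integration of test functions\<close>

lemma compact_support_bounded:
  fixes f :: "'a::euclidean_space \<Rightarrow> 'b::real_normed_vector"
  assumes "continuous_on UNIV f" "compact K" "\<And>x. x \<notin> K \<Longrightarrow> f x = 0"
  obtains B where "0 \<le> B" "\<And>x. norm (f x) \<le> B"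
proof -
  have "bounded (f ` K)"
    using assms by (meson compact_continuous_image compact_imp_bounded continuous_on_subset subset_UNIV)
  then obtain B where B: "\<And>x. x \<in> K \<Longrightarrow> norm (f x) \<le> B" by (auto simp: bounded_iff)
  have "norm (f x) \<le> max 0 B" for x
    by (cases "x \<in> K") (use B[of x] assms(3)[of x] in auto)
  then show ?thesis using that[of "max 0 B"] by simp
qed

lemma compact_support_integrable:
  fixes f :: "'a::euclidean_space \<Rightarrow> 'b::{banach, second_countable_topology}"
  assumes "continuous_on UNIV f" "compact K" "\<And>x. x \<notin> K \<Longrightarrow> f x = 0"
  shows "integrable lborel f"
proof -
  have "integrable lborel (\<lambda>x. indicator K x *\<^sub>R f x)"
    using assms by (intro borel_integrable_compact) (auto intro: continuous_on_subset)
  also have "(\<lambda>x. indicator K x *\<^sub>R f x) = f"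
    using assms(3) by (auto simp: indicator_def)
  finally show ?thesis .
qed

lemma lborel_integral_shift:
  fixes f :: "'a::euclidean_space \<Rightarrow> 'b::{banach, second_countable_topology}"
  assumes "f \<in> borel_measurable borel"
  shows "(\<integral>x. f (x + z) \<partial>lborel) = (\<integral>x. f x \<partial>lborel)"
proof -
  have "(\<integral>x. f x \<partial>lborel) = (\<integral>x. f x \<partial>(distr lborel borel ((+) z)))"
    by (simp add: lborel_distr_plus)
  also have "\<dots> = (\<integral>x. f (z + x) \<partial>lborel)"
    by (rule integral_distr) (use assms in auto)
  finally show ?thesis by (simp add: add.commute)
qed

lemma test_fun_cgrad_bounded:
  assumes "test_fun \<Omega> \<phi>"
  obtains L where "0 \<le> L" "\<And>x. norm (cgrad \<phi> x) \<le> L"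
  using assms test_funE compact_support_bounded[OF smooth_cgrad_continuous[OF test_fun_smooth[OF assms]]]
  by metis

lemma test_fun_bounded:
  assumes "test_fun \<Omega> \<phi>"
  obtains L where "0 \<le> L" "\<And>x. norm (\<phi> x) \<le> L"
  using assms test_funE compact_support_bounded[OF smooth_continuous[OF test_fun_smooth[OF assms]]]
  by metis

lemma smooth_Lipschitz:
  assumes "smooth_on UNIV \<phi>" "\<And>x. norm (cgrad \<phi> x) \<le> L"
  shows "\<bar>\<phi> x - \<phi> y\<bar> \<le> L * norm (x - y)"
proof -
  have "norm (\<phi> x - \<phi> y) \<le> L * norm (x - y)"
  proof (rule differentiable_bound[of UNIV])
    show "(\<phi> has_derivative (\<lambda>v. cgrad \<phi> x \<bullet> v)) (at x within UNIV)" for x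
      using smooth_has_derivative[OF assms(1)] by simp
    show "onorm ((\<bullet>) (cgrad \<phi> x)) \<le> L" for x
    proof (rule onorm_le)
      fix v
      have "norm (cgrad \<phi> x \<bullet> v) \<le> norm (cgrad \<phi> x) * norm v" by (simp add: Cauchy_Schwarz_ineq2)
      also have "\<dots> \<le> L * norm v" by (intro mult_right_mono assms(2)) simp
      finally show "norm (cgrad \<phi> x \<bullet> v) \<le> L * norm v" .
    qed
  qed auto
  then show ?thesis by simp
qed

text \<open>The steps are reciprocals of integers for two reasons: dominated convergence needs a
  sequence, and \<open>l2_translate_le\<close> cuts a translation into \<open>Suc n\<close> equal
  pieces.\<close>

lemma difference_quotient_tendsto:
  assumes "smooth_on UNIV u"
  shows "(\<lambda>n. (u (x + inverse (real (Suc n)) *\<^sub>R v) - u x) / inverse (real (Suc n))) \<longlonglongrightarrow> cgrad u x \<bullet> v"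
proof -
  have "((\<lambda>t. x + t *\<^sub>R v) has_derivative (\<lambda>t. t *\<^sub>R v)) (at 0)"
    by (auto intro!: derivative_eq_intros)
  moreover have "(u has_derivative (\<lambda>w. cgrad u x \<bullet> w)) (at (x + 0 *\<^sub>R v))"
    using smooth_has_derivative[OF assms] by simp
  ultimately have "((\<lambda>t. u (x + t *\<^sub>R v)) has_derivative (\<lambda>t. cgrad u x \<bullet> (t *\<^sub>R v))) (at 0)"
    by (rule has_derivative_compose)
  then have "((\<lambda>t. u (x + t *\<^sub>R v)) has_field_derivative (cgrad u x \<bullet> v)) (at 0)"
    by (rule has_derivative_imp_has_field_derivative) simp
  then have "((\<lambda>h. (u (x + h *\<^sub>R v) - u (x + 0 *\<^sub>R v)) / h) \<longlongrightarrow> cgrad u x \<bullet> v) (at 0)"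
    by (simp add: DERIV_def)
  moreover have "filterlim (\<lambda>n. inverse (real (Suc n))) (at 0) sequentially"
    using LIMSEQ_inverse_real_of_nat by (auto simp: filterlim_at)
  ultimately have "(\<lambda>n. (u (x + inverse (real (Suc n)) *\<^sub>R v) - u (x + 0 *\<^sub>R v)) / inverse (real (Suc n)))
      \<longlonglongrightarrow> cgrad u x \<bullet> v"
    by (rule filterlim_compose)
  then show ?thesis by simp
qed

lemma difference_quotient_bound:
  assumes "smooth_on UNIV \<phi>" "\<And>x. norm (cgrad \<phi> x) \<le> L" "0 \<le> L" "0 < t"
  shows "\<bar>(\<phi> (x + t *\<^sub>R v) - \<phi> x) / t\<bar> \<le> L * norm v"
  using smooth_Lipschitz[OF assms(1,2), of "x + t *\<^sub>R v" x] assms(3,4)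
  by (simp add: divide_le_eq abs_mult mult_ac)

text \<open>The mean value inequality bounds the quotients, and all their supports lie in one
  compact set. The majorant is a multiple of an indicator, so it serves for integrals and for square
  norms alike.\<close>

lemma test_fun_difference_quotient_dominated:
  assumes "test_fun \<Omega> \<phi>"
  shows "\<exists>K C. compact K \<and>
    (\<forall>n x. \<bar>(\<phi> (x + inverse (real (Suc n)) *\<^sub>R v) - \<phi> x) / inverse (real (Suc n))\<bar> \<le> indicator K x * C) \<and>
    (\<forall>x. \<bar>cgrad \<phi> x \<bullet> v\<bar> \<le> indicator K x * C)"
proof (rule test_funE[OF assms], rule test_fun_cgrad_bounded[OF assms])
  fix K L assume K: "compact K" "\<And>x. x \<notin> K \<Longrightarrow> \<phi> x = 0" "\<And>x. x \<notin> K \<Longrightarrow> cgrad \<phi> x = 0"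
    and L: "0 \<le> L" "\<And>x. norm (cgrad \<phi> x) \<le> L"
  \<comment> \<open>All steps have length at most \<open>norm v\<close>; outside this enlargement of
    \<open>K\<close> neither \<open>x\<close> nor a translate of it by such a step meets
    \<open>K\<close>.\<close>
  define K' where "K' = {x - s |x s. x \<in> K \<and> s \<in> cball 0 (norm v)}"
  have notin: "x + s \<notin> K" if "x \<notin> K'" "norm s \<le> norm v" for x s
    using that unfolding K'_def by (metis (mono_tags, lifting) add_diff_cancel_right' mem_Collect_eq mem_cball_0)
  show ?thesis
  proof (intro exI conjI allI)
    show "compact K'" unfolding K'_def by (intro compact_differences K(1)) simp
    fix x
    have "\<bar>cgrad \<phi> x \<bullet> v\<bar> \<le> L * norm v"
      using Cauchy_Schwarz_ineq2[of "cgrad \<phi> x" v] mult_right_mono[OF L(2)[of x], of "norm v"] by simp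
    then show "\<bar>cgrad \<phi> x \<bullet> v\<bar> \<le> indicator K' x * (L * norm v)"
      using notin[of x 0] K(3)[of x] by (cases "x \<in> K'") auto
    fix n
    show "\<bar>(\<phi> (x + inverse (real (Suc n)) *\<^sub>R v) - \<phi> x) / inverse (real (Suc n))\<bar> \<le> indicator K' x * (L * norm v)"
    proof (cases "x \<in> K'")
      case True
      then show ?thesis
        using difference_quotient_bound[OF test_fun_smooth[OF assms] L(2,1), of "inverse (real (Suc n))" x v] by simp
    next
      case False
      have "inverse (real (Suc n)) * norm v \<le> 1 * norm v"
        by (intro mult_right_mono) (auto simp: inverse_eq_divide divide_le_eq)
      then have "norm (inverse (real (Suc n)) *\<^sub>R v) \<le> norm v" by simp
      then show ?thesis using notin[OF False, of "inverse (real (Suc n)) *\<^sub>R v"] notin[OF False, of 0] K(2) L(1) by simp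
    qed
  qed
qed

lemma compact_support_shift:
  fixes f :: "'a::euclidean_space \<Rightarrow> real"
  assumes "compact K" "\<And>x. x \<notin> K \<Longrightarrow> f x = 0"
  obtains K' where "compact K'" "\<And>x. x \<notin> K' \<Longrightarrow> f (x + z) = 0"
proof (rule that)
  show "compact ((\<lambda>x. - z + x) ` K)" by (rule compact_translation[OF assms(1)])
  fix x assume "x \<notin> (\<lambda>x. - z + x) ` K"
  then have "x + z \<notin> K" by (metis add_uminus_conv_diff add.commute add_diff_cancel_right' image_eqI)
  then show "f (x + z) = 0" by (rule assms(2))
qed

text \<open>Translation invariance makes the integrals of the difference quotients vanish.\<close>
lemma integral_directional_derivative_test_fun:
  assumes "test_fun \<Omega> \<phi>"
  shows "(\<integral>x. cgrad \<phi> x \<bullet> v \<partial>lborel) = 0"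
proof -
  note sm = test_fun_smooth[OF assms]
  have meas: "\<phi> \<in> borel_measurable borel"
    using smooth_continuous[OF sm] by (rule borel_measurable_continuous_onI)
  have int: "integrable lborel (\<lambda>x. \<phi> (x + z))" for z
  proof (rule test_funE[OF assms])
    fix K assume K: "compact K" "\<And>x. x \<notin> K \<Longrightarrow> \<phi> x = 0"
    obtain K' where "compact K'" "\<And>x. x \<notin> K' \<Longrightarrow> \<phi> (x + z) = 0"
      using compact_support_shift[of K \<phi> z] K by blast
    then show ?thesis
      by (rule compact_support_integrable[OF smooth_continuous[OF smooth_shift[OF sm]]])
  qed
  have int0: "integrable lborel \<phi>" using int[of 0] by simp
  obtain K C where K: "compact K"
    "\<And>n x. \<bar>(\<phi> (x + inverse (real (Suc n)) *\<^sub>R v) - \<phi> x) / inverse (real (Suc n))\<bar> \<le> indicator K x * C"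
    using test_fun_difference_quotient_dominated[OF assms, of v] by auto
  define D where "D n x = (\<phi> (x + inverse (real (Suc n)) *\<^sub>R v) - \<phi> x) / inverse (real (Suc n))" for n x
  have "(\<lambda>n. \<integral>x. D n x \<partial>lborel) \<longlonglongrightarrow> (\<integral>x. cgrad \<phi> x \<bullet> v \<partial>lborel)"
  proof (rule integral_dominated_convergence[where w="\<lambda>x. indicator K x *\<^sub>R C"])
    show "(\<lambda>x. cgrad \<phi> x \<bullet> v) \<in> borel_measurable lborel"
      using smooth_cgrad_continuous[OF sm]
      by (auto intro!: borel_measurable_continuous_onI continuous_intros)
    show "D n \<in> borel_measurable lborel" for n
      unfolding D_def using int int0 by measurable
    show "integrable lborel (\<lambda>x. indicator K x *\<^sub>R C)"
      by (rule borel_integrable_compact[OF K(1)]) simp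
    show "AE x in lborel. (\<lambda>n. D n x) \<longlonglongrightarrow> cgrad \<phi> x \<bullet> v"
      unfolding D_def using difference_quotient_tendsto[OF sm] by simp
    show "AE x in lborel. norm (D n x) \<le> indicator K x *\<^sub>R C" for n
      using K(2) by (intro AE_I2) (simp add: D_def)
  qed
  moreover have "(\<integral>x. D n x \<partial>lborel) = 0" for n
    unfolding D_def using int int0 lborel_integral_shift[OF meas] by simp
  ultimately show ?thesis by (simp add: LIMSEQ_const_iff)
qed

section \<open>The space of weakly differentiable pairs\<close>

text \<open>An element of \<open>W\<^sub>0\<^sup>1\<^sup>,\<^sup>2\<close> is carried together with its gradient as one function into
  \<open>real \<times> 'a\<close>, so that the Sobolev norm is an \<open>L\<^sup>2\<close> norm.\<close>
definition jet :: "('a::euclidean_space \<Rightarrow> real) \<Rightarrow> 'a \<Rightarrow> real \<times> 'a" where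
  "jet \<phi> x = (\<phi> x, cgrad \<phi> x)"

text \<open>The closure of the jets of test functions in the square norm. The weak gradient identity
  is not part of the definition; it passes to the limit from the jets in
  \<open>H1_imp_weak_grad\<close>.\<close>

definition H1 :: "'a::euclidean_space set \<Rightarrow> ('a \<Rightarrow> real \<times> 'a) \<Rightarrow> bool" where
  "H1 \<Omega> F \<longleftrightarrow> sq_int (lebesgue_on \<Omega>) F \<and>
     (\<forall>e>0. \<exists>\<phi>. test_fun \<Omega> \<phi> \<and> l2 (lebesgue_on \<Omega>) (\<lambda>x. F x - jet \<phi> x) < e)"

lemma H1_sq_int: "H1 \<Omega> F \<Longrightarrow> sq_int (lebesgue_on \<Omega>) F"
  by (simp add: H1_def)

lemma measurable_fst_snd:
  fixes F :: "'b \<Rightarrow> 'c::euclidean_space \<times> 'd::euclidean_space"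
  assumes "F \<in> borel_measurable M"
  shows "(\<lambda>x. fst (F x)) \<in> borel_measurable M" "(\<lambda>x. snd (F x)) \<in> borel_measurable M"
  by (rule borel_measurable_continuous_on[OF _ assms], intro continuous_intros)+

lemma norm_fst_le_norm: "norm (fst p) \<le> norm p"
  and norm_snd_le_norm: "norm (snd p) \<le> norm p"
  by (cases p; simp add: norm_fst_le norm_snd_le)+

lemma sq_int_fst: "sq_int M F \<Longrightarrow> sq_int M (\<lambda>x. fst (F x))"
  by (rule sq_int_bound[where C=1 and v=F]) (auto intro!: AE_I2 measurable_fst_snd simp: sq_int_def norm_fst_le_norm)

lemma sq_int_snd: "sq_int M F \<Longrightarrow> sq_int M (\<lambda>x. snd (F x))"
  by (rule sq_int_bound[where C=1 and v=F]) (auto intro!: AE_I2 measurable_fst_snd simp: sq_int_def norm_snd_le_norm)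

lemma sq_int_Pair:
  assumes "sq_int M u" "sq_int M v" shows "sq_int M (\<lambda>x. (u x, v x))"
proof -
  have "(\<lambda>x. (norm (u x, v x))\<^sup>2) = (\<lambda>x. (norm (u x))\<^sup>2 + (norm (v x))\<^sup>2)"
    by (simp add: norm_Pair)
  moreover have "integrable M (\<lambda>x. (norm (u x))\<^sup>2 + (norm (v x))\<^sup>2)"
    using assms by (auto simp: sq_int_def)
  ultimately show ?thesis
    using assms unfolding sq_int_def by (auto intro: borel_measurable_Pair)
qed

lemma ip_Pair:
  assumes "sq_int M F" "sq_int M F'"
  shows "ip M F F' = ip M (\<lambda>x. fst (F x)) (\<lambda>x. fst (F' x)) + ip M (\<lambda>x. snd (F x)) (\<lambda>x. snd (F' x))"
  using assms unfolding ip_def inner_prod_def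
  by (intro Bochner_Integration.integral_add sq_int_inner_integrable sq_int_fst sq_int_snd)

lemma l2_fst_le: "sq_int M F \<Longrightarrow> l2 M (\<lambda>x. fst (F x)) \<le> l2 M F"
  by (rule l2_mono) (auto intro!: AE_I2 simp: norm_fst_le_norm sq_int_fst sq_int_measurable)

lemma l2_snd_le: "sq_int M F \<Longrightarrow> l2 M (\<lambda>x. snd (F x)) \<le> l2 M F"
  by (rule l2_mono) (auto intro!: AE_I2 simp: norm_snd_le_norm sq_int_snd sq_int_measurable)

lemma l2_pair_power2:
  assumes "sq_int M F"
  shows "(l2 M F)\<^sup>2 = (l2 M (\<lambda>x. fst (F x)))\<^sup>2 + (l2 M (\<lambda>x. snd (F x)))\<^sup>2"
  using ip_Pair[OF assms assms] by (simp add: l2_power2)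

lemma jet_add:
  assumes "test_fun \<Omega> \<phi>" "test_fun \<Omega> \<psi>"
  shows "jet (\<lambda>x. \<phi> x + \<psi> x) x = jet \<phi> x + jet \<psi> x"
  using cgrad_add[OF assms[THEN test_fun_smooth]] by (simp add: jet_def)

lemma jet_cmult: "test_fun \<Omega> \<phi> \<Longrightarrow> jet (\<lambda>x. c * \<phi> x) x = c *\<^sub>R jet \<phi> x"
  using cgrad_cmult[OF test_fun_smooth] by (simp add: jet_def)

text \<open>Boundedness makes the restricted measure finite, so constants are square integrable and
  square integrable functions are integrable. The locale is interpreted a second time on a small
  ball inside the domain.\<close>

locale bounded_open =
  fixes \<Omega> :: "'a::euclidean_space set"
  assumes open_dom: "open \<Omega>" and bounded_dom: "bounded \<Omega>"
begin

abbreviation M :: "'a measure" where "M \<equiv> lebesgue_on \<Omega>"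

lemma dom_sets [simp]: "\<Omega> \<in> sets lebesgue"
  using open_dom by auto

lemma finite_M: "finite_measure M"
  by (intro finite_measure_lebesgue_on lmeasurable_open bounded_dom open_dom)

sublocale finite_measure M by (rule finite_M)

lemma continuous_measurable_M: "continuous_on UNIV f \<Longrightarrow> f \<in> borel_measurable M"
  for f :: "'a \<Rightarrow> 'b::euclidean_space"
  by (rule continuous_imp_measurable_on_sets_lebesgue) (auto intro: continuous_on_subset)

lemma integral_M_set: "(\<integral>x. f x \<partial>M) = (LINT x:\<Omega>|lebesgue. f x)"
  for f :: "'a \<Rightarrow> 'b::euclidean_space"
  unfolding set_lebesgue_integral_def by (rule integral_restrict_space) simp

lemma integrable_M_set: "integrable M f \<longleftrightarrow> set_integrable lebesgue \<Omega> f"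
  for f :: "'a \<Rightarrow> 'b::euclidean_space"
  unfolding set_integrable_def by (rule integrable_restrict_space) simp

text \<open>The passage to \<open>lborel\<close>, where translation invariance and Fubini's theorem
  are available.\<close>

lemma integral_M_lborel:
  fixes f :: "'a \<Rightarrow> 'b::euclidean_space"
  assumes "continuous_on UNIV f" "\<And>x. x \<notin> \<Omega> \<Longrightarrow> f x = 0"
  shows "(\<integral>x. f x \<partial>M) = (\<integral>x. f x \<partial>lborel)"
proof -
  have "(\<integral>x. f x \<partial>M) = (\<integral>x. f x \<partial>lebesgue)"
    unfolding integral_M_set set_lebesgue_integral_def
    by (rule arg_cong[where f="integral\<^sup>L lebesgue"]) (use assms(2) in \<open>auto simp: indicator_def\<close>)
  also have "\<dots> = (\<integral>x. f x \<partial>lborel)"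
    using assms(1) by (intro integral_completion) (simp add: borel_measurable_continuous_onI)
  finally show ?thesis .
qed

lemma test_fun_outside: "test_fun \<Omega> \<phi> \<Longrightarrow> x \<notin> \<Omega> \<Longrightarrow> \<phi> x = 0 \<and> cgrad \<phi> x = 0"
  by (metis subsetD test_funE)

lemma sq_int_test_fun: assumes "test_fun \<Omega> \<phi>" shows "sq_int M \<phi>"
proof -
  obtain B where "\<And>x. norm (\<phi> x) \<le> B" using test_fun_bounded[OF assms] by metis
  then show ?thesis
    using continuous_measurable_M[OF smooth_continuous[OF test_fun_smooth[OF assms]]]
    by (intro sq_int_bounded) auto
qed

lemma sq_int_test_fun_cgrad: assumes "test_fun \<Omega> \<phi>" shows "sq_int M (cgrad \<phi>)"
proof -
  obtain B where "\<And>x. norm (cgrad \<phi> x) \<le> B" using test_fun_cgrad_bounded[OF assms] by metis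
  then show ?thesis
    using continuous_measurable_M[OF smooth_cgrad_continuous[OF test_fun_smooth[OF assms]]]
    by (intro sq_int_bounded) auto
qed

lemma sq_int_jet: "test_fun \<Omega> \<phi> \<Longrightarrow> sq_int M (jet \<phi>)"
  unfolding jet_def[abs_def] by (intro sq_int_Pair sq_int_test_fun sq_int_test_fun_cgrad)

section \<open>The closed linear space generated by the jets\<close>

lemma H1_jet: "test_fun \<Omega> \<phi> \<Longrightarrow> H1 \<Omega> (jet \<phi>)"
  unfolding H1_def using sq_int_jet by (auto intro!: exI[of _ \<phi>])

lemma H1_approx:
  assumes "H1 \<Omega> F"
  obtains \<phi> where "\<And>n. test_fun \<Omega> (\<phi> n)" "(\<lambda>n. l2 M (\<lambda>x. jet (\<phi> n) x - F x)) \<longlonglongrightarrow> 0"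
proof -
  have "\<forall>n. \<exists>\<phi>. test_fun \<Omega> \<phi> \<and> l2 M (\<lambda>x. F x - jet \<phi> x) < inverse (real (Suc n))"
    using assms unfolding H1_def by simp
  then obtain \<phi> where \<phi>: "\<And>n. test_fun \<Omega> (\<phi> n)"
      "\<And>n. l2 M (\<lambda>x. F x - jet (\<phi> n) x) < inverse (real (Suc n))" by metis
  have "(\<lambda>n. l2 M (\<lambda>x. F x - jet (\<phi> n) x)) \<longlonglongrightarrow> 0"
    by (rule Lim_null_comparison[OF _ LIMSEQ_inverse_real_of_nat])
      (use \<phi>(2) in \<open>auto intro!: always_eventually less_imp_le\<close>)
  then have "(\<lambda>n. l2 M (\<lambda>x. jet (\<phi> n) x - F x)) \<longlonglongrightarrow> 0"
    by (simp add: l2_minus_commute)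
  then show ?thesis by (rule that[OF \<phi>(1)])
qed

lemma H1_closed:
  assumes "\<And>n. H1 \<Omega> (F n)" "sq_int M G" "(\<lambda>n. l2 M (\<lambda>x. F n x - G x)) \<longlonglongrightarrow> 0"
  shows "H1 \<Omega> G"
  unfolding H1_def
proof (intro conjI allI impI assms(2))
  fix e :: real assume e: "0 < e"
  have "\<forall>\<^sub>F n in sequentially. l2 M (\<lambda>x. F n x - G x) < e/2"
    by (rule order_tendstoD(2)[OF assms(3)]) (use e in simp)
  then obtain n where n: "l2 M (\<lambda>x. F n x - G x) < e/2" by (auto simp: eventually_sequentially)
  obtain \<phi> where \<phi>: "test_fun \<Omega> \<phi>" "l2 M (\<lambda>x. F n x - jet \<phi> x) < e/2"
    using assms(1)[of n] e unfolding H1_def by (meson half_gt_zero)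
  have "l2 M (\<lambda>x. G x - jet \<phi> x) < e"
    using l2_triangle_diff[OF assms(2) H1_sq_int[OF assms(1)[of n]] sq_int_jet[OF \<phi>(1)]] n \<phi>(2)
      l2_minus_commute[of M G "F n"] by simp
  then show "\<exists>\<phi>. test_fun \<Omega> \<phi> \<and> l2 M (\<lambda>x. G x - jet \<phi> x) < e" using \<phi>(1) by blast
qed

lemma H1_add:
  assumes "H1 \<Omega> F" "H1 \<Omega> G" shows "H1 \<Omega> (\<lambda>x. F x + G x)"
  unfolding H1_def
proof (intro conjI allI impI sq_int_add assms[THEN H1_sq_int])
  fix e :: real assume "0 < e"
  then obtain \<phi> \<psi> where \<phi>: "test_fun \<Omega> \<phi>" "l2 M (\<lambda>x. F x - jet \<phi> x) < e/2"
      "test_fun \<Omega> \<psi>" "l2 M (\<lambda>x. G x - jet \<psi> x) < e/2"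
    using assms unfolding H1_def by (meson half_gt_zero)
  have "l2 M (\<lambda>x. F x + G x - jet (\<lambda>x. \<phi> x + \<psi> x) x) =
      l2 M (\<lambda>x. (F x - jet \<phi> x) + (G x - jet \<psi> x))"
    by (simp add: jet_add[OF \<phi>(1,3)] algebra_simps)
  also have "\<dots> < e"
    using l2_triangle[OF sq_int_diff[OF H1_sq_int[OF assms(1)] sq_int_jet[OF \<phi>(1)]]
        sq_int_diff[OF H1_sq_int[OF assms(2)] sq_int_jet[OF \<phi>(3)]]] \<phi>(2,4) by simp
  finally show "\<exists>\<phi>. test_fun \<Omega> \<phi> \<and> l2 M (\<lambda>x. F x + G x - jet \<phi> x) < e"
    using test_fun_add[OF \<phi>(1,3)] by blast
qed

lemma H1_scaleR:
  assumes "H1 \<Omega> F" shows "H1 \<Omega> (\<lambda>x. c *\<^sub>R F x)"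
proof -
  obtain \<phi> where \<phi>: "\<And>n. test_fun \<Omega> (\<phi> n)" "(\<lambda>n. l2 M (\<lambda>x. jet (\<phi> n) x - F x)) \<longlonglongrightarrow> 0"
    using H1_approx[OF assms] by blast
  show ?thesis
  proof (rule H1_closed)
    show "H1 \<Omega> (jet (\<lambda>x. c * \<phi> n x))" for n by (intro H1_jet test_fun_cmult \<phi>)
    have "(\<lambda>n. \<bar>c\<bar> * l2 M (\<lambda>x. jet (\<phi> n) x - F x)) \<longlonglongrightarrow> 0"
      using tendsto_mult_right_zero[OF \<phi>(2)] .
    then show "(\<lambda>n. l2 M (\<lambda>x. jet (\<lambda>x. c * \<phi> n x) x - c *\<^sub>R F x)) \<longlonglongrightarrow> 0"
      by (simp add: jet_cmult[OF \<phi>(1)] scaleR_diff_right[symmetric] l2_scaleR)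
  qed (rule sq_int_scaleR[OF H1_sq_int[OF assms]])
qed

lemma H1_diff: "H1 \<Omega> F \<Longrightarrow> H1 \<Omega> G \<Longrightarrow> H1 \<Omega> (\<lambda>x. F x - G x)"
  using H1_add[OF _ H1_scaleR[of G "-1"]] by simp

text \<open>Pairing a function against \<open>cross b\<close> of another one collects the two terms of the
  integration by parts formula.\<close>
definition cross :: "'a \<Rightarrow> real \<times> 'a \<Rightarrow> real \<times> 'a" where
  "cross b p = (snd p \<bullet> b, fst p *\<^sub>R b)"

lemma inner_cross: "p \<bullet> cross b q = fst p * (snd q \<bullet> b) + fst q * (snd p \<bullet> b)"
  by (simp add: cross_def inner_prod_def)

lemma ip_cross_commute: "ip M F (\<lambda>x. cross b (G x)) = ip M G (\<lambda>x. cross b (F x))"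
  by (simp add: ip_def inner_cross add.commute)

lemma sq_int_cross: assumes "sq_int M F" shows "sq_int M (\<lambda>x. cross b (F x))"
proof -
  have "sq_int M (\<lambda>x. snd (F x) \<bullet> b)"
    by (rule sq_int_bound[OF sq_int_snd[OF assms], where C="norm b"])
      (use sq_int_measurable[OF sq_int_snd[OF assms]] in
        \<open>auto intro!: AE_I2 simp: Cauchy_Schwarz_ineq2 mult.commute[of "norm b"]\<close>)
  moreover have "sq_int M (\<lambda>x. fst (F x) *\<^sub>R b)"
    by (rule sq_int_bound[OF sq_int_fst[OF assms], where C="norm b"])
      (use sq_int_measurable[OF sq_int_fst[OF assms]] in \<open>auto intro!: AE_I2\<close>)
  ultimately show ?thesis unfolding cross_def by (rule sq_int_Pair)
qed

text \<open>By the product rule the integrand is the derivative of the test function \<phi> \<psi>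
  in direction \<open>b\<close>, whose integral vanishes.\<close>

lemma ip_cross_test_fun:
  assumes "test_fun \<Omega> \<phi>" "test_fun \<Omega> \<psi>"
  shows "ip M (jet \<phi>) (\<lambda>x. cross b (jet \<psi> x)) = 0"
proof -
  note sm = assms[THEN test_fun_smooth]
  have t: "test_fun \<Omega> (\<lambda>x. \<phi> x * \<psi> x)" by (rule test_fun_mult[OF assms(1) sm(2)])
  have "ip M (jet \<phi>) (\<lambda>x. cross b (jet \<psi> x)) = (\<integral>x. cgrad (\<lambda>x. \<phi> x * \<psi> x) x \<bullet> b \<partial>M)"
    unfolding ip_def inner_cross by (simp add: jet_def cgrad_mult[OF sm] inner_add_left)
  also have "\<dots> = (\<integral>x. cgrad (\<lambda>x. \<phi> x * \<psi> x) x \<bullet> b \<partial>lborel)"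
    by (rule integral_M_lborel)
      (use smooth_cgrad_continuous[OF test_fun_smooth[OF t]] test_fun_outside[OF t] in
        \<open>auto intro!: continuous_intros\<close>)
  also have "\<dots> = 0" by (rule integral_directional_derivative_test_fun[OF t])
  finally show ?thesis .
qed

text \<open>For fixed second argument the pairing is continuous in the first. The limit is therefore
  taken in one argument at a time, with \<open>ip_cross_commute\<close> exchanging the
  roles.\<close>

lemma ip_cross_H1:
  assumes "H1 \<Omega> F" "H1 \<Omega> G"
  shows "ip M F (\<lambda>x. cross b (G x)) = 0"
proof -
  have 1: "ip M F (\<lambda>x. cross b (jet \<psi> x)) = 0" if F: "H1 \<Omega> F" and \<psi>: "test_fun \<Omega> \<psi>" for F \<psi>
  proof -
    obtain \<phi> where \<phi>: "\<And>n. test_fun \<Omega> (\<phi> n)" "(\<lambda>n. l2 M (\<lambda>x. jet (\<phi> n) x - F x)) \<longlonglongrightarrow> 0"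
      using H1_approx[OF F] by blast
    have "(\<lambda>n. ip M (jet (\<phi> n)) (\<lambda>x. cross b (jet \<psi> x))) \<longlonglongrightarrow> ip M F (\<lambda>x. cross b (jet \<psi> x))"
      by (intro l2_tendsto_ip sq_int_jet \<phi> \<psi> H1_sq_int[OF F] sq_int_cross)
    then show ?thesis using ip_cross_test_fun[OF \<phi>(1) \<psi>] by (simp add: LIMSEQ_const_iff)
  qed
  obtain \<psi> where \<psi>: "\<And>n. test_fun \<Omega> (\<psi> n)" "(\<lambda>n. l2 M (\<lambda>x. jet (\<psi> n) x - G x)) \<longlonglongrightarrow> 0"
    using H1_approx[OF assms(2)] by blast
  have "(\<lambda>n. ip M (jet (\<psi> n)) (\<lambda>x. cross b (F x))) \<longlonglongrightarrow> ip M G (\<lambda>x. cross b (F x))"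
    by (intro l2_tendsto_ip sq_int_jet \<psi> assms[THEN H1_sq_int] sq_int_cross)
  then show ?thesis
    using 1[OF assms(1) \<psi>(1)] by (simp add: LIMSEQ_const_iff ip_cross_commute[of _ b F])
qed

text \<open>A weak gradient comes with integrability on compact subsets only. The cut-offs to a
  compact exhaustion are measurable, and at every point they are eventually equal to
  \<open>G\<close>.\<close>

lemma locally_integrable_measurable:
  fixes G :: "'a \<Rightarrow> 'b::euclidean_space"
  assumes "\<And>K. compact K \<Longrightarrow> K \<subseteq> \<Omega> \<Longrightarrow> set_integrable lebesgue K G"
  shows "G \<in> borel_measurable M"
proof (rule open_Union_compact_subsets[OF open_dom])
  fix C :: "nat \<Rightarrow> 'a set"
  assume C: "\<And>n. compact (C n)" "\<And>n. C n \<subseteq> \<Omega>"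
      "\<And>K. compact K \<Longrightarrow> K \<subseteq> \<Omega> \<Longrightarrow> \<exists>N. \<forall>n\<ge>N. K \<subseteq> C n"
  have "(\<lambda>x. indicator (C n) x *\<^sub>R G x) \<in> borel_measurable lebesgue" for n
    using assms[OF C(1,2)] unfolding set_integrable_def by (rule borel_measurable_integrable)
  then have m: "(\<lambda>x. indicator (C n) x *\<^sub>R G x) \<in> borel_measurable M" for n
    by (rule measurable_restrict_space1)
  show "G \<in> borel_measurable M"
  proof (rule borel_measurable_LIMSEQ_metric[OF m])
    fix x assume "x \<in> space M"
    then have "x \<in> \<Omega>" by simp
    then obtain N where "\<forall>n\<ge>N. {x} \<subseteq> C n" using C(3)[of "{x}"] by auto
    then have "\<forall>\<^sub>F n in sequentially. indicator (C n) x *\<^sub>R G x = G x"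
      by (auto simp: eventually_sequentially intro!: exI[of _ N])
    then show "(\<lambda>n. indicator (C n) x *\<^sub>R G x) \<longlonglongrightarrow> G x" by (rule tendsto_eventually)
  qed
qed

section \<open>Comparison with the Sobolev notions and eigenvalues of the statement\<close>

lemma L2_on_sq_int:
  assumes "L2_on \<Omega> u" shows "sq_int M u"
proof -
  have "u \<in> borel_measurable M"
    using assms borel_measurable_restrict_space_iff[of \<Omega> lebesgue u] by (simp add: L2_on_def)
  then show ?thesis using assms by (simp add: L2_on_def sq_int_def integrable_M_set)
qed

lemma sq_int_L2_on:
  assumes "sq_int M u" shows "L2_on \<Omega> u"
  using assms borel_measurable_restrict_space_iff[of \<Omega> lebesgue u]
  by (simp add: L2_on_def sq_int_def integrable_M_set)

text \<open>\<open>L2_on\<close> speaks only of the norm of the gradient; measurability of the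
  vector field itself is recovered from the local integrability contained in
  \<open>weak_grad\<close>.\<close>

lemma H10_grad_imp_H1:
  assumes "H10_grad \<Omega> u G" shows "H1 \<Omega> (\<lambda>x. (u x, G x))"
proof -
  have w: "\<And>K. compact K \<Longrightarrow> K \<subseteq> \<Omega> \<Longrightarrow> set_integrable lebesgue K G"
    and L: "L2_on \<Omega> u" "L2_on \<Omega> (\<lambda>x. norm (G x))"
    using assms unfolding H10_grad_def weak_grad_def by blast+
  obtain \<phi> where \<phi>: "\<And>n. test_fun \<Omega> (\<phi> n)"
      "(\<lambda>n. LINT x:\<Omega>|lebesgue. (\<phi> n x - u x)\<^sup>2) \<longlonglongrightarrow> 0"
      "(\<lambda>n. LINT x:\<Omega>|lebesgue. (norm (cgrad (\<phi> n) x - G x))\<^sup>2) \<longlonglongrightarrow> 0"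
    using assms unfolding H10_grad_def by blast
  have u: "sq_int M u" by (rule L2_on_sq_int[OF L(1)])
  have G: "sq_int M G"
    using L2_on_sq_int[OF L(2)] locally_integrable_measurable[OF w] by (simp add: sq_int_def)
  have s: "sq_int M (\<lambda>x. (u x, G x))" by (rule sq_int_Pair[OF u G])
  have "(l2 M (\<lambda>x. jet (\<phi> n) x - (u x, G x)))\<^sup>2 =
      (LINT x:\<Omega>|lebesgue. (\<phi> n x - u x)\<^sup>2) + (LINT x:\<Omega>|lebesgue. (norm (cgrad (\<phi> n) x - G x))\<^sup>2)" for n
    unfolding l2_pair_power2[OF sq_int_diff[OF sq_int_jet[OF \<phi>(1)] s]]
    by (simp add: l2_def jet_def integral_M_set[symmetric])
  then have "(\<lambda>n. (l2 M (\<lambda>x. jet (\<phi> n) x - (u x, G x)))\<^sup>2) \<longlonglongrightarrow> 0"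
    using tendsto_add[OF \<phi>(2,3)] by simp
  then have "(\<lambda>n. l2 M (\<lambda>x. jet (\<phi> n) x - (u x, G x))) \<longlonglongrightarrow> 0"
    using tendsto_real_sqrt by fastforce
  then show ?thesis by (rule H1_closed[OF H1_jet[OF \<phi>(1)] s])
qed

lemma sq_int_locally_integrable:
  assumes "sq_int M u" "compact K" "K \<subseteq> \<Omega>" shows "set_integrable lebesgue K u"
proof (rule set_integrable_subset[of _ \<Omega>])
  show "set_integrable lebesgue \<Omega> u"
    using sq_int_imp_integrable[OF assms(1)] by (simp add: integrable_M_set)
qed (use assms in \<open>auto intro: lmeasurable_compact fmeasurableD\<close>)

lemma H1_imp_weak_grad:
  assumes "H1 \<Omega> F" shows "weak_grad \<Omega> (\<lambda>x. fst (F x)) (\<lambda>x. snd (F x))"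
  unfolding weak_grad_def
proof (intro conjI allI impI ballI)
  fix \<psi> and b :: 'a assume \<psi>: "test_fun \<Omega> \<psi>" and b: "b \<in> Basis"
  note s = H1_sq_int[OF assms]
  have "0 = (\<integral>x. fst (F x) * pdiff b \<psi> x + (snd (F x) \<bullet> b) * \<psi> x \<partial>M)"
    using ip_cross_H1[OF assms H1_jet[OF \<psi>], of b] unfolding ip_def inner_cross
    by (simp add: jet_def cgrad_inner_Basis[OF b] mult.commute)
  also have "\<dots> = (\<integral>x. fst (F x) * pdiff b \<psi> x \<partial>M) + (\<integral>x. (snd (F x) \<bullet> b) * \<psi> x \<partial>M)"
  proof (rule Bochner_Integration.integral_add)
    have "sq_int M (pdiff b \<psi>)"
      using sq_int_fst[OF sq_int_cross[OF sq_int_jet[OF \<psi>], of b]] cgrad_inner_Basis[OF b, of \<psi>]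
      by (simp add: cross_def jet_def)
    then show "integrable M (\<lambda>x. fst (F x) * pdiff b \<psi> x)"
      by (rule sq_int_mult_integrable[OF sq_int_fst[OF s]])
    show "integrable M (\<lambda>x. (snd (F x) \<bullet> b) * \<psi> x)"
      using sq_int_mult_integrable[OF sq_int_fst[OF sq_int_cross[OF s, of b]] sq_int_test_fun[OF \<psi>]]
      by (simp add: cross_def)
  qed
  finally show "(LINT x:\<Omega>|lebesgue. fst (F x) * pdiff b \<psi> x) = - (LINT x:\<Omega>|lebesgue. (snd (F x) \<bullet> b) * \<psi> x)"
    by (simp add: integral_M_set)
next
  fix K assume "compact K \<and> K \<subseteq> \<Omega>"
  then show "set_integrable lebesgue K (\<lambda>x. fst (F x))" "set_integrable lebesgue K (\<lambda>x. snd (F x))"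
    using sq_int_locally_integrable[OF sq_int_fst[OF H1_sq_int[OF assms]]]
      sq_int_locally_integrable[OF sq_int_snd[OF H1_sq_int[OF assms]]] by auto
qed

text \<open>This direction is what certifies the minimizer of the Rayleigh quotient as an
  eigenfunction in the sense of the definitions.\<close>

lemma H1_imp_H10_grad:
  assumes "H1 \<Omega> F" shows "H10_grad \<Omega> (\<lambda>x. fst (F x)) (\<lambda>x. snd (F x))"
  unfolding H10_grad_def
proof (intro conjI H1_imp_weak_grad[OF assms])
  note s = H1_sq_int[OF assms]
  show "L2_on \<Omega> (\<lambda>x. fst (F x))" "L2_on \<Omega> (\<lambda>x. norm (snd (F x)))"
    using s by (auto intro!: sq_int_L2_on sq_int_norm sq_int_fst sq_int_snd)
  obtain \<phi> where \<phi>: "\<And>n. test_fun \<Omega> (\<phi> n)" "(\<lambda>n. l2 M (\<lambda>x. jet (\<phi> n) x - F x)) \<longlonglongrightarrow> 0"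
    using H1_approx[OF assms] by blast
  have sd: "sq_int M (\<lambda>x. jet (\<phi> n) x - F x)" for n by (intro sq_int_diff sq_int_jet \<phi> s)
  have fst_le: "l2 M (\<lambda>x. fst (jet (\<phi> n) x - F x)) \<le> l2 M (\<lambda>x. jet (\<phi> n) x - F x)" for n
    by (rule l2_fst_le[OF sd])
  have "(\<lambda>n. (l2 M (\<lambda>x. fst (jet (\<phi> n) x - F x)))\<^sup>2) \<longlonglongrightarrow> 0\<^sup>2"
    by (intro tendsto_power, rule Lim_null_comparison[OF _ \<phi>(2)]) (use fst_le in simp)
  moreover have "(l2 M (\<lambda>x. fst (jet (\<phi> n) x - F x)))\<^sup>2 = (LINT x:\<Omega>|lebesgue. (\<phi> n x - fst (F x))\<^sup>2)" for n
    by (simp add: l2_def jet_def integral_M_set[symmetric])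
  ultimately have 1: "(\<lambda>n. LINT x:\<Omega>|lebesgue. (\<phi> n x - fst (F x))\<^sup>2) \<longlonglongrightarrow> 0"
    by (simp only: zero_power2)
  have snd_le: "l2 M (\<lambda>x. snd (jet (\<phi> n) x - F x)) \<le> l2 M (\<lambda>x. jet (\<phi> n) x - F x)" for n
    by (rule l2_snd_le[OF sd])
  have "(\<lambda>n. (l2 M (\<lambda>x. snd (jet (\<phi> n) x - F x)))\<^sup>2) \<longlonglongrightarrow> 0\<^sup>2"
    by (intro tendsto_power, rule Lim_null_comparison[OF _ \<phi>(2)]) (use snd_le in simp)
  moreover have "(l2 M (\<lambda>x. snd (jet (\<phi> n) x - F x)))\<^sup>2 =
      (LINT x:\<Omega>|lebesgue. (norm (cgrad (\<phi> n) x - snd (F x)))\<^sup>2)" for n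
    by (simp add: l2_def jet_def integral_M_set[symmetric])
  ultimately have 2: "(\<lambda>n. LINT x:\<Omega>|lebesgue. (norm (cgrad (\<phi> n) x - snd (F x)))\<^sup>2) \<longlonglongrightarrow> 0"
    by (simp only: zero_power2)
  show "\<exists>\<phi>s. (\<forall>n. test_fun \<Omega> (\<phi>s n)) \<and>
        (\<lambda>n. LINT x:\<Omega>|lebesgue. (\<phi>s n x - fst (F x))\<^sup>2) \<longlonglongrightarrow> 0 \<and>
        (\<lambda>n. LINT x:\<Omega>|lebesgue. (norm (cgrad (\<phi>s n) x - snd (F x)))\<^sup>2) \<longlonglongrightarrow> 0"
    using \<phi>(1) 1 2 by blast
qed

lemma AE_M_iff: "(AE x in M. P x) \<longleftrightarrow> (AE x in lebesgue. x \<in> \<Omega> \<longrightarrow> P x)"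
  by (rule AE_restrict_space_iff) simp

lemma dirichlet_eigenvalueI:
  assumes "H1 \<Omega> F" "l2 M (\<lambda>x. fst (F x)) \<noteq> 0"
    and "\<And>\<phi>. test_fun \<Omega> \<phi> \<Longrightarrow> ip M (\<lambda>x. snd (F x)) (cgrad \<phi>) = lam * ip M (\<lambda>x. fst (F x)) \<phi>"
  shows "dirichlet_eigenvalue \<Omega> lam"
  unfolding dirichlet_eigenvalue_def dirichlet_eigenfun_def
proof (intro exI conjI allI impI)
  show "H10_grad \<Omega> (\<lambda>x. fst (F x)) (\<lambda>x. snd (F x))" by (rule H1_imp_H10_grad[OF assms(1)])
  show "\<not> (AE x in lebesgue. x \<in> \<Omega> \<longrightarrow> fst (F x) = 0)"
  proof
    assume "AE x in lebesgue. x \<in> \<Omega> \<longrightarrow> fst (F x) = 0"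
    then have "AE x in M. (norm (fst (F x)))\<^sup>2 = 0" by (simp add: AE_M_iff)
    then have "(\<integral>x. (norm (fst (F x)))\<^sup>2 \<partial>M) = 0" by (rule integral_eq_zero_AE)
    then show False using assms(2) by (simp add: l2_def)
  qed
  show "(LINT x:\<Omega>|lebesgue. snd (F x) \<bullet> cgrad \<phi> x) = lam * (LINT x:\<Omega>|lebesgue. fst (F x) * \<phi> x)"
    if "test_fun \<Omega> \<phi>" for \<phi>
    using assms(3)[OF that] by (simp add: ip_def integral_M_set)
qed

end


section \<open>The fundamental lemma of the calculus of variations\<close>

lemma AE_lebesgue_negligible: "(AE x in lebesgue. P x) \<longleftrightarrow> negligible {x. \<not> P x}"
proof
  assume "AE x in lebesgue. P x"
  then obtain N where "N \<in> null_sets lebesgue" "{x. \<not> P x} \<subseteq> N"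
    by (auto simp: eventually_ae_filter)
  then show "negligible {x. \<not> P x}"
    by (meson negligible_iff_null_sets negligible_subset)
next
  assume "negligible {x. \<not> P x}"
  then have "{x. \<not> P x} \<in> null_sets lebesgue" by (simp add: negligible_iff_null_sets)
  then show "AE x in lebesgue. P x" using AE_not_in by fastforce
qed

text \<open>A Lindelof argument in the guise of \<open>locally_negligible_alt\<close>: a locally
  negligible exceptional set is negligible.\<close>

lemma AE_lebesgue_local:
  assumes "\<And>x. x \<in> \<Omega> \<Longrightarrow> \<exists>U. open U \<and> x \<in> U \<and> (AE y in lebesgue. y \<in> U \<longrightarrow> P y)"
  shows "AE y in lebesgue. y \<in> \<Omega> \<longrightarrow> P y"
proof -
  let ?S = "{y. \<not> (y \<in> \<Omega> \<longrightarrow> P y)}"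
  have "negligible ?S"
  proof (subst locally_negligible_alt, intro ballI)
    fix x assume x: "x \<in> ?S"
    then obtain U where U: "open U" "x \<in> U" "AE y in lebesgue. y \<in> U \<longrightarrow> P y" using assms by auto
    have "negligible (?S \<inter> U)"
      using U(3) unfolding AE_lebesgue_negligible by (rule negligible_subset) auto
    moreover have "openin (top_of_set ?S) (?S \<inter> U)" using U(1) by (simp add: openin_open_Int)
    ultimately show "\<exists>V. openin (top_of_set ?S) V \<and> x \<in> V \<and> negligible V"
      using x U(2) by (intro exI[of _ "?S \<inter> U"]) auto
  qed
  then show ?thesis by (simp only: AE_lebesgue_negligible)
qed

text \<open>A pi-lambda argument: the boxes are stable under intersection and generate the Borel
  sets, and vanishing of the set integral passes to complements and disjoint unions. The total
  integral is a separate hypothesis, used for complements, because the whole space is not a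
  box.\<close>

lemma lborel_AE_zero_of_boxes:
  fixes g :: "'a::euclidean_space \<Rightarrow> real"
  assumes g: "integrable lborel g" and 0: "\<And>p q. (LINT x:box p q|lborel. g x) = 0"
    and univ: "(\<integral>x. g x \<partial>lborel) = 0"
  shows "AE x in lborel. g x = 0"
proof (rule sigma_finite_measure.density_zero[OF sigma_finite_lborel g])
  fix A :: "'a set" assume "A \<in> sets lborel"
  then have A: "A \<in> sigma_sets UNIV (range (\<lambda>(a, b). box a b))"
    by (simp add: borel_eq_box)
  have si: "set_integrable lborel B g" if "B \<in> sets borel" for B
    unfolding set_integrable_def using that integrable_mult_indicator[OF _ g] by simp
  have sb: "B \<in> sets borel" if "B \<in> sigma_sets UNIV (range (\<lambda>(a, b). box a b))" for B :: "'a set"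
    using that by (simp add: borel_eq_box)
  have stable: "Int_stable (range (\<lambda>(a, b). box a b :: 'a set))"
    by (auto simp: Int_stable_def box_Int_box)
  show "(LINT x:A|lborel. g x) = 0"
    using A
  proof (induction A rule: sigma_sets_induct_disjoint[OF stable subset_UNIV[of "range (\<lambda>(a, b). box a b)", folded Pow_UNIV],
      consumes 1, case_names basic empty compl union])
    case (basic B) then show ?case using 0 by auto
  next
    case empty show ?case by (simp add: set_lebesgue_integral_def)
  next
    case (compl B)
    have B: "B \<in> sets borel" using compl(1) by (rule sb)
    have "(LINT x:(UNIV - B) \<union> B|lborel. g x) = (LINT x:UNIV - B|lborel. g x) + (LINT x:B|lborel. g x)"
      using B by (intro set_integral_Un si) auto
    then show ?case using compl(2) univ by (simp add: set_lebesgue_integral_def)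
  next
    case (union B)
    have "(LINT x:(\<Union>i. B i)|lborel. g x) = (\<Sum>i. (LINT x:B i|lborel. g x))"
    proof (rule lebesgue_integral_countable_add)
      show "B i \<in> sets lborel" for i using union(2) sb by auto
      then show "set_integrable lborel (\<Union>i. B i) g" by (intro si) auto
      show "B i \<inter> B j = {}" if "i \<noteq> j" for i j
        using union(1) that by (auto simp: disjoint_family_on_def)
    qed
    then show ?case using union(3) by simp
  qed
qed

text \<open>Bumps increase to indicators of boxes, so integrals over subboxes vanish by dominated
  convergence. Cutting \<open>g\<close> off to the large box reduces arbitrary boxes to
  subboxes.\<close>

lemma lborel_AE_zero_of_bumps:
  fixes g :: "'a::euclidean_space \<Rightarrow> real"
  assumes g: "integrable lborel g"
    and 0: "\<And>p q n. cbox p q \<subseteq> cbox a c \<Longrightarrow> (\<integral>x. g x * bump p q n x \<partial>lborel) = 0"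
  shows "AE x in lborel. x \<in> box a c \<longrightarrow> g x = 0"
proof -
  have sub: "(\<integral>x. g x * indicator (box p q) x \<partial>lborel) = 0" if pq: "cbox p q \<subseteq> cbox a c" for p q
  proof -
    have "(\<lambda>n. \<integral>x. g x * bump p q n x \<partial>lborel) \<longlonglongrightarrow> (\<integral>x. g x * indicator (box p q) x \<partial>lborel)"
    proof (rule integral_dominated_convergence[where w="\<lambda>x. norm (g x)"])
      note [measurable] = borel_measurable_integrable[OF g]
      have [measurable]: "bump p q n \<in> borel_measurable borel" for n
        using smooth_continuous[OF bump_smooth] by (rule borel_measurable_continuous_onI)
      show "(\<lambda>x. g x * indicator (box p q) x) \<in> borel_measurable lborel"
        "(\<lambda>x. g x * bump p q n x) \<in> borel_measurable lborel" for n
        using borel_open[OF open_box] by measurable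
      show "AE x in lborel. (\<lambda>n. g x * bump p q n x) \<longlonglongrightarrow> g x * indicator (box p q) x"
        by (intro AE_I2 tendsto_mult tendsto_const bump_tendsto)
      show "AE x in lborel. norm (g x * bump p q n x) \<le> norm (g x)" for n
        using bump_bounds[of p q n] by (intro AE_I2) (auto simp: abs_mult intro!: mult_left_le)
    qed (use g in auto)
    then show ?thesis using 0[OF pq] by (simp add: LIMSEQ_const_iff)
  qed
  define g' where "g' x = g x * indicator (box a c) x" for x
  have g': "integrable lborel g'"
    unfolding g'_def using integrable_mult_indicator[of "box a c" lborel g] g
    by (simp add: mult.commute)
  have "AE x in lborel. g' x = 0"
  proof (rule lborel_AE_zero_of_boxes[OF g'])
    show "(\<integral>x. g' x \<partial>lborel) = 0" unfolding g'_def by (rule sub) simp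
    fix p q :: 'a
    obtain p' q' where *: "box p q \<inter> box a c = box p' q'" using box_Int_box by blast
    have "(LINT x:box p q|lborel. g' x) = (\<integral>x. g x * indicator (box p' q') x \<partial>lborel)"
      unfolding set_lebesgue_integral_def g'_def *[symmetric]
      by (rule arg_cong[where f="integral\<^sup>L lborel"]) (auto simp: indicator_def)
    also have "\<dots> = 0"
    \<comment> \<open>For a nonempty open box the closed box is its closure and hence stays in
      \<open>cbox a c\<close>; an empty one gives no control over \<open>cbox p' q'\<close>, but
      then the integral is trivially 0.\<close>
    proof (cases "box p' q' = {}")
      case False
      then have "cbox p' q' = closure (box p' q')" by (simp add: closure_box)
      also have "\<dots> \<subseteq> closure (box a c)" using * by (intro closure_mono) auto
      also have "\<dots> \<subseteq> cbox a c" by (intro closure_minimal box_subset_cbox closed_cbox)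
      finally show ?thesis by (rule sub)
    qed simp
    finally show "(LINT x:box p q|lborel. g' x) = 0" .
  qed
  then show ?thesis by eventually_elim (auto simp: g'_def indicator_def split: if_splits)
qed

text \<open>Passing to a Borel version makes Fubini's theorem available.\<close>
lemma integrable_on_borel_version:
  fixes v :: "'a::euclidean_space \<Rightarrow> real"
  assumes "set_integrable lebesgue A v"
  obtains g where "integrable lborel g" "AE x in lebesgue. x \<in> A \<longrightarrow> v x = g x"
    "\<And>\<psi>. continuous_on UNIV \<psi> \<Longrightarrow>
      (LINT x:A|lebesgue. v x * \<psi> x) = (\<integral>x. g x * \<psi> x \<partial>lborel)"
proof -
  have i: "integrable lebesgue (\<lambda>x. indicator A x * v x)"
    using assms by (simp add: set_integrable_def)
  obtain g where g: "g \<in> borel_measurable lborel" "AE x in lborel. indicator A x * v x = g x"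
    using completion_ex_borel_measurable_real[OF borel_measurable_integrable[OF i]] by blast
  have AE: "AE x in lebesgue. indicator A x * v x = g x" using g(2) by (rule AE_completion)
  have gm: "g \<in> borel_measurable lebesgue" using g(1) by (rule measurable_completion)
  have "integrable lebesgue g"
    using i by (rule integrable_cong_AE_imp) (use AE gm in auto)
  then have 1: "integrable lborel g" using integrable_completion[OF g(1)] by simp
  have 2: "AE x in lebesgue. x \<in> A \<longrightarrow> v x = g x"
    using AE by eventually_elim (auto simp: indicator_def split: if_splits)
  have 3: "(LINT x:A|lebesgue. v x * \<psi> x) = (\<integral>x. g x * \<psi> x \<partial>lborel)" if "continuous_on UNIV \<psi>" for \<psi>
  proof -
    have \<psi>: "\<psi> \<in> borel_measurable lborel" using borel_measurable_continuous_onI[OF that] by simp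
    have \<psi>': "\<psi> \<in> borel_measurable lebesgue" using \<psi> by (rule measurable_completion)
    have "(LINT x:A|lebesgue. v x * \<psi> x) = (\<integral>x. (indicator A x * v x) * \<psi> x \<partial>lebesgue)"
      by (simp add: set_lebesgue_integral_def mult.assoc)
    also have "\<dots> = (\<integral>x. g x * \<psi> x \<partial>lebesgue)"
      by (rule integral_cong_AE) (use AE gm \<psi>' borel_measurable_integrable[OF i] in auto)
    also have "\<dots> = (\<integral>x. g x * \<psi> x \<partial>lborel)"
      by (rule integral_completion) (use g(1) \<psi> in measurable)
    finally show ?thesis .
  qed
  show ?thesis by (rule that[OF 1 2 3])
qed

text \<open>Since \<open>w\<close> is only locally integrable, the claim is localized to compact
  boxes inside the domain; on each of them \<open>w\<close> has an integrable Borel version that can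
  be tested with bumps.\<close>

lemma (in bounded_open) du_Bois_Reymond:
  fixes w :: "'a \<Rightarrow> real"
  assumes loc: "\<And>K. compact K \<Longrightarrow> K \<subseteq> \<Omega> \<Longrightarrow> set_integrable lebesgue K w"
    and 0: "\<And>\<psi>. test_fun \<Omega> \<psi> \<Longrightarrow> (\<integral>x. w x * \<psi> x \<partial>M) = 0"
  shows "AE x in M. w x = 0"
  unfolding AE_M_iff
proof (rule AE_lebesgue_local)
  fix x assume "x \<in> \<Omega>"
  then obtain a c where ac: "cbox a c \<subseteq> \<Omega>" "x \<in> box a c" using open_contains_cbox[OF open_dom] by metis
  obtain g where g: "integrable lborel g" "AE x in lebesgue. x \<in> cbox a c \<longrightarrow> w x = g x"
    "\<And>\<psi>. continuous_on UNIV \<psi> \<Longrightarrow>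
      (LINT x:cbox a c|lebesgue. w x * \<psi> x) = (\<integral>x. g x * \<psi> x \<partial>lborel)"
    by (rule integrable_on_borel_version[OF loc[OF compact_cbox ac(1)]]) (rule that)
  have "AE x in lborel. x \<in> box a c \<longrightarrow> g x = 0"
  proof (rule lborel_AE_zero_of_bumps[OF g(1)])
    fix p q n assume pq: "cbox p q \<subseteq> cbox a c"
    have t: "test_fun \<Omega> (bump p q n)" using pq ac(1) by (intro test_fun_bump) auto
    have "(\<integral>x. g x * bump p q n x \<partial>lborel) = (LINT x:cbox a c|lebesgue. w x * bump p q n x)"
      using g(3)[OF smooth_continuous[OF bump_smooth]] by simp
    also have "\<dots> = (LINT x:\<Omega>|lebesgue. w x * bump p q n x)"
      unfolding set_lebesgue_integral_def
    proof (rule arg_cong[where f="integral\<^sup>L lebesgue"], rule ext)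
      fix x
      have "bump p q n x = 0" if "x \<notin> cbox a c"
        using that pq box_subset_cbox[of p q] by (intro bump_zero) auto
      then show "indicator (cbox a c) x *\<^sub>R (w x * bump p q n x) = indicator \<Omega> x *\<^sub>R (w x * bump p q n x)"
        using ac(1) by (cases "x \<in> cbox a c") (auto simp: indicator_def)
    qed
    also have "\<dots> = 0" using 0[OF t] by (simp add: integral_M_set)
    finally show "(\<integral>x. g x * bump p q n x \<partial>lborel) = 0" .
  qed
  then have "AE x in lebesgue. x \<in> box a c \<longrightarrow> g x = 0" by (rule AE_completion)
  then have "AE x in lebesgue. x \<in> box a c \<longrightarrow> w x = 0"
    using g(2) by eventually_elim (use box_subset_cbox in auto)
  then show "\<exists>U. open U \<and> x \<in> U \<and> (AE y in lebesgue. y \<in> U \<longrightarrow> w y = 0)"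
    using ac(2) open_box by blast
qed

section \<open>Functions with vanishing weak gradient\<close>

lemma test_fun_shift:
  assumes "test_fun U \<psi>" "\<And>x. x \<in> U \<Longrightarrow> x - z \<in> V"
  shows "test_fun V (\<lambda>x. \<psi> (x + z))"
proof (rule test_funE[OF assms(1)])
  fix K assume K: "compact K" "K \<subseteq> U" "\<And>x. x \<notin> K \<Longrightarrow> \<psi> x = 0"
  show ?thesis
  proof (rule test_funI)
    show "smooth_on UNIV (\<lambda>x. \<psi> (x + z))" by (rule smooth_shift[OF test_fun_smooth[OF assms(1)]])
    show "compact ((\<lambda>x. - z + x) ` K)" by (rule compact_translation[OF K(1)])
    show "(\<lambda>x. - z + x) ` K \<subseteq> V" using assms(2) K(2) by auto
    fix x assume "x \<notin> (\<lambda>x. - z + x) ` K"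
    then have "x + z \<notin> K" by (metis add_uminus_conv_diff add.commute add_diff_cancel_right' image_eqI)
    then show "\<psi> (x + z) = 0" by (rule K(3))
  qed
qed

text \<open>The integral of g y \<psi> (y + t z) is differentiated in \<open>t\<close> under the
  integral sign. Its derivative vanishes on the open interval (-1, 2), which contains both
  parameters 0 and 1 to be compared.\<close>

lemma shifted_integral_constant:
  fixes g :: "'a::euclidean_space \<Rightarrow> real"
  assumes g: "integrable lborel g" and \<psi>: "test_fun U \<psi>"
    and 0: "\<And>t. - 1 < t \<Longrightarrow> t < 2 \<Longrightarrow> (\<integral>y. g y * (cgrad \<psi> (y + t *\<^sub>R z) \<bullet> z) \<partial>lborel) = 0"
  shows "(\<integral>y. g y * \<psi> (y + z) \<partial>lborel) = (\<integral>y. g y * \<psi> y \<partial>lborel)"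
proof -
  note sm = test_fun_smooth[OF \<psi>]
  obtain L where L: "0 \<le> L" "\<And>x. norm (cgrad \<psi> x) \<le> L" using test_fun_cgrad_bounded[OF \<psi>] by blast
  obtain B where B: "0 \<le> B" "\<And>x. norm (\<psi> x) \<le> B" using test_fun_bounded[OF \<psi>] by blast
  define h where "h t = (\<integral>y. g y * \<psi> (y + t *\<^sub>R z) \<partial>lborel)" for t
  note [measurable] = borel_measurable_integrable[OF g]
  have shc: "continuous_on UNIV (\<lambda>y. \<psi> (y + w))" for w
    using smooth_continuous[OF smooth_shift[OF sm]] .
  then have [measurable]: "(\<lambda>y. \<psi> (y + w)) \<in> borel_measurable borel" for w
    by (rule borel_measurable_continuous_onI)
  have int: "integrable lborel (\<lambda>y. g y * \<psi> (y + w))" for w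
  proof (rule Bochner_Integration.integrable_bound[where f="\<lambda>y. B * norm (g y)"])
    show "AE y in lborel. norm (g y * \<psi> (y + w)) \<le> norm (B * norm (g y))"
    proof (rule AE_I2)
      fix y
      have "\<bar>g y\<bar> * \<bar>\<psi> (y + w)\<bar> \<le> \<bar>g y\<bar> * B" using B(2)[of "y + w"] by (intro mult_left_mono) auto
      then show "norm (g y * \<psi> (y + w)) \<le> norm (B * norm (g y))"
        using B(1) by (simp add: abs_mult mult.commute)
    qed
  qed (use g in auto)
  have "(h has_real_derivative 0) (at t)" if t: "- 1 < t" "t < 2" for t
    \<comment> \<open>Limits are taken along null sequences so that dominated convergence
      applies.\<close>
    unfolding DERIV_def tendsto_at_iff_sequentially
  proof (intro allI impI)
    fix X :: "nat \<Rightarrow> real" assume X: "\<forall>i. X i \<in> UNIV - {0}" "X \<longlonglongrightarrow> 0"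
    define Q where "Q i y = (\<psi> (y + (t + X i) *\<^sub>R z) - \<psi> (y + t *\<^sub>R z)) / X i" for i y
    have "(\<lambda>i. \<integral>y. g y * Q i y \<partial>lborel) \<longlonglongrightarrow> (\<integral>y. g y * (cgrad \<psi> (y + t *\<^sub>R z) \<bullet> z) \<partial>lborel)"
    proof (rule integral_dominated_convergence[where w="\<lambda>y. L * norm z * norm (g y)"])
      have "continuous_on UNIV (\<lambda>y. cgrad \<psi> (y + t *\<^sub>R z) \<bullet> z)"
        using smooth_cgrad_continuous[OF smooth_shift[OF sm, of "t *\<^sub>R z"]] cgrad_shift[OF sm]
        by (intro continuous_intros) (simp cong: continuous_on_cong)
      then have [measurable]: "(\<lambda>y. cgrad \<psi> (y + t *\<^sub>R z) \<bullet> z) \<in> borel_measurable borel"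
        by (rule borel_measurable_continuous_onI)
      show "(\<lambda>y. g y * (cgrad \<psi> (y + t *\<^sub>R z) \<bullet> z)) \<in> borel_measurable lborel"
        "(\<lambda>y. g y * Q i y) \<in> borel_measurable lborel" for i
        unfolding Q_def by measurable
      show "integrable lborel (\<lambda>y. L * norm z * norm (g y))" using g by auto
      show "AE y in lborel. (\<lambda>i. g y * Q i y) \<longlonglongrightarrow> g y * (cgrad \<psi> (y + t *\<^sub>R z) \<bullet> z)"
      proof (intro AE_I2 tendsto_mult tendsto_const)
        fix y
        have "((\<lambda>s. y + s *\<^sub>R z) has_derivative (\<lambda>s. s *\<^sub>R z)) (at t)"
          by (auto intro!: derivative_eq_intros)
        then have "((\<lambda>s. \<psi> (y + s *\<^sub>R z)) has_derivative (\<lambda>s. cgrad \<psi> (y + t *\<^sub>R z) \<bullet> (s *\<^sub>R z))) (at t)"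
          by (rule has_derivative_compose) (rule smooth_has_derivative[OF sm])
        then have "((\<lambda>s. \<psi> (y + s *\<^sub>R z)) has_field_derivative (cgrad \<psi> (y + t *\<^sub>R z) \<bullet> z)) (at t)"
          by (rule has_derivative_imp_has_field_derivative) simp
        then have "((\<lambda>s. (\<psi> (y + (t + s) *\<^sub>R z) - \<psi> (y + t *\<^sub>R z)) / s) \<longlongrightarrow> cgrad \<psi> (y + t *\<^sub>R z) \<bullet> z) (at 0)"
          by (simp add: DERIV_def)
        then show "(\<lambda>i. Q i y) \<longlonglongrightarrow> cgrad \<psi> (y + t *\<^sub>R z) \<bullet> z"
          unfolding tendsto_at_iff_sequentially using X by (auto simp: Q_def o_def)
      qed
      show "AE y in lborel. norm (g y * Q i y) \<le> L * norm z * norm (g y)" for i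
      proof (rule AE_I2)
        fix y
        have "\<bar>\<psi> (y + (t + X i) *\<^sub>R z) - \<psi> (y + t *\<^sub>R z)\<bar> \<le> L * norm (X i *\<^sub>R z)"
          using smooth_Lipschitz[OF sm L(2), of "y + (t + X i) *\<^sub>R z" "y + t *\<^sub>R z"]
          by (simp add: scaleR_add_left)
        then have "\<bar>Q i y\<bar> \<le> L * norm z"
          using X(1) by (simp add: Q_def divide_le_eq mult_ac)
        then have "\<bar>g y\<bar> * \<bar>Q i y\<bar> \<le> \<bar>g y\<bar> * (L * norm z)" by (intro mult_left_mono) auto
        then show "norm (g y * Q i y) \<le> L * norm z * norm (g y)" by (simp add: abs_mult mult_ac)
      qed
    qed
    moreover have "(\<integral>y. g y * Q i y \<partial>lborel) = (h (t + X i) - h t) / X i" for i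
    proof -
      have "(\<integral>y. g y * Q i y \<partial>lborel) =
          (\<integral>y. (g y * \<psi> (y + (t + X i) *\<^sub>R z) - g y * \<psi> (y + t *\<^sub>R z)) / X i \<partial>lborel)"
        by (simp add: Q_def right_diff_distrib)
      then show ?thesis using int by (simp add: h_def)
    qed
    ultimately show "((\<lambda>s. (h (t + s) - h t) / s) \<circ> X) \<longlonglongrightarrow> 0"
      using 0[OF t] by (simp add: o_def)
  qed
  then have "h 1 = h 0" by (intro DERIV_isconst3[of "-1" 2]) auto
  then show ?thesis by (simp add: h_def)
qed

text \<open>Both sides evaluate the double integral of \<open>g (x + y - x0) * \<psi> x * \<rho> y\<close>.\<close>
lemma translation_invariant_proportional:
  fixes g \<psi> \<rho> :: "'a::euclidean_space \<Rightarrow> real"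
  assumes g: "integrable lborel g" and \<psi>: "test_fun U \<psi>" and \<rho>: "test_fun U \<rho>"
    and inv: "\<And>\<phi> z. test_fun U \<phi> \<Longrightarrow> x0 - z \<in> U \<Longrightarrow>
      (\<integral>y. g y * \<phi> (y + z) \<partial>lborel) = (\<integral>y. g y * \<phi> y \<partial>lborel)"
  shows "(\<integral>y. g y * \<psi> y \<partial>lborel) * (\<integral>y. \<rho> y \<partial>lborel) = (\<integral>y. g y * \<rho> y \<partial>lborel) * (\<integral>y. \<psi> y \<partial>lborel)"
proof -
  note [measurable] = borel_measurable_integrable[OF g]
  have cm: "\<phi> \<in> borel_measurable borel" if "test_fun U \<phi>" for \<phi>
    using smooth_continuous[OF test_fun_smooth[OF that]] by (rule borel_measurable_continuous_onI)
  note [measurable] = cm[OF \<psi>] cm[OF \<rho>]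
  have ti: "integrable lborel \<phi>" if "test_fun U \<phi>" for \<phi>
    by (rule test_funE[OF that])
      (rule compact_support_integrable[OF smooth_continuous[OF test_fun_smooth[OF that]]])
  \<comment> \<open>For \<open>y\<close> in \<open>U\<close> the shift \<open>x0 - y\<close> is one
    of those allowed in \<open>inv\<close>, because \<open>x0 - (x0 - y) = y\<close>; for other
    \<open>y\<close> the factor \<open>\<eta> y\<close> vanishes.\<close>
  have inner: "(\<integral>x. g (x + y - x0) * \<phi> x \<partial>lborel) * \<eta> y = (\<integral>x. g x * \<phi> x \<partial>lborel) * \<eta> y"
    if \<phi>: "test_fun U \<phi>" and \<eta>: "test_fun U \<eta>" for \<phi> \<eta> y
  proof (cases "y \<in> U")
    case True
    note [measurable] = cm[OF \<phi>]
    have "(\<integral>x. g (x + y - x0) * \<phi> x \<partial>lborel) = (\<integral>x. (\<lambda>x. g x * \<phi> (x + (x0 - y))) (x + (y - x0)) \<partial>lborel)"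
      by (simp add: algebra_simps)
    also have "\<dots> = (\<integral>x. g x * \<phi> (x + (x0 - y)) \<partial>lborel)"
      by (rule lborel_integral_shift) measurable
    also have "\<dots> = (\<integral>x. g x * \<phi> x \<partial>lborel)" using True by (intro inv[OF \<phi>]) simp
    finally show ?thesis by simp
  next
    case False
    then have "\<eta> y = 0" using \<eta> by (metis subsetD test_funE)
    then show ?thesis by simp
  qed
  define k where "k x y = g (x + y - x0) * \<psi> x * \<rho> y" for x y
  obtain B where B: "0 \<le> B" "\<And>x. norm (\<psi> x) \<le> B" using test_fun_bounded[OF \<psi>] by blast
  have gs: "integrable lborel (\<lambda>x. g (x + w))" for w
  proof -
    have "integrable (distr lborel borel ((+) w)) g" using g by (simp add: lborel_distr_plus)
    then have "integrable lborel (\<lambda>x. g (w + x))"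
      using integrable_distr[of "(+) w" lborel borel g] by simp
    then show ?thesis by (simp add: add.commute)
  qed
  have bd: "norm (k x y) \<le> B * norm (g (x + y - x0)) * norm (\<rho> y)" for x y
  proof -
    have "\<bar>g (x + y - x0)\<bar> * \<bar>\<psi> x\<bar> \<le> \<bar>g (x + y - x0)\<bar> * B" using B(2)[of x] by (intro mult_left_mono) auto
    then have "\<bar>g (x + y - x0)\<bar> * \<bar>\<psi> x\<bar> * \<bar>\<rho> y\<bar> \<le> \<bar>g (x + y - x0)\<bar> * B * \<bar>\<rho> y\<bar>"
      by (intro mult_right_mono) auto
    then show ?thesis by (simp add: k_def abs_mult mult_ac)
  qed
  \<comment> \<open>Fubini needs joint integrability: \<open>\<psi>\<close> is bounded by
    \<open>B\<close>, and the remaining integral over \<open>x\<close> of the translate of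
    \<open>g\<close> does not depend on \<open>y\<close>.\<close>
  have "integrable (lborel \<Otimes>\<^sub>M lborel) (\<lambda>(y, x). k x y)"
  proof (rule Bochner_Integration.integrable_bound[where f="\<lambda>(y, x). B * norm (g (x + y - x0)) * norm (\<rho> y)"])
    show "integrable (lborel \<Otimes>\<^sub>M lborel) (\<lambda>(y, x). B * norm (g (x + y - x0)) * norm (\<rho> y))"
    proof (rule lborel_pair.Fubini_integrable)
      have "(\<integral>x. norm (g (x + y - x0)) \<partial>lborel) = (\<integral>x. norm (g x) \<partial>lborel)" for y
        using lborel_integral_shift[of "\<lambda>x. norm (g x)" "y - x0"] by (simp add: add_diff_eq)
      then have "(\<lambda>y. \<integral>x. norm (case (y, x) of (y, x) \<Rightarrow> B * norm (g (x + y - x0)) * norm (\<rho> y)) \<partial>lborel)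
          = (\<lambda>y. B * (\<integral>x. norm (g x) \<partial>lborel) * norm (\<rho> y))"
        using B(1) by (simp add: abs_mult)
      then show "integrable lborel (\<lambda>y. \<integral>x. norm (case (y, x) of (y, x) \<Rightarrow> B * norm (g (x + y - x0)) * norm (\<rho> y)) \<partial>lborel)"
        using ti[OF \<rho>] by simp
      show "AE y in lborel. integrable lborel (\<lambda>x. case (y, x) of (y, x) \<Rightarrow> B * norm (g (x + y - x0)) * norm (\<rho> y))"
        using gs[THEN integrable_norm] by (simp add: add_diff_eq[symmetric])
    qed measurable
    show "AE x in lborel \<Otimes>\<^sub>M lborel. norm (case x of (y, x) \<Rightarrow> k x y)
        \<le> norm (case x of (y, x) \<Rightarrow> B * norm (g (x + y - x0)) * norm (\<rho> y))"
      using bd B(1) by (intro AE_I2) (auto simp: abs_mult split: prod.split)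
  qed (unfold k_def, measurable)
  then have "(\<integral>x. (\<integral>y. k x y \<partial>lborel) \<partial>lborel) = (\<integral>y. (\<integral>x. k x y \<partial>lborel) \<partial>lborel)"
    using lborel_pair.Fubini_integral[of "\<lambda>y x. k x y"] by simp
  moreover have "(\<integral>x. k x y \<partial>lborel) = (\<integral>x. g x * \<psi> x \<partial>lborel) * \<rho> y" for y
    using inner[OF \<psi> \<rho>, of y] by (simp add: k_def)
  moreover have "(\<integral>y. k x y \<partial>lborel) = (\<integral>x. g x * \<rho> x \<partial>lborel) * \<psi> x" for x
  proof -
    have "(\<integral>y. k x y \<partial>lborel) = (\<integral>y. g (y + x - x0) * \<rho> y \<partial>lborel) * \<psi> x"
      unfolding k_def by (subst integral_mult_left_zero[symmetric]) (simp add: ac_simps add.commute[of x])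
    then show ?thesis using inner[OF \<rho> \<psi>, of x] by simp
  qed
  ultimately show ?thesis by simp
qed


lemma not_AE_ball_False:
  fixes x :: "'a::euclidean_space"
  assumes "0 < e" "AE y in lebesgue. y \<in> ball x e \<longrightarrow> False" shows False
proof -
  have "negligible (ball x e)"
    using assms(2) unfolding AE_lebesgue_negligible by (simp add: ball_def)
  then show False using open_not_negligible[OF open_ball, of x e] assms(1) by simp
qed

text \<open>The index is 1 because the bump of index 0 vanishes identically: all arguments of
  \<open>flat 0\<close> are then 0.\<close>

lemma bump_integral_pos:
  assumes "x \<in> box a c" shows "0 < (\<integral>x. bump a c 1 x \<partial>lborel)"
proof -
  have int: "integrable lborel (bump a c 1)"
  proof (rule compact_support_integrable[OF smooth_continuous[OF bump_smooth] compact_cbox[of a c]])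
    fix y assume "y \<notin> cbox a c"
    then show "bump a c 1 y = 0" using box_subset_cbox[of a c] by (intro bump_zero) auto
  qed
  have nn: "0 \<le> (\<integral>x. bump a c 1 x \<partial>lborel)" using bump_bounds by (intro integral_nonneg_AE AE_I2) blast
  have "(\<integral>x. bump a c 1 x \<partial>lborel) \<noteq> 0"
  proof
    assume "(\<integral>x. bump a c 1 x \<partial>lborel) = 0"
    then have "AE x in lborel. bump a c 1 x = 0"
      using integral_nonneg_eq_0_iff_AE[OF int AE_I2[OF bump_bounds[THEN conjunct1]]] by blast
    then have AE: "AE x in lebesgue. bump a c 1 x = 0" by (rule AE_completion)
    obtain e where e: "0 < e" "ball x e \<subseteq> box a c" using assms open_box open_contains_ball by metis
    have "AE y in lebesgue. y \<in> ball x e \<longrightarrow> False"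
      using AE by eventually_elim (use e(2) bump_pos[of _ a c 1] in force)
    then show False by (rule not_AE_ball_False[OF e(1)])
  qed
  then show ?thesis using nn by simp
qed

context bounded_open
begin

text \<open>A zero weak gradient makes \<psi> \<mapsto> \<integral> v \<psi> invariant under small
  translations. An invariant functional is a multiple \<open>c\<close> of the plain integral, so
  \<open>v - c\<close> is annihilated by all test functions of the ball.\<close>

lemma zero_weak_gradient_locally_constant:
  fixes v :: "'a \<Rightarrow> real"
  assumes loc: "\<And>K. compact K \<Longrightarrow> K \<subseteq> \<Omega> \<Longrightarrow> set_integrable lebesgue K v"
    and 0: "\<And>\<psi> z. test_fun \<Omega> \<psi> \<Longrightarrow> (\<integral>x. v x * (cgrad \<psi> x \<bullet> z) \<partial>M) = 0"
    and x0: "x0 \<in> \<Omega>"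
  shows "\<exists>c r. 0 < r \<and> (AE x in lebesgue. x \<in> ball x0 r \<longrightarrow> v x = c)"
proof -
  obtain R where R: "0 < R" "cball x0 R \<subseteq> \<Omega>" using open_dom x0 open_contains_cball by blast
  \<comment> \<open>A point within \<open>r\<close> of \<open>x0\<close> is moved by
    \<open>t *\<^sub>R z\<close> with |t| < 2 and |z| < r, so it remains within 3 r = R.\<close>
  define r where "r = R / 3"
  define U where "U = ball x0 r"
  have r: "0 < r" using R by (simp add: r_def)
  have UR: "U \<subseteq> cball x0 R" using R by (auto simp: U_def r_def)
  have U\<Omega>: "U \<subseteq> \<Omega>" using UR R(2) by blast
  obtain g where g: "integrable lborel g" "AE x in lebesgue. x \<in> cball x0 R \<longrightarrow> v x = g x"
    "\<And>\<psi>. continuous_on UNIV \<psi> \<Longrightarrow>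
      (LINT x:cball x0 R|lebesgue. v x * \<psi> x) = (\<integral>x. g x * \<psi> x \<partial>lborel)"
    by (rule integrable_on_borel_version[OF loc[OF compact_cball R(2)]]) (rule that)
  have restr: "(LINT x:A|lebesgue. v x * \<eta> x) = (\<integral>x. g x * \<eta> x \<partial>lborel)"
    if \<eta>: "continuous_on UNIV \<eta>" "\<And>x. x \<notin> cball x0 R \<inter> A \<Longrightarrow> \<eta> x = 0" for \<eta> A
  proof -
    have "(LINT x:A|lebesgue. v x * \<eta> x) = (LINT x:cball x0 R|lebesgue. v x * \<eta> x)"
      unfolding set_lebesgue_integral_def
    proof (rule arg_cong[where f="integral\<^sup>L lebesgue"], rule ext)
      fix x show "indicator A x *\<^sub>R (v x * \<eta> x) = indicator (cball x0 R) x *\<^sub>R (v x * \<eta> x)"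
        using \<eta>(2)[of x] by (cases "x \<in> cball x0 R \<inter> A") (auto simp: indicator_def)
    qed
    then show ?thesis using g(3)[OF \<eta>(1)] by simp
  qed
  have inv: "(\<integral>y. g y * \<phi> (y + z) \<partial>lborel) = (\<integral>y. g y * \<phi> y \<partial>lborel)"
    if \<phi>: "test_fun U \<phi>" and z: "x0 - z \<in> U" for \<phi> z
  proof (rule shifted_integral_constant[OF g(1) \<phi>])
    fix t :: real assume t: "- 1 < t" "t < 2"
    have nz: "norm z < r" using z by (simp add: U_def dist_norm)
    define \<kappa> where "\<kappa> y = \<phi> (y + t *\<^sub>R z)" for y
    have \<kappa>: "test_fun (ball x0 R) \<kappa>"
      unfolding \<kappa>_def
    proof (rule test_fun_shift[OF \<phi>])
      fix x assume "x \<in> U"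
      then have x: "norm (x0 - x) < r" by (simp add: U_def dist_norm)
      have "\<bar>t\<bar> * norm z \<le> 2 * r" using t nz by (intro mult_mono) auto
      then have "norm (t *\<^sub>R z) \<le> 2 * r" by simp
      moreover have "norm (x0 - x + t *\<^sub>R z) \<le> norm (x0 - x) + norm (t *\<^sub>R z)" by (rule norm_triangle_ineq)
      ultimately have "norm (x0 - x + t *\<^sub>R z) < R" using x by (simp add: r_def)
      moreover have "x0 - x + t *\<^sub>R z = x0 - (x - t *\<^sub>R z)" by simp
      ultimately show "x - t *\<^sub>R z \<in> ball x0 R" by (simp only: mem_ball dist_norm)
    qed
    have \<kappa>\<Omega>: "test_fun \<Omega> \<kappa>" using R(2) by (intro test_fun_mono[OF \<kappa>]) (auto intro: ball_subset_cball[THEN subsetD])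
    have zero: "cgrad \<kappa> x = 0" if "x \<notin> ball x0 R" for x
      by (rule test_funE[OF \<kappa>]) (use that in blast)
    have cg: "cgrad \<phi> (y + t *\<^sub>R z) = cgrad \<kappa> y" for y
      unfolding \<kappa>_def by (rule cgrad_shift[OF test_fun_smooth[OF \<phi>], symmetric])
    have "(\<integral>y. g y * (cgrad \<kappa> y \<bullet> z) \<partial>lborel) = (LINT x:\<Omega>|lebesgue. v x * (cgrad \<kappa> x \<bullet> z))"
    proof (rule restr[symmetric])
      show "continuous_on UNIV (\<lambda>x. cgrad \<kappa> x \<bullet> z)"
        using smooth_cgrad_continuous[OF test_fun_smooth[OF \<kappa>]] by (intro continuous_intros)
      fix x assume "x \<notin> cball x0 R \<inter> \<Omega>"
      then have "x \<notin> ball x0 R" using R(2) ball_subset_cball[of x0 R] by blast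
      then show "cgrad \<kappa> x \<bullet> z = 0" by (simp add: zero)
    qed
    also have "\<dots> = 0" using 0[OF \<kappa>\<Omega>, of z] by (simp add: integral_M_set)
    finally show "(\<integral>y. g y * (cgrad \<phi> (y + t *\<^sub>R z) \<bullet> z) \<partial>lborel) = 0" by (simp add: cg)
  qed
  have "x0 \<in> U" using r by (simp add: U_def)
  then obtain p q where pq: "cbox p q \<subseteq> U" "x0 \<in> box p q"
    using open_contains_cbox[OF open_ball] unfolding U_def by metis
  define \<rho> where "\<rho> = bump p q 1"
  have \<rho>: "test_fun U \<rho>" unfolding \<rho>_def by (rule test_fun_bump[OF pq(1)])
  have \<rho>0: "0 < (\<integral>x. \<rho> x \<partial>lborel)" unfolding \<rho>_def by (rule bump_integral_pos[OF pq(2)])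
  \<comment> \<open>The factor of proportionality, read off from one bump of positive
    integral.\<close>
  define c where "c = (\<integral>y. g y * \<rho> y \<partial>lborel) / (\<integral>x. \<rho> x \<partial>lborel)"
  have propo: "(\<integral>y. g y * \<psi> y \<partial>lborel) = c * (\<integral>y. \<psi> y \<partial>lborel)" if \<psi>: "test_fun U \<psi>" for \<psi>
    using translation_invariant_proportional[OF g(1) \<psi> \<rho> inv] \<rho>0 by (simp add: c_def field_simps)
  interpret U: bounded_open U by standard (simp_all add: U_def)
  have vi: "set_integrable lebesgue U v"
    by (rule set_integrable_subset[OF loc[OF compact_cball R(2)] _ UR]) (simp add: U_def)
  have ci: "set_integrable lebesgue U (\<lambda>x. c)"
    unfolding U.integrable_M_set[symmetric] by simp
  have "AE x in U.M. v x - c = 0"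
  proof (rule U.du_Bois_Reymond)
    show "set_integrable lebesgue K (\<lambda>x. v x - c)" if "compact K" "K \<subseteq> U" for K
      by (rule set_integrable_subset[OF set_integral_diff(1)[OF vi ci] _ that(2)])
        (use that(1) in \<open>auto intro: lmeasurable_compact fmeasurableD\<close>)
    fix \<psi> assume \<psi>: "test_fun U \<psi>"
    note sm = test_fun_smooth[OF \<psi>]
    obtain B where B: "\<And>x. norm (\<psi> x) \<le> B" using test_fun_bounded[OF \<psi>] by blast
    have m: "\<psi> \<in> borel_measurable U.M" by (rule U.continuous_measurable_M[OF smooth_continuous[OF sm]])
    have iv: "integrable U.M (\<lambda>x. v x * \<psi> x)"
    proof (rule Bochner_Integration.integrable_bound[where f="\<lambda>x. B * norm (v x)"])
      show "integrable U.M (\<lambda>x. B * norm (v x))" using vi by (simp add: U.integrable_M_set[symmetric])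
      then show "(\<lambda>x. v x * \<psi> x) \<in> borel_measurable U.M"
        using vi m by (simp add: U.integrable_M_set[symmetric] borel_measurable_integrable borel_measurable_times)
      show "AE x in U.M. norm (v x * \<psi> x) \<le> norm (B * norm (v x))"
      proof (rule AE_I2)
        fix x
        have "\<bar>v x\<bar> * \<bar>\<psi> x\<bar> \<le> \<bar>v x\<bar> * \<bar>B\<bar>" using B[of x] by (intro mult_left_mono) auto
        then show "norm (v x * \<psi> x) \<le> norm (B * norm (v x))" by (simp add: abs_mult mult.commute)
      qed
    qed
    have "(\<integral>x. (v x - c) * \<psi> x \<partial>U.M) = (\<integral>x. v x * \<psi> x - c * \<psi> x \<partial>U.M)"
      by (simp add: left_diff_distrib)
    also have "\<dots> = (\<integral>x. v x * \<psi> x \<partial>U.M) - c * (\<integral>x. \<psi> x \<partial>U.M)"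
      using iv U.sq_int_imp_integrable[OF U.sq_int_test_fun[OF \<psi>]] by simp
    also have "(\<integral>x. v x * \<psi> x \<partial>U.M) = (\<integral>x. g x * \<psi> x \<partial>lborel)"
      unfolding U.integral_M_set
      by (rule restr[OF smooth_continuous[OF sm]]) (use UR U.test_fun_outside[OF \<psi>] in blast)
    also have "(\<integral>x. \<psi> x \<partial>U.M) = (\<integral>x. \<psi> x \<partial>lborel)"
      by (rule U.integral_M_lborel[OF smooth_continuous[OF sm]]) (use U.test_fun_outside[OF \<psi>] in auto)
    finally show "(\<integral>x. (v x - c) * \<psi> x \<partial>U.M) = 0" using propo[OF \<psi>] by simp
  qed
  then have "AE x in lebesgue. x \<in> ball x0 r \<longrightarrow> v x = c"
    unfolding U.AE_M_iff by (simp add: U_def)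
  then show ?thesis using r by blast
qed

text \<open>The local constants form a locally constant function of the centre, hence a constant one
  on a connected set.\<close>

lemma zero_weak_gradient_constant:
  fixes v :: "'a \<Rightarrow> real"
  assumes "connected \<Omega>"
    and loc: "\<And>K. compact K \<Longrightarrow> K \<subseteq> \<Omega> \<Longrightarrow> set_integrable lebesgue K v"
    and 0: "\<And>\<psi> z. test_fun \<Omega> \<psi> \<Longrightarrow> (\<integral>x. v x * (cgrad \<psi> x \<bullet> z) \<partial>M) = 0"
  shows "\<exists>c. AE x in M. v x = c"
proof (cases "\<Omega> = {}")
  case True
  then show ?thesis by (simp add: AE_M_iff)
next
  case False
  then obtain a where a: "a \<in> \<Omega>" by blast
  have "\<forall>x\<in>\<Omega>. \<exists>c r. 0 < r \<and> (AE y in lebesgue. y \<in> ball x r \<longrightarrow> v y = c)"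
    using zero_weak_gradient_locally_constant[OF loc 0] by blast
  then obtain c r where cr: "\<And>x. x \<in> \<Omega> \<Longrightarrow> 0 < r x"
      "\<And>x. x \<in> \<Omega> \<Longrightarrow> AE y in lebesgue. y \<in> ball x (r x) \<longrightarrow> v y = c x"
    by metis
  have const: "c a = c b" if b: "b \<in> \<Omega>" for b
  proof (rule connected_local_const[OF assms(1) a b], intro ballI)
    fix x assume x: "x \<in> \<Omega>"
    have "c x = c y" if y: "y \<in> \<Omega>" "y \<in> ball x (r x)" for y
    proof (rule ccontr)
      assume ne: "c x \<noteq> c y"
      obtain e where e: "0 < e" "ball y e \<subseteq> ball x (r x)" using y(2) open_ball open_contains_ball by metis
      \<comment> \<open>On the intersection of the two balls both constants would be the value of
        \<open>v\<close> almost everywhere, although a nonempty open set is not negligible.\<close>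
      have "AE w in lebesgue. w \<in> ball y (min e (r y)) \<longrightarrow> False"
        using cr(2)[OF x] cr(2)[OF y(1)] by eventually_elim (use e(2) ne in auto)
      then show False using not_AE_ball_False[of "min e (r y)" y] e(1) cr(1)[OF y(1)] by simp
    qed
    then show "\<forall>\<^sub>F y in at x within \<Omega>. c x = c y"
      using cr(1)[OF x] by (auto simp: eventually_at dist_commute intro!: exI[of _ "r x"])
  qed
  have "AE y in lebesgue. y \<in> \<Omega> \<longrightarrow> v y = c a"
  proof (rule AE_lebesgue_local)
    fix x assume x: "x \<in> \<Omega>"
    then show "\<exists>U. open U \<and> x \<in> U \<and> (AE y in lebesgue. y \<in> U \<longrightarrow> v y = c a)"
      using cr[OF x] const[OF x] by (intro exI[of _ "ball x (r x)"]) simp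
  qed
  then show ?thesis unfolding AE_M_iff by blast
qed

end


section \<open>Rellich compactness\<close>

lemma sq_int_compact_support:
  fixes f :: "'a::euclidean_space \<Rightarrow> 'b::euclidean_space"
  assumes "continuous_on UNIV f" "compact K" "\<And>x. x \<notin> K \<Longrightarrow> f x = 0"
  shows "sq_int lborel f"
proof -
  have "integrable lborel (\<lambda>x. (norm (f x))\<^sup>2)"
    using assms by (intro compact_support_integrable[of _ K] continuous_intros) auto
  then show ?thesis
    using borel_measurable_continuous_onI[OF assms(1)] by (simp add: sq_int_def)
qed

lemma sq_int_lborel_test_fun_shift:
  assumes "test_fun U \<phi>" shows "sq_int lborel (\<lambda>x. \<phi> (x + z))"
proof (rule test_funE[OF assms])
  fix K assume K: "compact K" "\<And>x. x \<notin> K \<Longrightarrow> \<phi> x = 0"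
  obtain K' where "compact K'" "\<And>x. x \<notin> K' \<Longrightarrow> \<phi> (x + z) = 0"
    using compact_support_shift[of K \<phi> z] K by blast
  then show ?thesis
    by (rule sq_int_compact_support[OF smooth_continuous[OF smooth_shift[OF test_fun_smooth[OF assms]]]])
qed

lemma sq_int_lborel_test_fun: "test_fun U \<phi> \<Longrightarrow> sq_int lborel \<phi>"
  using sq_int_lborel_test_fun_shift[of U \<phi> 0] by simp

lemma sq_int_lborel_cgrad:
  assumes "test_fun U \<phi>" shows "sq_int lborel (cgrad \<phi>)"
  by (rule test_funE[OF assms])
    (rule sq_int_compact_support[OF smooth_cgrad_continuous[OF test_fun_smooth[OF assms]]])

section \<open>The modulus of continuity in the square norm\<close>

lemma l2_lborel_shift:
  fixes f :: "'a::euclidean_space \<Rightarrow> 'b::euclidean_space"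
  assumes "f \<in> borel_measurable borel"
  shows "l2 lborel (\<lambda>x. f (x + z)) = l2 lborel f"
  using lborel_integral_shift[of "\<lambda>x. (norm (f x))\<^sup>2" z] assms by (simp add: l2_def)

text \<open>Telescoping over \<open>k\<close> equal steps; by translation invariance all increments
  have the same norm.\<close>

lemma l2_translate_le_multiple:
  assumes \<phi>: "test_fun U \<phi>"
  shows "l2 lborel (\<lambda>x. \<phi> (x + real k *\<^sub>R w) - \<phi> x) \<le> real k * l2 lborel (\<lambda>x. \<phi> (x + w) - \<phi> x)"
proof (induction k)
  case (Suc k)
  note sq = sq_int_lborel_test_fun_shift[OF \<phi>] sq_int_lborel_test_fun[OF \<phi>]
  have "(\<lambda>x. \<phi> (x + w) - \<phi> x) \<in> borel_measurable borel"
    using sq_int_measurable[OF sq_int_diff[OF sq]] by simp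
  then have "l2 lborel (\<lambda>x. \<phi> (x + real k *\<^sub>R w + w) - \<phi> (x + real k *\<^sub>R w)) = l2 lborel (\<lambda>x. \<phi> (x + w) - \<phi> x)"
    using l2_lborel_shift[of "\<lambda>x. \<phi> (x + w) - \<phi> x" "real k *\<^sub>R w"] by simp
  moreover have "x + real (Suc k) *\<^sub>R w = x + real k *\<^sub>R w + w" for x
    by (simp add: algebra_simps)
  ultimately show ?case
    using l2_triangle_diff[OF sq(1)[of "real (Suc k) *\<^sub>R w"] sq(1)[of "real k *\<^sub>R w"] sq(2)] Suc
    by (simp add: algebra_simps)
qed simp

text \<open>Cutting the translation into \<open>Suc n\<close> pieces bounds its effect by the norm
  of a difference quotient with step \<open>inverse (Suc n)\<close>. As \<open>n\<close> grows this
  norm tends to that of the directional derivative, so no line integral and no integral form of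
  Minkowski's inequality is involved.\<close>

lemma l2_translate_le:
  assumes \<phi>: "test_fun U \<phi>"
  shows "l2 lborel (\<lambda>x. \<phi> (x + z) - \<phi> x) \<le> norm z * l2 lborel (cgrad \<phi>)"
proof -
  note sm = test_fun_smooth[OF \<phi>]
  note sq = sq_int_lborel_test_fun_shift[OF \<phi>] sq_int_lborel_test_fun[OF \<phi>]
  define t where "t n = inverse (real (Suc n))" for n
  define D where "D n x = (\<phi> (x + t n *\<^sub>R z) - \<phi> x) / t n" for n x
  have Dsc: "D n x = real (Suc n) *\<^sub>R (\<phi> (x + t n *\<^sub>R z) - \<phi> x)" for n x
    by (simp add: D_def t_def divide_inverse mult.commute)
  have Dsq: "sq_int lborel (D n)" for n
    unfolding Dsc[abs_def] by (intro sq_int_scaleR sq_int_diff sq)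
  have cm: "(\<lambda>x. cgrad \<phi> x \<bullet> z) \<in> borel_measurable lborel"
    using sq_int_measurable[OF sq_int_lborel_cgrad[OF \<phi>]] by measurable
  have cle: "AE x in lborel. norm (cgrad \<phi> x \<bullet> z) \<le> norm z * norm (cgrad \<phi> x)"
    by (intro AE_I2) (simp add: Cauchy_Schwarz_ineq2 mult.commute[of "norm z"])
  have csq: "sq_int lborel (\<lambda>x. cgrad \<phi> x \<bullet> z)"
    by (rule sq_int_bound[OF sq_int_lborel_cgrad[OF \<phi>] cm cle])
  obtain K C where K: "compact K" "\<And>n x. \<bar>D n x\<bar> \<le> indicator K x * C" "\<And>x. \<bar>cgrad \<phi> x \<bullet> z\<bar> \<le> indicator K x * C"
    unfolding D_def t_def using test_fun_difference_quotient_dominated[OF \<phi>, of z] by auto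
  have "(\<lambda>n. l2 lborel (\<lambda>x. D n x - cgrad \<phi> x \<bullet> z)) \<longlonglongrightarrow> 0"
  proof (rule l2_dominated_tendsto[where w="\<lambda>x. 2 * (indicator K x * C)"])
    show "(\<lambda>x. D n x - cgrad \<phi> x \<bullet> z) \<in> borel_measurable lborel" for n
      using sq_int_measurable[OF sq_int_diff[OF Dsq csq]] .
    have "integrable lborel (\<lambda>x. indicator K x *\<^sub>R (2 * C)\<^sup>2)"
      by (rule borel_integrable_compact[OF K(1)]) simp
    moreover have "(\<lambda>x. indicator K x *\<^sub>R (2 * C)\<^sup>2) = (\<lambda>x. (norm (2 * (indicator K x * C)))\<^sup>2)"
      by (auto simp: indicator_def power_mult_distrib)
    ultimately have "integrable lborel (\<lambda>x. (norm (2 * (indicator K x * C)))\<^sup>2)" by metis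
    moreover have "K \<in> sets borel" using K(1) by (rule borel_compact)
    ultimately show "sq_int lborel (\<lambda>x. 2 * (indicator K x * C))"
      unfolding sq_int_def by (auto intro!: borel_measurable_times borel_measurable_indicator)
    show "AE x in lborel. norm (D n x - cgrad \<phi> x \<bullet> z) \<le> 2 * (indicator K x * C)" for n
    proof (rule AE_I2)
      fix x show "norm (D n x - cgrad \<phi> x \<bullet> z) \<le> 2 * (indicator K x * C)"
        using K(2)[of n x] K(3)[of x] abs_triangle_ineq4[of "D n x" "cgrad \<phi> x \<bullet> z"] by simp
    qed
    have "(\<lambda>n. D n x - cgrad \<phi> x \<bullet> z) \<longlonglongrightarrow> 0" for x
      unfolding D_def t_def using LIM_zero[OF difference_quotient_tendsto[OF sm]] by blast
    then show "AE x in lborel. (\<lambda>n. D n x - cgrad \<phi> x \<bullet> z) \<longlonglongrightarrow> 0" by simp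
  qed
  then have "(\<lambda>n. l2 lborel (D n)) \<longlonglongrightarrow> l2 lborel (\<lambda>x. cgrad \<phi> x \<bullet> z)"
    by (rule l2_tendsto_l2[OF Dsq csq])
  moreover have "l2 lborel (\<lambda>x. \<phi> (x + z) - \<phi> x) \<le> l2 lborel (D n)" for n
  proof -
    have "real (Suc n) *\<^sub>R (t n *\<^sub>R z) = z" by (simp add: t_def)
    then show ?thesis
      using l2_translate_le_multiple[OF \<phi>, of "Suc n" "t n *\<^sub>R z"] unfolding Dsc[abs_def] l2_scaleR by simp
  qed
  ultimately have "l2 lborel (\<lambda>x. \<phi> (x + z) - \<phi> x) \<le> l2 lborel (\<lambda>x. cgrad \<phi> x \<bullet> z)"
    using LIMSEQ_le_const by blast
  also have "\<dots> \<le> \<bar>norm z\<bar> * l2 lborel (cgrad \<phi>)"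
    by (rule l2_bound[OF sq_int_lborel_cgrad[OF \<phi>] cm cle])
  finally show ?thesis by simp
qed

text \<open>Convolution with the normalized indicator of a ball, used as the smoothing operator in
  Rellich's theorem: it supplies equicontinuity and stays close in the square norm.\<close>

definition ball_mean :: "real \<Rightarrow> ('a::euclidean_space \<Rightarrow> real) \<Rightarrow> 'a \<Rightarrow> real" where
  "ball_mean h u x = (\<integral>z. u (x + z) \<partial>restrict_space lborel (ball 0 h)) / measure lborel (ball (0::'a) h)"

lemma finite_measure_ball: "finite_measure (restrict_space lborel (ball (0::'a::euclidean_space) h))"
  using emeasure_lborel_ball_finite[of "0::'a" h]
  by (intro finite_measureI) (simp add: emeasure_restrict_space)

lemma measure_space_ball:
  "measure (restrict_space lborel (ball 0 h)) (space (restrict_space lborel (ball (0::'a::euclidean_space) h)))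
    = measure lborel (ball (0::'a) h)"
  by (simp add: measure_restrict_space space_restrict_space)

lemma measure_ball_pos: "0 < h \<Longrightarrow> 0 < measure lborel (ball (0::'a::euclidean_space) h)"
  using content_ball_pos[of h "0::'a"] by simp

lemma l2_restrict_le:
  fixes f :: "'a::euclidean_space \<Rightarrow> 'b::euclidean_space"
  assumes "sq_int lborel f" "B \<in> sets borel"
  shows "l2 (restrict_space lborel B) f \<le> l2 lborel f"
proof -
  have "(\<integral>x. (norm (f x))\<^sup>2 \<partial>restrict_space lborel B) = (\<integral>x. indicator B x *\<^sub>R (norm (f x))\<^sup>2 \<partial>lborel)"
    using assms(2) by (intro integral_restrict_space) simp
  also have "\<dots> \<le> (\<integral>x. (norm (f x))\<^sup>2 \<partial>lborel)"
  proof (rule integral_mono)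
    show i: "integrable lborel (\<lambda>x. (norm (f x))\<^sup>2)" using assms(1) by (rule sq_int_integrable)
    then show "integrable lborel (\<lambda>x. indicator B x *\<^sub>R (norm (f x))\<^sup>2)"
      using assms(2) by (intro integrable_mult_indicator) simp
  qed (auto simp: indicator_def)
  finally show ?thesis unfolding l2_def by (rule real_sqrt_le_mono)
qed

lemma sq_int_restrict:
  fixes f :: "'a::euclidean_space \<Rightarrow> 'b::euclidean_space"
  assumes "sq_int lborel f" "B \<in> sets borel"
  shows "sq_int (restrict_space lborel B) f"
proof -
  have "integrable lborel (\<lambda>x. indicator B x *\<^sub>R (norm (f x))\<^sup>2)"
    using assms(2) sq_int_integrable[OF assms(1)] by (intro integrable_mult_indicator) simp_all
  then show ?thesis
    using assms integrable_restrict_space[of B lborel "\<lambda>x. (norm (f x))\<^sup>2"]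
    by (simp add: sq_int_def measurable_restrict_space1)
qed

lemma ball_integral_le_l2:
  fixes f :: "'a::euclidean_space \<Rightarrow> real"
  assumes "sq_int (restrict_space lborel (ball 0 h)) f"
  shows "\<bar>\<integral>z. f z \<partial>restrict_space lborel (ball 0 h)\<bar> \<le>
    sqrt (measure lborel (ball (0::'a) h)) * l2 (restrict_space lborel (ball 0 h)) f"
proof -
  have "\<bar>\<integral>z. f z \<partial>restrict_space lborel (ball 0 h)\<bar> \<le> (\<integral>z. norm (f z) \<partial>restrict_space lborel (ball 0 h))"
    using integral_norm_bound[of "restrict_space lborel (ball 0 h)" f] by simp
  also have "\<dots> \<le> sqrt (measure lborel (ball (0::'a) h)) * l2 (restrict_space lborel (ball 0 h)) f"
    using finite_measure.integral_norm_le_l2[OF finite_measure_ball assms] by (simp only: measure_space_ball)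
  finally show ?thesis .
qed

lemma sq_int_ball_shift:
  assumes "test_fun U \<phi>" shows "sq_int (restrict_space lborel (ball 0 h)) (\<lambda>z. \<phi> (x + z))"
  using sq_int_restrict[OF sq_int_lborel_test_fun_shift[OF assms, of x], of "ball 0 h"]
  by (simp add: add.commute)

text \<open>Cauchy-Schwarz on the ball gives a supremum bound in terms of the square norm and
  \<open>h\<close> alone, so it is uniform over a bounded family.\<close>

lemma ball_mean_bound:
  fixes \<phi> :: "'a::euclidean_space \<Rightarrow> real"
  assumes \<phi>: "test_fun U \<phi>" and h: "0 < h"
  shows "\<bar>ball_mean h \<phi> x\<bar> \<le> l2 lborel \<phi> / sqrt (measure lborel (ball (0::'a) h))"
proof -
  define V where "V = measure lborel (ball (0::'a) h)"
  have V: "0 < V" unfolding V_def by (rule measure_ball_pos[OF h])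
  have "\<bar>\<integral>z. \<phi> (x + z) \<partial>restrict_space lborel (ball 0 h)\<bar> \<le> sqrt V * l2 (restrict_space lborel (ball 0 h)) (\<lambda>z. \<phi> (x + z))"
    unfolding V_def by (rule ball_integral_le_l2[OF sq_int_ball_shift[OF \<phi>]])
  also have "\<dots> \<le> sqrt V * l2 lborel \<phi>"
    using l2_restrict_le[OF sq_int_lborel_test_fun_shift[OF \<phi>, of x], of "ball 0 h"]
      l2_lborel_shift[of \<phi> x] sq_int_measurable[OF sq_int_lborel_test_fun[OF \<phi>]] V
    by (intro mult_left_mono) (simp_all add: add.commute)
  finally have "\<bar>\<integral>z. \<phi> (x + z) \<partial>restrict_space lborel (ball 0 h)\<bar> / V \<le> sqrt V * l2 lborel \<phi> / V"
    using V by (intro divide_right_mono) auto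
  also have "sqrt V * l2 lborel \<phi> / V = l2 lborel \<phi> / sqrt V"
    using V by (simp add: real_div_sqrt field_simps)
  finally show ?thesis using V by (simp add: ball_mean_def V_def)
qed

text \<open>The Lipschitz constant comes from the translation estimate in the square norm and not
  from the supremum of the gradient; this keeps it uniform over a family bounded in the Sobolev
  norm.\<close>

lemma ball_mean_Lipschitz:
  fixes \<phi> :: "'a::euclidean_space \<Rightarrow> real"
  assumes \<phi>: "test_fun U \<phi>" and h: "0 < h"
  shows "\<bar>ball_mean h \<phi> x - ball_mean h \<phi> y\<bar> \<le>
    norm (x - y) * (l2 lborel (cgrad \<phi>) / sqrt (measure lborel (ball (0::'a) h)))"
proof -
  define V where "V = measure lborel (ball (0::'a) h)"
  define N where "N = restrict_space lborel (ball (0::'a) h)"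
  have V: "0 < V" unfolding V_def by (rule measure_ball_pos[OF h])
  note sN = sq_int_ball_shift[OF \<phi>, of h, folded N_def]
  interpret N: finite_measure N unfolding N_def by (rule finite_measure_ball)
  have sh: "sq_int lborel (\<lambda>z. \<phi> (x + z) - \<phi> (y + z))"
    using sq_int_diff[OF sq_int_lborel_test_fun_shift[OF \<phi>, of x] sq_int_lborel_test_fun_shift[OF \<phi>, of y]]
    by (simp add: add.commute)
  have "(\<integral>z. \<phi> (x + z) \<partial>N) - (\<integral>z. \<phi> (y + z) \<partial>N) = (\<integral>z. \<phi> (x + z) - \<phi> (y + z) \<partial>N)"
    using N.sq_int_imp_integrable[OF sN] by simp
  then have "\<bar>(\<integral>z. \<phi> (x + z) \<partial>N) - (\<integral>z. \<phi> (y + z) \<partial>N)\<bar> \<le> sqrt V * l2 N (\<lambda>z. \<phi> (x + z) - \<phi> (y + z))"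
    unfolding V_def N_def using ball_integral_le_l2[OF sq_int_diff[OF sN sN, unfolded N_def]] by simp
  also have "\<dots> \<le> sqrt V * l2 lborel (\<lambda>z. \<phi> (x + z) - \<phi> (y + z))"
    using l2_restrict_le[OF sh, of "ball 0 h"] V unfolding N_def by (intro mult_left_mono) simp_all
  also have "l2 lborel (\<lambda>z. \<phi> (x + z) - \<phi> (y + z)) = l2 lborel (\<lambda>z. \<phi> (z + (x - y)) - \<phi> z)"
    using l2_lborel_shift[of "\<lambda>z. \<phi> (z + (x - y)) - \<phi> z" y]
      sq_int_measurable[OF sq_int_diff[OF sq_int_lborel_test_fun_shift[OF \<phi>, of "x - y"] sq_int_lborel_test_fun[OF \<phi>]]]
    by (simp add: algebra_simps)
  also have "sqrt V * \<dots> \<le> sqrt V * (norm (x - y) * l2 lborel (cgrad \<phi>))"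
    using V by (intro mult_left_mono l2_translate_le[OF \<phi>]) simp
  finally have "\<bar>(\<integral>z. \<phi> (x + z) \<partial>N) - (\<integral>z. \<phi> (y + z) \<partial>N)\<bar> / V \<le> sqrt V * (norm (x - y) * l2 lborel (cgrad \<phi>)) / V"
    using V by (intro divide_right_mono) auto
  also have "\<dots> = norm (x - y) * (l2 lborel (cgrad \<phi>) / sqrt V)"
    using V by (simp add: real_div_sqrt field_simps)
  finally show ?thesis using V by (simp add: ball_mean_def V_def N_def diff_divide_distrib[symmetric])
qed

lemma ball_mean_continuous:
  assumes "test_fun U \<phi>" "0 < h" shows "continuous_on UNIV (ball_mean h \<phi>)"
proof -
  define C where "C = l2 lborel (cgrad \<phi>) / sqrt (measure lborel (ball (0::'a) h))"
  have "C-lipschitz_on UNIV (ball_mean h \<phi>)"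
    using ball_mean_Lipschitz[OF assms]
    by (intro lipschitz_onI) (auto simp: C_def dist_norm mult.commute)
  then show ?thesis by (rule lipschitz_on_continuous_on)
qed

text \<open>Jensen's inequality, obtained from Cauchy-Schwarz on the ball. The nonnegative integral
  on the right prepares the interchange of integrals without a discussion of integrability.\<close>

lemma ball_mean_close_pointwise:
  fixes \<phi> :: "'a::euclidean_space \<Rightarrow> real"
  assumes \<phi>: "test_fun U \<phi>" and h: "0 < h"
  shows "ennreal ((ball_mean h \<phi> x - \<phi> x)\<^sup>2) * ennreal (measure lborel (ball (0::'a) h)) \<le>
    (\<integral>\<^sup>+z. ennreal ((\<phi> (x + z) - \<phi> x)\<^sup>2) * indicator (ball 0 h) z \<partial>lborel)"
proof -
  define V where "V = measure lborel (ball (0::'a) h)"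
  define N where "N = restrict_space lborel (ball (0::'a) h)"
  have V: "0 < V" unfolding V_def by (rule measure_ball_pos[OF h])
  interpret N: finite_measure N unfolding N_def by (rule finite_measure_ball)
  note sN = sq_int_ball_shift[OF \<phi>, of h, folded N_def]
  have sc: "sq_int N (\<lambda>z. \<phi> x)" by (simp add: sq_int_def)
  have mV: "measure N (space N) = V" unfolding N_def V_def by (rule measure_space_ball)
  have "V * (ball_mean h \<phi> x - \<phi> x) = (\<integral>z. \<phi> (x + z) - \<phi> x \<partial>N)"
    using N.sq_int_imp_integrable[OF sN] V mV
    by (simp add: ball_mean_def V_def[symmetric] N_def[symmetric] right_diff_distrib)
  then have "\<bar>V * (ball_mean h \<phi> x - \<phi> x)\<bar> \<le> sqrt V * l2 N (\<lambda>z. \<phi> (x + z) - \<phi> x)"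
    using ball_integral_le_l2[OF sq_int_diff[OF sN sc, unfolded N_def], folded N_def V_def] by simp
  then have "V * \<bar>ball_mean h \<phi> x - \<phi> x\<bar> \<le> sqrt V * l2 N (\<lambda>z. \<phi> (x + z) - \<phi> x)"
    using V by (simp add: abs_mult)
  then have sq: "(V * \<bar>ball_mean h \<phi> x - \<phi> x\<bar>)\<^sup>2 \<le> (sqrt V * l2 N (\<lambda>z. \<phi> (x + z) - \<phi> x))\<^sup>2"
    using V by (intro power_mono) auto
  have "V * (V * (ball_mean h \<phi> x - \<phi> x)\<^sup>2) \<le> V * (l2 N (\<lambda>z. \<phi> (x + z) - \<phi> x))\<^sup>2"
  proof -
    have "(V * \<bar>ball_mean h \<phi> x - \<phi> x\<bar>)\<^sup>2 = V * (V * (ball_mean h \<phi> x - \<phi> x)\<^sup>2)"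
      by (simp add: power_mult_distrib) (simp add: power2_eq_square)
    moreover have "(sqrt V * l2 N (\<lambda>z. \<phi> (x + z) - \<phi> x))\<^sup>2 = V * (l2 N (\<lambda>z. \<phi> (x + z) - \<phi> x))\<^sup>2"
      using V by (simp add: power_mult_distrib)
    ultimately show ?thesis using sq by metis
  qed
  then have "V * (ball_mean h \<phi> x - \<phi> x)\<^sup>2 \<le> (\<integral>z. (\<phi> (x + z) - \<phi> x)\<^sup>2 \<partial>N)"
    using V by (simp add: l2_def)
  then have "ennreal ((ball_mean h \<phi> x - \<phi> x)\<^sup>2 * V) \<le> ennreal (\<integral>z. (\<phi> (x + z) - \<phi> x)\<^sup>2 \<partial>N)"
    by (intro ennreal_leI) (simp add: mult.commute)
  also have "\<dots> = (\<integral>\<^sup>+z. ennreal ((\<phi> (x + z) - \<phi> x)\<^sup>2) \<partial>N)"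
    using sq_int_integrable[OF sq_int_diff[OF sN sc]] by (intro nn_integral_eq_integral[symmetric]) auto
  also have "\<dots> = (\<integral>\<^sup>+z. ennreal ((\<phi> (x + z) - \<phi> x)\<^sup>2) * indicator (ball 0 h) z \<partial>lborel)"
    unfolding N_def by (rule nn_integral_restrict_space) simp
  finally show ?thesis using V by (simp add: ennreal_mult V_def)
qed

text \<open>After integration in \<open>x\<close> and Tonelli the inner integral is the squared norm
  of a translation difference with \<open>norm z < h\<close>; the volume of the ball then
  cancels.\<close>

lemma ball_mean_close:
  fixes \<phi> :: "'a::euclidean_space \<Rightarrow> real"
  assumes \<phi>: "test_fun U \<phi>" and h: "0 < h"
  shows "(\<integral>\<^sup>+x. ennreal ((ball_mean h \<phi> x - \<phi> x)\<^sup>2) \<partial>lborel) \<le> ennreal ((h * l2 lborel (cgrad \<phi>))\<^sup>2)"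
proof -
  define V where "V = measure lborel (ball (0::'a) h)"
  have V: "0 < V" unfolding V_def by (rule measure_ball_pos[OF h])
  note sm = test_fun_smooth[OF \<phi>]
  have [measurable]: "\<phi> \<in> borel_measurable borel"
    using smooth_continuous[OF sm] by (rule borel_measurable_continuous_onI)
  have [measurable]: "ball_mean h \<phi> \<in> borel_measurable borel"
    using ball_mean_continuous[OF \<phi> h] by (rule borel_measurable_continuous_onI)
  have VE: "ennreal V = emeasure lborel (ball (0::'a) h)"
    unfolding V_def using emeasure_lborel_ball_finite[of "0::'a" h] by (simp add: emeasure_eq_ennreal_measure)
  have "(\<integral>\<^sup>+x. ennreal ((ball_mean h \<phi> x - \<phi> x)\<^sup>2) \<partial>lborel) * ennreal V
      = (\<integral>\<^sup>+x. ennreal ((ball_mean h \<phi> x - \<phi> x)\<^sup>2) * ennreal V \<partial>lborel)"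
    by (rule nn_integral_multc[symmetric]) measurable
  also have "\<dots> \<le> (\<integral>\<^sup>+x. (\<integral>\<^sup>+z. ennreal ((\<phi> (x + z) - \<phi> x)\<^sup>2) * indicator (ball 0 h) z \<partial>lborel) \<partial>lborel)"
    unfolding V_def by (intro nn_integral_mono ball_mean_close_pointwise[OF \<phi> h])
  also have "\<dots> = (\<integral>\<^sup>+z. (\<integral>\<^sup>+x. ennreal ((\<phi> (x + z) - \<phi> x)\<^sup>2) * indicator (ball 0 h) z \<partial>lborel) \<partial>lborel)"
  proof (rule lborel_pair.Fubini')
    have "ball (0::'a) h \<in> sets borel" by simp
    then have [measurable]: "(\<lambda>p::'a \<times> 'a. indicator (ball 0 h) (fst p) :: ennreal) \<in> borel_measurable (borel \<Otimes>\<^sub>M borel)"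
      by (intro measurable_compose[OF measurable_fst borel_measurable_indicator])
    show "(\<lambda>(z, x). ennreal ((\<phi> (x + z) - \<phi> x)\<^sup>2) * indicator (ball 0 h) z) \<in> borel_measurable (lborel \<Otimes>\<^sub>M lborel)"
      unfolding split_beta by measurable
  qed
  also have "\<dots> \<le> (\<integral>\<^sup>+z. ennreal ((h * l2 lborel (cgrad \<phi>))\<^sup>2) * indicator (ball (0::'a) h) z \<partial>lborel)"
  proof (rule nn_integral_mono)
    fix z :: 'a
    show "(\<integral>\<^sup>+x. ennreal ((\<phi> (x + z) - \<phi> x)\<^sup>2) * indicator (ball 0 h) z \<partial>lborel) \<le>
        ennreal ((h * l2 lborel (cgrad \<phi>))\<^sup>2) * indicator (ball (0::'a) h) z"
    proof (cases "z \<in> ball 0 h")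
      case True
      have sq: "sq_int lborel (\<lambda>x. \<phi> (x + z) - \<phi> x)"
        by (intro sq_int_diff sq_int_lborel_test_fun_shift[OF \<phi>] sq_int_lborel_test_fun[OF \<phi>])
      have "(\<integral>\<^sup>+x. ennreal ((\<phi> (x + z) - \<phi> x)\<^sup>2) \<partial>lborel) = ennreal ((l2 lborel (\<lambda>x. \<phi> (x + z) - \<phi> x))\<^sup>2)"
        using sq_int_integrable[OF sq] by (simp add: l2_def nn_integral_eq_integral)
      also have "\<dots> \<le> ennreal ((h * l2 lborel (cgrad \<phi>))\<^sup>2)"
      proof (intro ennreal_leI power_mono)
        have "l2 lborel (\<lambda>x. \<phi> (x + z) - \<phi> x) \<le> norm z * l2 lborel (cgrad \<phi>)" by (rule l2_translate_le[OF \<phi>])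
        also have "\<dots> \<le> h * l2 lborel (cgrad \<phi>)" using True by (intro mult_right_mono) auto
        finally show "l2 lborel (\<lambda>x. \<phi> (x + z) - \<phi> x) \<le> h * l2 lborel (cgrad \<phi>)" .
      qed simp
      finally show ?thesis using True by simp
    qed simp
  qed
  also have "\<dots> = ennreal ((h * l2 lborel (cgrad \<phi>))\<^sup>2) * ennreal V"
    by (simp add: nn_integral_cmult_indicator VE)
  finally show ?thesis
    using V ennreal_mult_le_mult_iff[of "ennreal V"] unfolding mult.commute[of _ "ennreal V"] by simp
qed

context bounded_open
begin

section \<open>Transfer to the domain and extraction of subsequences\<close>

lemma l2_M_lborel:
  fixes f :: "'a \<Rightarrow> 'b::euclidean_space"
  assumes "continuous_on UNIV f" "\<And>x. x \<notin> \<Omega> \<Longrightarrow> f x = 0"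
  shows "l2 M f = l2 lborel f"
  unfolding l2_def using assms by (subst integral_M_lborel) (auto intro!: continuous_intros)

lemma sq_int_ball_mean:
  assumes \<phi>: "test_fun \<Omega> \<phi>" and h: "0 < h"
  shows "sq_int M (ball_mean h \<phi>)"
  by (rule sq_int_bounded[OF continuous_measurable_M[OF ball_mean_continuous[OF \<phi> h]]])
    (use ball_mean_bound[OF \<phi> h] in \<open>auto intro!: AE_I2\<close>)

lemma l2_ball_mean_close:
  assumes \<phi>: "test_fun \<Omega> \<phi>" and h: "0 < h"
  shows "l2 M (\<lambda>x. ball_mean h \<phi> x - \<phi> x) \<le> h * l2 M (cgrad \<phi>)"
proof -
  have sq: "sq_int M (\<lambda>x. ball_mean h \<phi> x - \<phi> x)"
    by (intro sq_int_diff sq_int_ball_mean sq_int_test_fun \<phi> h)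
  have "ennreal ((l2 M (\<lambda>x. ball_mean h \<phi> x - \<phi> x))\<^sup>2) = (\<integral>\<^sup>+x. ennreal ((ball_mean h \<phi> x - \<phi> x)\<^sup>2) \<partial>M)"
    using sq_int_integrable[OF sq] by (simp add: l2_def nn_integral_eq_integral)
  also have "\<dots> = (\<integral>\<^sup>+x. ennreal ((ball_mean h \<phi> x - \<phi> x)\<^sup>2) * indicator \<Omega> x \<partial>lebesgue)"
    by (rule nn_integral_restrict_space) simp
  also have "\<dots> \<le> (\<integral>\<^sup>+x. ennreal ((ball_mean h \<phi> x - \<phi> x)\<^sup>2) \<partial>lebesgue)"
    by (rule nn_integral_mono) (auto simp: indicator_def)
  also have "\<dots> \<le> ennreal ((h * l2 lborel (cgrad \<phi>))\<^sup>2)"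
    unfolding nn_integral_completion by (rule ball_mean_close[OF \<phi> h])
  also have "l2 lborel (cgrad \<phi>) = l2 M (cgrad \<phi>)"
    by (rule l2_M_lborel[symmetric, OF smooth_cgrad_continuous[OF test_fun_smooth[OF \<phi>]]])
      (use test_fun_outside[OF \<phi>] in blast)
  finally have "(l2 M (\<lambda>x. ball_mean h \<phi> x - \<phi> x))\<^sup>2 \<le> (h * l2 M (cgrad \<phi>))\<^sup>2" by simp
  then show ?thesis by (rule power2_le_imp_le) (use h in simp)
qed

text \<open>At one fixed accuracy: the ball means are bounded and equicontinuous, so Arzela-Ascoli
  on the compact closure gives a uniformly convergent subsequence. Two smoothing errors and one
  uniform error, each at most e / 4, add up to less than \<open>e\<close>.\<close>

lemma Rellich_step:
  assumes \<phi>: "\<And>n. test_fun \<Omega> (\<phi> n)" and C: "\<And>n. l2 M (jet (\<phi> n)) \<le> C" and e: "0 < e"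
  shows "\<exists>k :: nat \<Rightarrow> nat. strict_mono k \<and> (\<exists>N. \<forall>m\<ge>N. \<forall>n\<ge>N. l2 M (\<lambda>x. \<phi> (k m) x - \<phi> (k n) x) < e)"
proof -
  have C0: "0 \<le> C" using order_trans[OF l2_nonneg C] .
  \<comment> \<open>The summand 1 keeps the denominator positive when \<open>C\<close> is 0; the
    choice makes the smoothing error \<open>h * C\<close> at most \<open>e / 4\<close>.\<close>
  define h where "h = e / (4 * (C + 1))"
  have h: "0 < h" using e C0 by (simp add: h_def)
  have hC: "h * C \<le> e / 4"
  proof -
    have "h * C \<le> h * (C + 1)" using h by (intro mult_left_mono) auto
    also have "\<dots> = e / 4" using C0 by (simp add: h_def field_simps)
    finally show ?thesis .
  qed
  define W where "W = sqrt (measure lborel (ball (0::'a) h))"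
  have W: "0 < W" using measure_ball_pos[OF h, where 'a='a] by (simp add: W_def)
  have l: "l2 M (\<phi> n) \<le> C" "l2 M (cgrad (\<phi> n)) \<le> C" for n
    using l2_fst_le[OF sq_int_jet[OF \<phi>[of n]]] l2_snd_le[OF sq_int_jet[OF \<phi>[of n]]] C[of n]
    by (simp_all add: jet_def)
  have l': "l2 lborel (\<phi> n) \<le> C" "l2 lborel (cgrad (\<phi> n)) \<le> C" for n
  proof -
    note sm = test_fun_smooth[OF \<phi>[of n]]
    have "l2 M (\<phi> n) = l2 lborel (\<phi> n)"
      by (rule l2_M_lborel[OF smooth_continuous[OF sm]]) (use test_fun_outside[OF \<phi>] in blast)
    moreover have "l2 M (cgrad (\<phi> n)) = l2 lborel (cgrad (\<phi> n))"
      by (rule l2_M_lborel[OF smooth_cgrad_continuous[OF sm]]) (use test_fun_outside[OF \<phi>] in blast)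
    ultimately show "l2 lborel (\<phi> n) \<le> C" "l2 lborel (cgrad (\<phi> n)) \<le> C" using l[of n] by simp_all
  qed
  define w where "w n = ball_mean h (\<phi> n)" for n
  have wb: "norm (w n x) \<le> C / W" for n x
  proof -
    have "norm (w n x) \<le> l2 lborel (\<phi> n) / W" using ball_mean_bound[OF \<phi> h] by (simp add: w_def W_def)
    also have "\<dots> \<le> C / W" using l'(1) W by (intro divide_right_mono) auto
    finally show ?thesis .
  qed
  have wL: "norm (w n x - w n y) \<le> norm (x - y) * (C / W)" for n x y
  proof -
    have "norm (w n x - w n y) \<le> norm (x - y) * (l2 lborel (cgrad (\<phi> n)) / W)"
      using ball_mean_Lipschitz[OF \<phi> h] by (simp add: w_def W_def)
    also have "\<dots> \<le> norm (x - y) * (C / W)" using l'(2) W by (intro mult_left_mono divide_right_mono) auto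
    finally show ?thesis .
  qed
  have equi: "\<exists>d. 0 < d \<and> (\<forall>n y. y \<in> closure \<Omega> \<and> norm (x - y) < d \<longrightarrow> norm (w n x - w n y) < \<epsilon>)"
    if \<epsilon>: "0 < \<epsilon>" for x :: 'a and \<epsilon>
  proof (intro exI conjI allI impI)
    define d where "d = \<epsilon> / (C / W + 1)"
    have CW: "0 < C / W + 1" using C0 W by (intro add_nonneg_pos) auto
    then show "0 < d" using \<epsilon> by (simp add: d_def)
    fix n y assume y: "y \<in> closure \<Omega> \<and> norm (x - y) < d"
    have "norm (w n x - w n y) \<le> norm (x - y) * (C / W)" by (rule wL)
    also have "\<dots> \<le> norm (x - y) * (C / W + 1)" by (intro mult_left_mono) auto
    also have "\<dots> < d * (C / W + 1)" using y CW by (intro mult_strict_right_mono) auto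
    also have "\<dots> = \<epsilon>" using CW by (simp add: d_def)
    finally show "norm (w n x - w n y) < \<epsilon>" .
  qed
  have cpt: "compact (closure \<Omega>)" using bounded_dom by (simp add: compact_closure)
  obtain g k where k: "strict_mono (k :: nat \<Rightarrow> nat)"
      "\<And>e. 0 < e \<Longrightarrow> \<exists>N. \<forall>n x. n \<ge> N \<and> x \<in> closure \<Omega> \<longrightarrow> norm (w (k n) x - g x) < e"
    by (rule Arzela_Ascoli[OF cpt wb equi]) blast+
  define m0 where "m0 = sqrt (measure M (space M)) + 1"
  have m0: "0 < m0" by (simp add: m0_def add_nonneg_pos)
  \<comment> \<open>Two uniform errors \<open>d\<close>, multiplied by the norm of the constant 1,
    which is below \<open>m0\<close>, contribute at most 2 d m0 = e / 4.\<close>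
  define d where "d = e / (8 * m0)"
  have d: "0 < d" using e m0 by (simp add: d_def)
  obtain N where N: "\<And>n x. n \<ge> N \<Longrightarrow> x \<in> closure \<Omega> \<Longrightarrow> norm (w (k n) x - g x) < d" using k(2)[OF d] by blast
  have "l2 M (\<lambda>x. \<phi> (k m) x - \<phi> (k n) x) < e" if mn: "m \<ge> N" "n \<ge> N" for m n
  proof -
    note sw = sq_int_ball_mean[OF \<phi> h, folded w_def]
    note s\<phi> = sq_int_test_fun[OF \<phi>]
    have "l2 M (\<lambda>x. w (k m) x - w (k n) x) \<le> \<bar>2 * d\<bar> * l2 M (\<lambda>x. 1 :: real)"
    proof (rule l2_bound)
      show "sq_int M (\<lambda>x. 1 :: real)" by (simp add: sq_int_def)
      show "(\<lambda>x. w (k m) x - w (k n) x) \<in> borel_measurable M" by (rule sq_int_measurable[OF sq_int_diff[OF sw sw]])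
      show "AE x in M. norm (w (k m) x - w (k n) x) \<le> 2 * d * norm (1::real)"
      proof (rule AE_I2)
        fix x assume "x \<in> space M"
        then have x: "x \<in> closure \<Omega>" using closure_subset by auto
        show "norm (w (k m) x - w (k n) x) \<le> 2 * d * norm (1::real)"
          using N[OF mn(1) x] N[OF mn(2) x] by simp
      qed
    qed
    also have "\<dots> \<le> 2 * d * m0" using d by (simp add: l2_def m0_def)
    also have "\<dots> = e / 4" using m0 by (simp add: d_def)
    finally have 1: "l2 M (\<lambda>x. w (k m) x - w (k n) x) \<le> e / 4" .
    have 2: "l2 M (\<lambda>x. w i x - \<phi> i x) \<le> e / 4" for i
    proof -
      have "l2 M (\<lambda>x. w i x - \<phi> i x) \<le> h * l2 M (cgrad (\<phi> i))" unfolding w_def by (rule l2_ball_mean_close[OF \<phi> h])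
      also have "\<dots> \<le> h * C" using l(2) h by (intro mult_left_mono) auto
      finally show ?thesis using hC by simp
    qed
    have "l2 M (\<lambda>x. \<phi> (k m) x - \<phi> (k n) x) \<le>
        l2 M (\<lambda>x. \<phi> (k m) x - w (k m) x) + (l2 M (\<lambda>x. w (k m) x - w (k n) x) + l2 M (\<lambda>x. w (k n) x - \<phi> (k n) x))"
      using l2_triangle_diff[OF s\<phi>[of "k m"] sw[of "k m"] s\<phi>[of "k n"]]
        l2_triangle_diff[OF sw[of "k m"] sw[of "k n"] s\<phi>[of "k n"]] by simp
    also have "\<dots> \<le> e / 4 + (e / 4 + e / 4)"
      using 1 2[of "k m"] 2[of "k n"] by (simp add: l2_minus_commute[of M "\<phi> (k m)"])
    finally show ?thesis using e by simp
  qed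
  then show ?thesis using k(1) by blast
qed

text \<open>The subsequence of \<open>Rellich_step\<close> depends on the accuracy; a diagonal
  sequence serves all accuracies \<open>inverse (Suc j)\<close> at once.\<close>

lemma Rellich_test_fun:
  assumes \<phi>: "\<And>n. test_fun \<Omega> (\<phi> n)" and C: "\<And>n. l2 M (jet (\<phi> n)) \<le> C"
  shows "\<exists>k :: nat \<Rightarrow> nat. strict_mono k \<and>
    (\<forall>e>0. \<exists>N. \<forall>m\<ge>N. \<forall>n\<ge>N. l2 M (\<lambda>x. \<phi> (k m) x - \<phi> (k n) x) < e)"
proof -
  define P where "P j s \<longleftrightarrow> (\<exists>N. \<forall>m\<ge>N. \<forall>n\<ge>N. l2 M (\<lambda>x. \<phi> (s m) x - \<phi> (s n) x) < inverse (real (Suc j)))"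
    for j :: nat and s :: "nat \<Rightarrow> nat"
  interpret subseqs P
  proof
    fix n :: nat and s :: "nat \<Rightarrow> nat" assume "strict_mono s"
    show "\<exists>r'. strict_mono r' \<and> P n (s \<circ> r')"
      unfolding P_def o_def by (rule Rellich_step[of "\<lambda>i. \<phi> (s i)", OF \<phi> C]) simp
  qed
  \<comment> \<open>Property \<open>j\<close> is known for the diagonal sequence only after its
    first \<open>Suc j\<close> terms have been dropped, and it is inherited by further
    subsequences.\<close>
  have P: "P j (diagseq \<circ> (+) (Suc j))" for j
  proof (rule diagseq_holds)
    fix r s :: "nat \<Rightarrow> nat" and n assume r: "strict_mono r" and "P n s"
    then obtain N where N: "\<forall>m\<ge>N. \<forall>i\<ge>N. l2 M (\<lambda>x. \<phi> (s m) x - \<phi> (s i) x) < inverse (real (Suc n))"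
      unfolding P_def by blast
    have "r i \<ge> N" if "i \<ge> N" for i using seq_suble[OF r, of i] that by simp
    then show "P n (s \<circ> r)" unfolding P_def o_def using N by blast
  qed
  have "\<exists>N. \<forall>m\<ge>N. \<forall>n\<ge>N. l2 M (\<lambda>x. \<phi> (diagseq m) x - \<phi> (diagseq n) x) < e" if e: "0 < e" for e
  proof -
    obtain j where j: "inverse (real (Suc j)) < e" using reals_Archimedean[OF e] by blast
    obtain N where N: "\<And>m n. m \<ge> N \<Longrightarrow> n \<ge> N \<Longrightarrow>
        l2 M (\<lambda>x. \<phi> (diagseq (Suc j + m)) x - \<phi> (diagseq (Suc j + n)) x) < inverse (real (Suc j))"
      using P[of j] unfolding P_def o_def by blast
    have "l2 M (\<lambda>x. \<phi> (diagseq m) x - \<phi> (diagseq n) x) < e" if "m \<ge> Suc j + N" "n \<ge> Suc j + N" for m n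
    proof -
      have "m - Suc j \<ge> N" "n - Suc j \<ge> N" "Suc j + (m - Suc j) = m" "Suc j + (n - Suc j) = n"
        using that by auto
      then show ?thesis using N[of "m - Suc j" "n - Suc j"] j by simp
    qed
    then show ?thesis by blast
  qed
  then show ?thesis using subseq_diagseq by blast
qed

text \<open>Each member is replaced by a test function at distance below
  \<open>inverse (Suc n)\<close>; this costs 1 in the bound, and the error vanishes along every
  subsequence.\<close>

lemma Rellich:
  assumes F: "\<And>n. H1 \<Omega> (F n)" and C: "\<And>n. l2 M (F n) \<le> C"
  shows "\<exists>k :: nat \<Rightarrow> nat. strict_mono k \<and>
    (\<forall>e>0. \<exists>N. \<forall>m\<ge>N. \<forall>n\<ge>N. l2 M (\<lambda>x. fst (F (k m) x) - fst (F (k n) x)) < e)"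
proof -
  have "\<forall>n. \<exists>\<phi>. test_fun \<Omega> \<phi> \<and> l2 M (\<lambda>x. F n x - jet \<phi> x) < inverse (real (Suc n))"
    using F unfolding H1_def by simp
  then obtain \<phi> where \<phi>: "\<And>n. test_fun \<Omega> (\<phi> n)"
      "\<And>n. l2 M (\<lambda>x. F n x - jet (\<phi> n) x) < inverse (real (Suc n))" by metis
  note sF = H1_sq_int[OF F] and sJ = sq_int_jet[OF \<phi>(1)]
  have bd: "l2 M (jet (\<phi> n)) \<le> C + 1" for n
  proof -
    have "inverse (real (Suc n)) \<le> 1" by (simp add: inverse_eq_divide)
    then show ?thesis
      using l2_le_diff[OF sJ[of n] sF[of n]] C[of n] \<phi>(2)[of n] l2_minus_commute[of M "jet (\<phi> n)" "F n"] by simp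
  qed
  obtain k where k: "strict_mono (k :: nat \<Rightarrow> nat)"
      "\<And>e. 0 < e \<Longrightarrow> \<exists>N. \<forall>m\<ge>N. \<forall>n\<ge>N. l2 M (\<lambda>x. \<phi> (k m) x - \<phi> (k n) x) < e"
    using Rellich_test_fun[of \<phi>, OF \<phi>(1) bd] by auto
  have "\<exists>N. \<forall>m\<ge>N. \<forall>n\<ge>N. l2 M (\<lambda>x. fst (F (k m) x) - fst (F (k n) x)) < e" if e: "0 < e" for e
  proof -
    obtain j where j: "inverse (real (Suc j)) < e / 4" using reals_Archimedean[of "e / 4"] e by auto
    obtain N where N: "\<And>m n. m \<ge> N \<Longrightarrow> n \<ge> N \<Longrightarrow> l2 M (\<lambda>x. \<phi> (k m) x - \<phi> (k n) x) < e / 4"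
      using k(2)[of "e / 4"] e by auto
    have close: "l2 M (\<lambda>x. fst (F i x) - \<phi> i x) < e / 4" if "i \<ge> j" for i
    proof -
      have "l2 M (\<lambda>x. fst (F i x) - \<phi> i x) \<le> l2 M (\<lambda>x. F i x - jet (\<phi> i) x)"
        using l2_fst_le[OF sq_int_diff[OF sF[of i] sJ[of i]]] by (simp add: jet_def)
      also have "\<dots> < inverse (real (Suc i))" by (rule \<phi>(2))
      also have "\<dots> \<le> inverse (real (Suc j))" using that by (simp add: le_imp_inverse_le)
      finally show ?thesis using j by simp
    qed
    have "l2 M (\<lambda>x. fst (F (k m) x) - fst (F (k n) x)) < e" if mn: "m \<ge> max N j" "n \<ge> max N j" for m n
    proof -
      have kj: "k m \<ge> j" "k n \<ge> j" using seq_suble[OF k(1)] mn by (meson max.bounded_iff order_trans)+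
      note sf = sq_int_fst[OF sF] and s\<phi> = sq_int_test_fun[OF \<phi>(1)]
      have "l2 M (\<lambda>x. fst (F (k m) x) - fst (F (k n) x)) \<le> l2 M (\<lambda>x. fst (F (k m) x) - \<phi> (k m) x)
          + (l2 M (\<lambda>x. \<phi> (k m) x - \<phi> (k n) x) + l2 M (\<lambda>x. \<phi> (k n) x - fst (F (k n) x)))"
        using l2_triangle_diff[OF sf[of "k m"] s\<phi>[of "k m"] sf[of "k n"]]
          l2_triangle_diff[OF s\<phi>[of "k m"] s\<phi>[of "k n"] sf[of "k n"]] by simp
      then show ?thesis
        using close[OF kj(1)] close[OF kj(2)] N[of m n] mn e l2_minus_commute[of M "\<phi> (k n)"] by simp
    qed
    then show ?thesis by blast
  qed
  then show ?thesis using k(1) by blast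
qed

end


section \<open>The ground state representation\<close>

lemma cgrad_compose:
  assumes "smooth_on UNIV u" "(q has_real_derivative d) (at (u x))"
  shows "cgrad (\<lambda>x. q (u x)) x = d *\<^sub>R cgrad u x"
proof (rule cgrad_eqI)
  have "((\<lambda>x. q (u x)) has_derivative (\<lambda>v. d * (cgrad u x \<bullet> v))) (at x)"
    by (rule has_derivative_compose[OF smooth_has_derivative[OF assms(1)] assms(2)[unfolded has_field_derivative_def]])
  moreover have "(\<lambda>v. d * (cgrad u x \<bullet> v)) = (\<bullet>) (d *\<^sub>R cgrad u x)" by (rule ext) simp
  ultimately show "((\<lambda>x. q (u x)) has_derivative (\<bullet>) (d *\<^sub>R cgrad u x)) (at x)" by (simp only:)
qed

text \<open>A smooth bounded approximation of \<open>1 / s\<close> for \<open>s > 0\<close>, and its derivative.\<close>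
definition rec_approx :: "real \<Rightarrow> real \<Rightarrow> real" where
  "rec_approx \<delta> s = s * inverse (s * s + \<delta>)"

definition rec_approx' :: "real \<Rightarrow> real \<Rightarrow> real" where
  "rec_approx' \<delta> s = (\<delta> - s * s) * (inverse (s * s + \<delta>))\<^sup>2"

lemma rec_approx_den: "0 < \<delta> \<Longrightarrow> 0 < s * s + \<delta>" for s :: real
  by (simp add: add_nonneg_pos)

lemma rec_approx_deriv:
  assumes "0 < \<delta>" shows "(rec_approx \<delta> has_real_derivative rec_approx' \<delta> s) (at s)"
proof -
  have "s * s + \<delta> \<noteq> 0" using rec_approx_den[OF assms, of s] by simp
  then show ?thesis
    unfolding rec_approx_def[abs_def] rec_approx'_def
    by (auto intro!: derivative_eq_intros simp: field_simps power2_eq_square)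
qed

lemma rec_approx_continuous:
  assumes "0 < \<delta>" shows "continuous_on UNIV (rec_approx \<delta>)" "continuous_on UNIV (rec_approx' \<delta>)"
proof -
  have "s * s + \<delta> \<noteq> 0" for s :: real using rec_approx_den[OF assms, of s] by simp
  then show "continuous_on UNIV (rec_approx \<delta>)" "continuous_on UNIV (rec_approx' \<delta>)"
    unfolding rec_approx_def[abs_def] rec_approx'_def[abs_def] by (auto intro!: continuous_intros)
qed

lemma rec_approx'_le: assumes "0 < \<delta>" shows "\<bar>rec_approx' \<delta> s\<bar> \<le> inverse (s * s + \<delta>)"
proof -
  note d = rec_approx_den[OF assms, of s]
  have "\<bar>\<delta> - s * s\<bar> \<le> s * s + \<delta>" using assms zero_le_square[of s] by (simp add: abs_le_iff)
  then have "\<bar>\<delta> - s * s\<bar> * (inverse (s * s + \<delta>))\<^sup>2 \<le> (s * s + \<delta>) * (inverse (s * s + \<delta>))\<^sup>2"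
    by (intro mult_right_mono) auto
  also have "\<dots> = inverse (s * s + \<delta>)" using d by (simp add: power2_eq_square)
  finally show ?thesis by (simp add: rec_approx'_def abs_mult)
qed

text \<open>Bounds that do not depend on \<delta>: the majorant for the limit \<delta>
  \<longlonglongrightarrow> 0 where the ground state is bounded away from 0.\<close>

lemma rec_approx_le_rec:
  assumes "0 < \<delta>" "0 < s"
  shows "\<bar>rec_approx \<delta> s\<bar> \<le> 1 / s" "\<bar>rec_approx' \<delta> s\<bar> \<le> 1 / s\<^sup>2"
proof -
  have i: "inverse (s * s + \<delta>) \<le> inverse (s * s)" using assms by (intro le_imp_inverse_le) auto
  then have "s * inverse (s * s + \<delta>) \<le> s * inverse (s * s)" using assms by (intro mult_left_mono) auto
  then show "\<bar>rec_approx \<delta> s\<bar> \<le> 1 / s"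
    using assms rec_approx_den[OF assms(1), of s] by (simp add: rec_approx_def abs_mult field_simps)
  show "\<bar>rec_approx' \<delta> s\<bar> \<le> 1 / s\<^sup>2"
    using rec_approx'_le[OF assms(1), of s] i by (simp add: power2_eq_square inverse_eq_divide)
qed

text \<open>Bounds that do not depend on \<open>s\<close>: the majorant at fixed \<delta> while the
  argument runs through approximations of the ground state, which may vanish or be negative.\<close>

lemma rec_approx_bounded:
  assumes "0 < \<delta>" "\<delta> \<le> 1"
  shows "\<bar>rec_approx \<delta> s\<bar> \<le> 1 / \<delta>" "\<bar>rec_approx' \<delta> s\<bar> \<le> 1 / \<delta>"
proof -
  note d = rec_approx_den[OF assms(1), of s]
  have "inverse (s * s + \<delta>) \<le> inverse \<delta>" using assms by (intro le_imp_inverse_le) auto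
  then show "\<bar>rec_approx' \<delta> s\<bar> \<le> 1 / \<delta>"
    using rec_approx'_le[OF assms(1), of s] by (simp add: inverse_eq_divide)
  have "\<bar>s\<bar> * \<delta> \<le> s * s + \<delta>"
  proof (cases "\<bar>s\<bar> \<le> 1")
    case True
    then have "\<bar>s\<bar> * \<delta> \<le> 1 * \<delta>" using assms by (intro mult_right_mono) auto
    moreover have "0 \<le> s * s" by simp
    ultimately show ?thesis by linarith
  next
    case False
    have "\<bar>s\<bar> * \<delta> \<le> \<bar>s\<bar> * 1" using assms by (intro mult_left_mono) auto
    also have "\<dots> \<le> \<bar>s\<bar> * \<bar>s\<bar>" using False by (intro mult_left_mono) auto
    finally show ?thesis using assms by simp
  qed
  then show "\<bar>rec_approx \<delta> s\<bar> \<le> 1 / \<delta>"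
    using d assms by (simp add: rec_approx_def abs_mult field_simps)
qed

lemma rec_approx_tendsto_rec:
  assumes "0 < s"
  shows "(\<lambda>n. rec_approx (inverse (real (Suc n))) s) \<longlonglongrightarrow> 1 / s"
    "(\<lambda>n. rec_approx' (inverse (real (Suc n))) s) \<longlonglongrightarrow> - (1 / s\<^sup>2)"
proof -
  have "(\<lambda>n. s * inverse (s * s + inverse (real (Suc n)))) \<longlonglongrightarrow> s * inverse (s * s + 0)"
    using assms by (intro tendsto_intros LIMSEQ_inverse_real_of_nat) auto
  then show "(\<lambda>n. rec_approx (inverse (real (Suc n))) s) \<longlonglongrightarrow> 1 / s"
    using assms unfolding rec_approx_def by (simp add: field_simps)
  have "(\<lambda>n. (inverse (real (Suc n)) - s * s) * (inverse (s * s + inverse (real (Suc n))))\<^sup>2)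
      \<longlonglongrightarrow> (0 - s * s) * (inverse (s * s + 0))\<^sup>2"
    using assms by (intro tendsto_intros LIMSEQ_inverse_real_of_nat) auto
  then show "(\<lambda>n. rec_approx' (inverse (real (Suc n))) s) \<longlonglongrightarrow> - (1 / s\<^sup>2)"
    using assms unfolding rec_approx'_def by (simp add: power2_eq_square field_simps)
qed

text \<open>The lower bound on compact subsets is what gives a meaning to division by \<Phi> against
  compactly supported factors. The equation is assumed for test functions only and extended to the
  Sobolev space in \<open>eigen_H1\<close>.\<close>

locale ground_state = bounded_open \<Omega> for \<Omega> :: "'a::euclidean_space set" +
  fixes \<Phi> :: "'a \<Rightarrow> real" and E :: "'a \<Rightarrow> 'a" and lam :: real
  assumes H1_ground: "H1 \<Omega> (\<lambda>x. (\<Phi> x, E x))"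
    and eigen_test: "\<And>\<phi>. test_fun \<Omega> \<phi> \<Longrightarrow> ip (lebesgue_on \<Omega>) E (cgrad \<phi>) = lam * ip (lebesgue_on \<Omega>) \<Phi> \<phi>"
    and ground_pos: "\<And>x. x \<in> \<Omega> \<Longrightarrow> 0 < \<Phi> x"
    and ground_lower: "\<And>K. compact K \<Longrightarrow> K \<subseteq> \<Omega> \<Longrightarrow> \<exists>c>0. \<forall>x\<in>K. c \<le> \<Phi> x"
begin

lemma sq_int_ground: "sq_int M \<Phi>" "sq_int M E"
  using sq_int_fst[OF H1_sq_int[OF H1_ground]] sq_int_snd[OF H1_sq_int[OF H1_ground]] by simp_all

lemma ground_measurable [measurable]: "\<Phi> \<in> borel_measurable M" "E \<in> borel_measurable M"
  using sq_int_ground by (auto dest: sq_int_measurable)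

lemma test_fun_measurable_M:
  assumes "test_fun \<Omega> \<phi>" shows "\<phi> \<in> borel_measurable M" "cgrad \<phi> \<in> borel_measurable M"
  using sq_int_measurable[OF sq_int_test_fun[OF assms]] sq_int_measurable[OF sq_int_test_fun_cgrad[OF assms]] .

text \<open>The equation says that pairing with the single function
  \<open>(- lam * \<Phi>, E)\<close> annihilates jets; this condition is continuous in the square
  norm and passes to limits.\<close>

lemma eigen_H1:
  assumes "H1 \<Omega> F"
  shows "ip M E (\<lambda>x. snd (F x)) = lam * ip M \<Phi> (\<lambda>x. fst (F x))"
proof -
  note s = H1_sq_int[OF assms]
  obtain \<phi> where \<phi>: "\<And>n. test_fun \<Omega> (\<phi> n)" "(\<lambda>n. l2 M (\<lambda>x. jet (\<phi> n) x - F x)) \<longlonglongrightarrow> 0"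
    using H1_approx[OF assms] by blast
  have G: "sq_int M (\<lambda>x. (- lam * \<Phi> x, E x))"
    using sq_int_Pair[OF sq_int_scaleR[OF sq_int_ground(1), of "- lam"] sq_int_ground(2)] by simp
  have eq: "ip M H (\<lambda>x. (- lam * \<Phi> x, E x)) = ip M E (\<lambda>x. snd (H x)) - lam * ip M \<Phi> (\<lambda>x. fst (H x))"
    if "sq_int M H" for H
    unfolding ip_Pair[OF that G] using ip_scaleR_right[of M "\<lambda>x. fst (H x)" "- lam" \<Phi>]
    by (simp add: ip_commute[of M E] ip_commute[of M \<Phi>])
  have "(\<lambda>n. ip M (jet (\<phi> n)) (\<lambda>x. (- lam * \<Phi> x, E x))) \<longlonglongrightarrow> ip M F (\<lambda>x. (- lam * \<Phi> x, E x))"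
    by (rule l2_tendsto_ip[OF sq_int_jet[OF \<phi>(1)] s G \<phi>(2)])
  moreover have "ip M (jet (\<phi> n)) (\<lambda>x. (- lam * \<Phi> x, E x)) = 0" for n
    unfolding eq[OF sq_int_jet[OF \<phi>(1)]] using eigen_test[OF \<phi>(1)] by (simp add: jet_def)
  ultimately show ?thesis using eq[OF s] by (simp add: LIMSEQ_const_iff)
qed

text \<open>By the product and chain rules the jet of \<zeta> q(\<Phi>) has this shape with \<alpha>
  = q(\<Phi>) and \<beta> = q'(\<Phi>). As \<open>E\<close> is merely square integrable, bounded
  coefficients tending to 0 pointwise are the right input for dominated convergence.\<close>

lemma coefficient_tendsto:
  fixes \<alpha> \<beta> :: "nat \<Rightarrow> 'a \<Rightarrow> real"
  assumes \<zeta>: "test_fun \<Omega> \<zeta>" and K: "\<And>x. x \<notin> K \<Longrightarrow> \<zeta> x = 0" "\<And>x. x \<notin> K \<Longrightarrow> cgrad \<zeta> x = 0"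
    and m: "\<And>n. \<alpha> n \<in> borel_measurable M" "\<And>n. \<beta> n \<in> borel_measurable M"
    and b: "\<And>n x. x \<in> K \<Longrightarrow> \<bar>\<alpha> n x\<bar> \<le> C" "\<And>n x. x \<in> K \<Longrightarrow> \<bar>\<beta> n x\<bar> \<le> C"
    and lim: "AE x in M. (\<lambda>n. \<alpha> n x) \<longlonglongrightarrow> 0" "AE x in M. (\<lambda>n. \<beta> n x) \<longlonglongrightarrow> 0"
  shows "(\<lambda>n. l2 M (\<lambda>x. (\<zeta> x * \<alpha> n x, \<alpha> n x *\<^sub>R cgrad \<zeta> x + (\<zeta> x * \<beta> n x) *\<^sub>R E x))) \<longlonglongrightarrow> 0"
proof -
  note [measurable] = m test_fun_measurable_M[OF \<zeta>]
  obtain B where B: "0 \<le> B" "\<And>x. norm (\<zeta> x) \<le> B" using test_fun_bounded[OF \<zeta>] by blast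
  define w where "w x = \<bar>C\<bar> * (norm (\<zeta> x) + norm (cgrad \<zeta> x) + B * norm (E x))" for x
  show ?thesis
  proof (rule l2_dominated_tendsto[where w=w])
    show "(\<lambda>x. (\<zeta> x * \<alpha> n x, \<alpha> n x *\<^sub>R cgrad \<zeta> x + (\<zeta> x * \<beta> n x) *\<^sub>R E x)) \<in> borel_measurable M" for n
      by (intro borel_measurable_Pair) measurable
    have "sq_int M (\<lambda>x. \<bar>C\<bar> *\<^sub>R (norm (\<zeta> x) + norm (cgrad \<zeta> x) + B *\<^sub>R norm (E x)))"
      by (intro sq_int_scaleR sq_int_add sq_int_norm sq_int_test_fun[OF \<zeta>] sq_int_test_fun_cgrad[OF \<zeta>] sq_int_ground)
    then show "sq_int M w" by (simp add: w_def[abs_def])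
    show "AE x in M. norm (\<zeta> x * \<alpha> n x, \<alpha> n x *\<^sub>R cgrad \<zeta> x + (\<zeta> x * \<beta> n x) *\<^sub>R E x) \<le> w x" for n
    proof (rule AE_I2)
      fix x
      show "norm (\<zeta> x * \<alpha> n x, \<alpha> n x *\<^sub>R cgrad \<zeta> x + (\<zeta> x * \<beta> n x) *\<^sub>R E x) \<le> w x"
      proof (cases "x \<in> K")
        case True
        have "norm (\<zeta> x * \<alpha> n x, \<alpha> n x *\<^sub>R cgrad \<zeta> x + (\<zeta> x * \<beta> n x) *\<^sub>R E x)
            \<le> norm (\<zeta> x * \<alpha> n x) + norm (\<alpha> n x *\<^sub>R cgrad \<zeta> x + (\<zeta> x * \<beta> n x) *\<^sub>R E x)"
          by (rule norm_Pair_le)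
        also have "\<dots> \<le> \<bar>\<zeta> x\<bar> * \<bar>\<alpha> n x\<bar> + (\<bar>\<alpha> n x\<bar> * norm (cgrad \<zeta> x) + \<bar>\<zeta> x\<bar> * \<bar>\<beta> n x\<bar> * norm (E x))"
          using norm_triangle_ineq[of "\<alpha> n x *\<^sub>R cgrad \<zeta> x" "(\<zeta> x * \<beta> n x) *\<^sub>R E x"] by (simp add: abs_mult)
        also have "\<dots> \<le> \<bar>\<zeta> x\<bar> * \<bar>C\<bar> + (\<bar>C\<bar> * norm (cgrad \<zeta> x) + B * \<bar>C\<bar> * norm (E x))"
          using b[OF True, of n] B(2)[of x] B(1)
          by (intro add_mono mult_mono mult_nonneg_nonneg order_refl) auto
        also have "\<dots> = w x" by (simp add: w_def algebra_simps)
        finally show ?thesis .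
      next
        case False
        then show ?thesis using K[of x] B(1) by (simp add: w_def)
      qed
    qed
    show "AE x in M. (\<lambda>n. (\<zeta> x * \<alpha> n x, \<alpha> n x *\<^sub>R cgrad \<zeta> x + (\<zeta> x * \<beta> n x) *\<^sub>R E x)) \<longlonglongrightarrow> 0"
      using lim
    proof eventually_elim
      case (elim x)
      have "(\<lambda>n. (\<zeta> x * \<alpha> n x, \<alpha> n x *\<^sub>R cgrad \<zeta> x + (\<zeta> x * \<beta> n x) *\<^sub>R E x)) \<longlonglongrightarrow>
          (\<zeta> x * 0, 0 *\<^sub>R cgrad \<zeta> x + (\<zeta> x * 0) *\<^sub>R E x)"
        by (intro tendsto_intros elim)
      then show ?case by (simp add: zero_prod_def)
    qed
  qed
qed

lemma sq_int_coefficients: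
  assumes \<zeta>: "test_fun \<Omega> \<zeta>" and K: "\<And>x. x \<notin> K \<Longrightarrow> \<zeta> x = 0" "\<And>x. x \<notin> K \<Longrightarrow> cgrad \<zeta> x = 0"
    and [measurable]: "\<alpha> \<in> borel_measurable M" "\<beta> \<in> borel_measurable M"
    and b: "\<And>x. x \<in> K \<Longrightarrow> \<bar>\<alpha> x\<bar> \<le> C" "\<And>x. x \<in> K \<Longrightarrow> \<bar>\<beta> x\<bar> \<le> C"
  shows "sq_int M (\<lambda>x. (\<zeta> x * \<alpha> x, \<alpha> x *\<^sub>R cgrad \<zeta> x + (\<zeta> x * \<beta> x) *\<^sub>R E x))"
proof (intro sq_int_Pair sq_int_add)
  note [measurable] = test_fun_measurable_M[OF \<zeta>]
  obtain B where B: "0 \<le> B" "\<And>x. norm (\<zeta> x) \<le> B" using test_fun_bounded[OF \<zeta>] by blast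
  have "\<bar>\<alpha> x\<bar> * norm v \<le> \<bar>C\<bar> * norm v" if "x \<in> K" for x and v :: 'a
    using b(1)[OF that] by (intro mult_right_mono) auto
  then show "sq_int M (\<lambda>x. \<alpha> x *\<^sub>R cgrad \<zeta> x)"
    using K(2) by (intro sq_int_bound[OF sq_int_test_fun_cgrad[OF \<zeta>], of _ "\<bar>C\<bar>"] AE_I2) (auto, metis mult_zero_right norm_zero order_refl)
  have "\<bar>\<zeta> x\<bar> * \<bar>\<alpha> x\<bar> \<le> \<bar>C\<bar> * \<bar>\<zeta> x\<bar>" for x
    using b(1)[of x] K(1)[of x] mult_right_mono[of "\<bar>\<alpha> x\<bar>" "\<bar>C\<bar>" "\<bar>\<zeta> x\<bar>"]
    by (cases "x \<in> K") (auto simp: mult.commute)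
  then show "sq_int M (\<lambda>x. \<zeta> x * \<alpha> x)"
    by (intro sq_int_bound[OF sq_int_test_fun[OF \<zeta>], of _ "\<bar>C\<bar>"] AE_I2) (auto simp: abs_mult)
  have "\<bar>\<zeta> x\<bar> * \<bar>\<beta> x\<bar> \<le> B * \<bar>C\<bar>" for x
    using b(2)[of x] K(1)[of x] B(1) B(2)[of x] mult_mono[of "\<bar>\<zeta> x\<bar>" B "\<bar>\<beta> x\<bar>" "\<bar>C\<bar>"]
    by (cases "x \<in> K") auto
  then have "\<bar>\<zeta> x\<bar> * \<bar>\<beta> x\<bar> * norm (E x) \<le> B * \<bar>C\<bar> * norm (E x)" for x
    by (intro mult_right_mono) auto
  then show "sq_int M (\<lambda>x. (\<zeta> x * \<beta> x) *\<^sub>R E x)"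
    by (intro sq_int_bound[OF sq_int_ground(2), of _ "B * \<bar>C\<bar>"] AE_I2) (auto simp: abs_mult)
qed

text \<open>The chain rule for a Sobolev function: it holds for test functions approximating \<Phi>,
  and both sides converge because \<open>rec_approx \<delta>\<close> and its derivative are bounded
  and continuous.\<close>

lemma H1_approx_quotient:
  assumes \<zeta>: "test_fun \<Omega> \<zeta>" and \<delta>: "0 < \<delta>" "\<delta> \<le> 1"
  shows "H1 \<Omega> (\<lambda>x. (\<zeta> x * rec_approx \<delta> (\<Phi> x),
    rec_approx \<delta> (\<Phi> x) *\<^sub>R cgrad \<zeta> x + (\<zeta> x * rec_approx' \<delta> (\<Phi> x)) *\<^sub>R E x))"
proof -
  obtain \<psi>0 where \<psi>0: "\<And>n. test_fun \<Omega> (\<psi>0 n)" "(\<lambda>n. l2 M (\<lambda>x. jet (\<psi>0 n) x - (\<Phi> x, E x))) \<longlonglongrightarrow> 0"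
    using H1_approx[OF H1_ground] by blast
  \<comment> \<open>Almost everywhere convergence is needed because the nonlinear coefficients
    depend on the values pointwise.\<close>
  obtain r where r: "strict_mono r" "AE x in M. (\<lambda>n. jet (\<psi>0 (r n)) x) \<longlonglongrightarrow> (\<Phi> x, E x)"
    using l2_tendsto_AE_subseq[OF sq_int_jet[OF \<psi>0(1)] H1_sq_int[OF H1_ground] \<psi>0(2)] by blast
  define \<psi> where "\<psi> n = \<psi>0 (r n)" for n
  have \<psi>: "test_fun \<Omega> (\<psi> n)" for n unfolding \<psi>_def by (rule \<psi>0)
  have \<psi>l: "(\<lambda>n. l2 M (\<lambda>x. jet (\<psi> n) x - (\<Phi> x, E x))) \<longlonglongrightarrow> 0"
    unfolding \<psi>_def using LIMSEQ_subseq_LIMSEQ[OF \<psi>0(2) r(1)] by (simp add: o_def)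
  have \<psi>AE: "AE x in M. (\<lambda>n. \<psi> n x) \<longlonglongrightarrow> \<Phi> x"
    using r(2) by eventually_elim (use tendsto_fst in \<open>fastforce simp: jet_def \<psi>_def\<close>)
  obtain B where B: "0 \<le> B" "\<And>x. norm (\<zeta> x) \<le> B" using test_fun_bounded[OF \<zeta>] by blast
  define X where "X n x = \<zeta> x * rec_approx \<delta> (\<psi> n x)" for n x
  have sq: "smooth_on UNIV (\<lambda>x. rec_approx \<delta> (\<psi> n x))" for n
  proof -
    note s = test_fun_smooth[OF \<psi>[of n]]
    have "\<psi> n x * \<psi> n x + \<delta> \<noteq> 0" for x using rec_approx_den[OF \<delta>(1), of "\<psi> n x"] by simp
    then show ?thesis unfolding rec_approx_def by (intro smooth_mult smooth_inverse smooth_add smooth_const s)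
  qed
  have X: "test_fun \<Omega> (X n)" for n unfolding X_def[abs_def] by (rule test_fun_mult[OF \<zeta> sq])
  have jX: "jet (X n) x = (\<zeta> x * rec_approx \<delta> (\<psi> n x),
      rec_approx \<delta> (\<psi> n x) *\<^sub>R cgrad \<zeta> x + (\<zeta> x * rec_approx' \<delta> (\<psi> n x)) *\<^sub>R cgrad (\<psi> n) x)" for n x
    unfolding jet_def X_def[abs_def] cgrad_mult[OF test_fun_smooth[OF \<zeta>] sq]
      cgrad_compose[OF test_fun_smooth[OF \<psi>] rec_approx_deriv[OF \<delta>(1)]] by (simp add: add.commute)
  define G where "G x = (\<zeta> x * rec_approx \<delta> (\<Phi> x),
    rec_approx \<delta> (\<Phi> x) *\<^sub>R cgrad \<zeta> x + (\<zeta> x * rec_approx' \<delta> (\<Phi> x)) *\<^sub>R E x)" for x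
  have rm [measurable]: "(\<lambda>x. rec_approx \<delta> (u x)) \<in> borel_measurable M" "(\<lambda>x. rec_approx' \<delta> (u x)) \<in> borel_measurable M"
    if "u \<in> borel_measurable M" for u
    using borel_measurable_continuous_on[OF rec_approx_continuous(1)[OF \<delta>(1)] that]
      borel_measurable_continuous_on[OF rec_approx_continuous(2)[OF \<delta>(1)] that] .
  note [measurable] = test_fun_measurable_M[OF \<zeta>] test_fun_measurable_M[OF \<psi>]
  have Gsq: "sq_int M G"
    unfolding G_def by (rule sq_int_coefficients[where K=UNIV and C="1 / \<delta>", OF \<zeta>])
      (use rec_approx_bounded[OF \<delta>] rm ground_measurable in auto)
  \<comment> \<open>The error is split in two: \<open>U\<close> carries the change of the
    coefficients at the fixed gradient \<open>E\<close> and is handled by dominated convergence,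
    \<open>V\<close> carries the change of the gradient with a bounded coefficient and is small in
    the square norm.\<close>
  define U where "U n x = (\<zeta> x * (rec_approx \<delta> (\<psi> n x) - rec_approx \<delta> (\<Phi> x)),
      (rec_approx \<delta> (\<psi> n x) - rec_approx \<delta> (\<Phi> x)) *\<^sub>R cgrad \<zeta> x +
      (\<zeta> x * (rec_approx' \<delta> (\<psi> n x) - rec_approx' \<delta> (\<Phi> x))) *\<^sub>R E x)" for n x
  define V where "V n x = (0::real, (\<zeta> x * rec_approx' \<delta> (\<psi> n x)) *\<^sub>R (cgrad (\<psi> n) x - E x))" for n x
  have split: "jet (X n) x - G x = U n x + V n x" for n x
    unfolding jX G_def U_def V_def by (simp add: algebra_simps)
  have Usq: "sq_int M (U n)" for n
    unfolding U_def by (rule sq_int_coefficients[where K=UNIV and C="2 / \<delta>", OF \<zeta>])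
      (use rec_approx_bounded[OF \<delta>] rm[OF test_fun_measurable_M(1)[OF \<psi>]] rm[OF ground_measurable(1)] in
        \<open>auto intro!: order_trans[OF abs_triangle_ineq4] add_mono[of _ "1/\<delta>" _ "1/\<delta>", simplified]\<close>)
  have Ul: "(\<lambda>n. l2 M (U n)) \<longlonglongrightarrow> 0"
    unfolding U_def
  proof (rule coefficient_tendsto[where K=UNIV and C="2 / \<delta>", OF \<zeta>])
    have "\<bar>a - b\<bar> \<le> 2 / \<delta>" if "\<bar>a\<bar> \<le> 1 / \<delta>" "\<bar>b\<bar> \<le> 1 / \<delta>" for a b
      using that abs_triangle_ineq4[of a b] by (simp add: add_divide_distrib[symmetric])
    then show "\<bar>rec_approx \<delta> (\<psi> n x) - rec_approx \<delta> (\<Phi> x)\<bar> \<le> 2 / \<delta>"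
      "\<bar>rec_approx' \<delta> (\<psi> n x) - rec_approx' \<delta> (\<Phi> x)\<bar> \<le> 2 / \<delta>" for n x
      using rec_approx_bounded[OF \<delta>] by blast+
    show "AE x in M. (\<lambda>n. rec_approx \<delta> (\<psi> n x) - rec_approx \<delta> (\<Phi> x)) \<longlonglongrightarrow> 0"
      using \<psi>AE by eventually_elim
        (intro LIM_zero continuous_on_tendsto_compose[OF rec_approx_continuous(1)[OF \<delta>(1)]], auto)
    show "AE x in M. (\<lambda>n. rec_approx' \<delta> (\<psi> n x) - rec_approx' \<delta> (\<Phi> x)) \<longlonglongrightarrow> 0"
      using \<psi>AE by eventually_elim
        (intro LIM_zero continuous_on_tendsto_compose[OF rec_approx_continuous(2)[OF \<delta>(1)]], auto)
  qed (auto intro!: rm test_fun_measurable_M[OF \<psi>] ground_measurable borel_measurable_diff)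
  have Vb: "norm (V n x) \<le> B / \<delta> * norm (jet (\<psi> n) x - (\<Phi> x, E x))" for n x
  proof -
    have "norm (V n x) = \<bar>\<zeta> x\<bar> * \<bar>rec_approx' \<delta> (\<psi> n x)\<bar> * norm (cgrad (\<psi> n) x - E x)"
      by (simp add: V_def norm_Pair abs_mult)
    also have "\<dots> \<le> B * (1 / \<delta>) * norm (jet (\<psi> n) x - (\<Phi> x, E x))"
      using B(2)[of x] B(1) rec_approx_bounded(2)[OF \<delta>, of "\<psi> n x"]
        norm_snd_le_norm[of "jet (\<psi> n) x - (\<Phi> x, E x)"]
      by (intro mult_mono mult_nonneg_nonneg) (use \<delta>(1) in \<open>auto simp: jet_def\<close>)
    finally show ?thesis by simp
  qed
  have Vm: "V n \<in> borel_measurable M" for n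
    unfolding V_def using rm(2)[OF test_fun_measurable_M(1)[OF \<psi>, of n]] by (intro borel_measurable_Pair) measurable
  have dsq: "sq_int M (\<lambda>x. jet (\<psi> n) x - (\<Phi> x, E x))" for n
    by (intro sq_int_diff sq_int_jet \<psi> H1_sq_int[OF H1_ground])
  have Vsq: "sq_int M (V n)" for n
    by (rule sq_int_bound[OF dsq Vm AE_I2[OF Vb]])
  have Vl: "(\<lambda>n. l2 M (V n)) \<longlonglongrightarrow> 0"
  proof (rule Lim_null_comparison)
    show "\<forall>\<^sub>F n in sequentially. norm (l2 M (V n)) \<le> \<bar>B / \<delta>\<bar> * l2 M (\<lambda>x. jet (\<psi> n) x - (\<Phi> x, E x))"
      using l2_bound[OF dsq Vm AE_I2[OF Vb]] by simp
    show "(\<lambda>n. \<bar>B / \<delta>\<bar> * l2 M (\<lambda>x. jet (\<psi> n) x - (\<Phi> x, E x))) \<longlonglongrightarrow> 0"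
      by (rule tendsto_mult_right_zero[OF \<psi>l])
  qed
  have "(\<lambda>n. l2 M (\<lambda>x. jet (X n) x - G x)) \<longlonglongrightarrow> 0"
  proof (rule Lim_null_comparison)
    show "\<forall>\<^sub>F n in sequentially. norm (l2 M (\<lambda>x. jet (X n) x - G x)) \<le> l2 M (U n) + l2 M (V n)"
      unfolding split using l2_triangle[OF Usq Vsq] by simp
    show "(\<lambda>n. l2 M (U n) + l2 M (V n)) \<longlonglongrightarrow> 0" using tendsto_add[OF Ul Vl] by simp
  qed
  then show ?thesis using H1_closed[OF H1_jet[OF X] Gsq] by (simp add: G_def[abs_def])
qed

lemma recip_measurable:
  "(\<lambda>x. 1 / \<Phi> x) \<in> borel_measurable M" "(\<lambda>x. - (1 / (\<Phi> x)\<^sup>2)) \<in> borel_measurable M"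
  by measurable

text \<open>The second component is the formal gradient of \<zeta> / \<Phi>. On the compact support
  of \<zeta> the ground state has a positive lower bound, which makes the regularized coefficients
  bounded uniformly as \<delta> tends to 0.\<close>

lemma H1_quotient:
  assumes \<zeta>: "test_fun \<Omega> \<zeta>"
  shows "H1 \<Omega> (\<lambda>x. (\<zeta> x * (1 / \<Phi> x), (1 / \<Phi> x) *\<^sub>R cgrad \<zeta> x + (\<zeta> x * (- (1 / (\<Phi> x)\<^sup>2))) *\<^sub>R E x))"
    (is "H1 \<Omega> ?G")
proof (rule test_funE[OF \<zeta>])
  fix K assume K: "compact K" "K \<subseteq> \<Omega>" "\<And>x. x \<notin> K \<Longrightarrow> \<zeta> x = 0" "\<And>x. x \<notin> K \<Longrightarrow> cgrad \<zeta> x = 0"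
  obtain c where c: "0 < c" "\<And>x. x \<in> K \<Longrightarrow> c \<le> \<Phi> x" using ground_lower[OF K(1,2)] by blast
  define C where "C = max (1 / c) (1 / c\<^sup>2)"
  have pos: "0 < \<Phi> x" if "x \<in> K" for x using c(1) c(2)[OF that] by simp
  have C: "1 / \<Phi> x \<le> C" "1 / (\<Phi> x)\<^sup>2 \<le> C" if "x \<in> K" for x
  proof -
    have "1 / \<Phi> x \<le> 1 / c" using c(1) c(2)[OF that] by (intro divide_left_mono) auto
    then show "1 / \<Phi> x \<le> C" by (simp add: C_def)
    have "1 / (\<Phi> x)\<^sup>2 \<le> 1 / c\<^sup>2" using c(1) c(2)[OF that] by (intro divide_left_mono power_mono) auto
    then show "1 / (\<Phi> x)\<^sup>2 \<le> C" by (simp add: C_def)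
  qed
  define d where "d n = inverse (real (Suc n))" for n
  have d: "0 < d n" "d n \<le> 1" for n by (simp_all add: d_def inverse_eq_divide)
  have rm: "(\<lambda>x. rec_approx (d n) (\<Phi> x)) \<in> borel_measurable M" "(\<lambda>x. rec_approx' (d n) (\<Phi> x)) \<in> borel_measurable M" for n
    using borel_measurable_continuous_on[OF rec_approx_continuous(1)[OF d(1)] ground_measurable(1)]
      borel_measurable_continuous_on[OF rec_approx_continuous(2)[OF d(1)] ground_measurable(1)] .
  show ?thesis
  proof (rule H1_closed[OF H1_approx_quotient[OF \<zeta> d]])
    show "sq_int M ?G"
    proof (rule sq_int_coefficients[where K=K and C=C, OF \<zeta> _ _ recip_measurable])
      show "\<And>x. x \<notin> K \<Longrightarrow> \<zeta> x = 0" "\<And>x. x \<notin> K \<Longrightarrow> cgrad \<zeta> x = 0" using K(3,4) by blast+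
      fix x assume x: "x \<in> K"
      show "\<bar>1 / \<Phi> x\<bar> \<le> C" "\<bar>- (1 / (\<Phi> x)\<^sup>2)\<bar> \<le> C" using C[OF x] pos[OF x] by simp_all
    qed
    \<comment> \<open>The difference of the regularized jet and its limit has again the coefficient
      form, with differences of reciprocals as coefficients.\<close>
    have "(\<lambda>n. l2 M (\<lambda>x. (\<zeta> x * (rec_approx (d n) (\<Phi> x) - 1 / \<Phi> x),
        (rec_approx (d n) (\<Phi> x) - 1 / \<Phi> x) *\<^sub>R cgrad \<zeta> x +
        (\<zeta> x * (rec_approx' (d n) (\<Phi> x) - - (1 / (\<Phi> x)\<^sup>2))) *\<^sub>R E x))) \<longlonglongrightarrow> 0"
    proof (rule coefficient_tendsto[where K=K and C="2 * C", OF \<zeta>])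
      show "\<And>x. x \<notin> K \<Longrightarrow> \<zeta> x = 0" "\<And>x. x \<notin> K \<Longrightarrow> cgrad \<zeta> x = 0" using K(3,4) by blast+
      fix n x assume x: "x \<in> K"
      show "\<bar>rec_approx (d n) (\<Phi> x) - 1 / \<Phi> x\<bar> \<le> 2 * C"
        using rec_approx_le_rec(1)[OF d(1)[of n] pos[OF x]] C(1)[OF x] pos[OF x]
          abs_triangle_ineq4[of "rec_approx (d n) (\<Phi> x)" "1 / \<Phi> x"] by simp
      show "\<bar>rec_approx' (d n) (\<Phi> x) - - (1 / (\<Phi> x)\<^sup>2)\<bar> \<le> 2 * C"
        using rec_approx_le_rec(2)[OF d(1)[of n] pos[OF x]] C(2)[OF x]
          abs_triangle_ineq[of "rec_approx' (d n) (\<Phi> x)" "1 / (\<Phi> x)\<^sup>2"] by simp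
    next
      show "AE x in M. (\<lambda>n. rec_approx (d n) (\<Phi> x) - 1 / \<Phi> x) \<longlonglongrightarrow> 0"
        unfolding d_def using LIM_zero[OF rec_approx_tendsto_rec(1)[OF ground_pos]] by (intro AE_I2) simp
      show "AE x in M. (\<lambda>n. rec_approx' (d n) (\<Phi> x) - - (1 / (\<Phi> x)\<^sup>2)) \<longlonglongrightarrow> 0"
        unfolding d_def using LIM_zero[OF rec_approx_tendsto_rec(2)[OF ground_pos]] by (intro AE_I2) simp
    qed (intro borel_measurable_diff rm recip_measurable)+
    then show "(\<lambda>n. l2 M (\<lambda>x. (\<zeta> x * rec_approx (d n) (\<Phi> x),
        rec_approx (d n) (\<Phi> x) *\<^sub>R cgrad \<zeta> x + (\<zeta> x * rec_approx' (d n) (\<Phi> x)) *\<^sub>R E x) - ?G x)) \<longlonglongrightarrow> 0"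
      by (simp add: algebra_simps)
  qed
qed

text \<open>The quadratic form of - \<Delta> - lam.\<close>

definition energy :: "('a \<Rightarrow> real \<times> 'a) \<Rightarrow> real" where
  "energy F = ip M (\<lambda>x. snd (F x)) (\<lambda>x. snd (F x)) - lam * ip M (\<lambda>x. fst (F x)) (\<lambda>x. fst (F x))"

text \<open>On \<open>\<Omega>\<close> this is \<open>\<Phi> *\<^sub>R \<nabla>(u / \<Phi>)\<close> for \<open>F = (u, \<nabla>u)\<close>.\<close>
definition ground_grad :: "('a \<Rightarrow> real \<times> 'a) \<Rightarrow> 'a \<Rightarrow> 'a" where
  "ground_grad F x = snd (F x) - (fst (F x) / \<Phi> x) *\<^sub>R E x"

lemma ground_grad_diff: "ground_grad (\<lambda>x. F x - G x) x = ground_grad F x - ground_grad G x"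
  by (simp add: ground_grad_def diff_divide_distrib algebra_simps)

lemma ground_grad_measurable:
  assumes "sq_int M F" shows "ground_grad F \<in> borel_measurable M"
proof -
  note [measurable] = sq_int_measurable[OF sq_int_fst[OF assms]] sq_int_measurable[OF sq_int_snd[OF assms]]
  show ?thesis unfolding ground_grad_def[abs_def] by measurable
qed

lemma energy_tendsto:
  assumes "\<And>n. sq_int M (F n)" "sq_int M G" "(\<lambda>n. l2 M (\<lambda>x. F n x - G x)) \<longlonglongrightarrow> 0"
  shows "(\<lambda>n. energy (F n)) \<longlonglongrightarrow> energy G"
proof -
  have d: "sq_int M (\<lambda>x. F n x - G x)" for n by (rule sq_int_diff[OF assms(1,2)])
  have "(\<lambda>n. l2 M (\<lambda>x. fst (F n x) - fst (G x))) \<longlonglongrightarrow> 0"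
    by (rule Lim_null_comparison[OF _ assms(3)]) (use l2_fst_le[OF d] in simp)
  then have 1: "(\<lambda>n. l2 M (\<lambda>x. fst (F n x))) \<longlonglongrightarrow> l2 M (\<lambda>x. fst (G x))"
    by (intro l2_tendsto_l2 sq_int_fst assms)
  have "(\<lambda>n. l2 M (\<lambda>x. snd (F n x) - snd (G x))) \<longlonglongrightarrow> 0"
    by (rule Lim_null_comparison[OF _ assms(3)]) (use l2_snd_le[OF d] in simp)
  then have 2: "(\<lambda>n. l2 M (\<lambda>x. snd (F n x))) \<longlonglongrightarrow> l2 M (\<lambda>x. snd (G x))"
    by (intro l2_tendsto_l2 sq_int_snd assms)
  show ?thesis unfolding energy_def l2_power2[symmetric] by (intro tendsto_intros 1 2)
qed

text \<open>Picone's identity: test the eigenvalue equation with \<open>\<phi>\<^sup>2 / \<Phi>\<close>.\<close>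
lemma ground_grad_test_fun:
  assumes \<phi>: "test_fun \<Omega> \<phi>"
  shows "sq_int M (ground_grad (jet \<phi>))" "(l2 M (ground_grad (jet \<phi>)))\<^sup>2 = energy (jet \<phi>)"
proof -
  note sm = test_fun_smooth[OF \<phi>]
  have \<phi>2: "test_fun \<Omega> (\<lambda>x. \<phi> x * \<phi> x)" by (rule test_fun_mult[OF \<phi> sm])
  define P where "P x = (\<phi> x * \<phi> x * (1 / \<Phi> x), (1 / \<Phi> x) *\<^sub>R cgrad (\<lambda>x. \<phi> x * \<phi> x) x +
      (\<phi> x * \<phi> x * (- (1 / (\<Phi> x)\<^sup>2))) *\<^sub>R E x)" for x
  have P: "H1 \<Omega> P" unfolding P_def[abs_def] by (rule H1_quotient[OF \<phi>2])
  note sP = H1_sq_int[OF P]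
  \<comment> \<open>With t = \<phi> / \<Phi> the square expands as |\<nabla>\<phi> - t E|^2 =
    |\<nabla>\<phi>|^2 - E \<bullet> (2 t \<nabla>\<phi> - t^2 E), and the bracket is the gradient
    of \<phi>^2 / \<Phi>.\<close>
  have eq: "(norm (ground_grad (jet \<phi>) x))\<^sup>2 = cgrad \<phi> x \<bullet> cgrad \<phi> x - E x \<bullet> snd (P x)" if "x \<in> space M" for x
  proof -
    define t where "t = \<phi> x / \<Phi> x"
    have "\<phi> x * \<phi> x * (- (1 / (\<Phi> x)\<^sup>2)) = - t\<^sup>2" by (simp add: t_def power2_eq_square)
    moreover have "(1 / \<Phi> x) *\<^sub>R (\<phi> x *\<^sub>R cgrad \<phi> x + \<phi> x *\<^sub>R cgrad \<phi> x) = (2 * t) *\<^sub>R cgrad \<phi> x"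
      by (simp add: t_def scaleR_add_left[symmetric])
    ultimately have P: "snd (P x) = (2 * t) *\<^sub>R cgrad \<phi> x + (- t\<^sup>2) *\<^sub>R E x"
      by (simp add: P_def cgrad_mult[OF sm sm])
    have g: "ground_grad (jet \<phi>) x = cgrad \<phi> x - t *\<^sub>R E x" by (simp add: ground_grad_def jet_def t_def)
    show ?thesis
      unfolding power2_norm_eq_inner g P
      by (simp add: inner_diff_left inner_diff_right inner_add_right inner_commute[of "E x" "cgrad \<phi> x"]
          power2_eq_square algebra_simps)
  qed
  have i: "integrable M (\<lambda>x. cgrad \<phi> x \<bullet> cgrad \<phi> x)" "integrable M (\<lambda>x. E x \<bullet> snd (P x))"
    by (intro sq_int_inner_integrable sq_int_test_fun_cgrad[OF \<phi>] sq_int_ground sq_int_snd[OF sP])+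
  have "integrable M (\<lambda>x. (norm (ground_grad (jet \<phi>) x))\<^sup>2)"
    by (rule iffD2[OF Bochner_Integration.integrable_cong[OF refl eq] Bochner_Integration.integrable_diff[OF i]])
  then show "sq_int M (ground_grad (jet \<phi>))"
    using ground_grad_measurable[OF sq_int_jet[OF \<phi>]] by (simp add: sq_int_def)
  have "(\<integral>x. (norm (ground_grad (jet \<phi>) x))\<^sup>2 \<partial>M) = (\<integral>x. cgrad \<phi> x \<bullet> cgrad \<phi> x - E x \<bullet> snd (P x) \<partial>M)"
    by (rule Bochner_Integration.integral_cong[OF refl eq])
  also have "\<dots> = ip M (cgrad \<phi>) (cgrad \<phi>) - ip M E (\<lambda>x. snd (P x))"
    unfolding ip_def by (rule Bochner_Integration.integral_diff[OF i])
  also have "ip M E (\<lambda>x. snd (P x)) = lam * ip M \<Phi> (\<lambda>x. fst (P x))" by (rule eigen_H1[OF P])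
  also have "ip M \<Phi> (\<lambda>x. fst (P x)) = ip M \<phi> \<phi>"
    unfolding ip_def
  proof (rule Bochner_Integration.integral_cong[OF refl])
    fix x assume "x \<in> space M"
    then have "\<Phi> x \<noteq> 0" using ground_pos[of x] by simp
    then show "\<Phi> x \<bullet> fst (P x) = \<phi> x \<bullet> \<phi> x" by (simp add: P_def)
  qed
  finally have "(\<integral>x. (norm (ground_grad (jet \<phi>) x))\<^sup>2 \<partial>M) = ip M (cgrad \<phi>) (cgrad \<phi>) - lam * ip M \<phi> \<phi>" .
  moreover have "energy (jet \<phi>) = ip M (cgrad \<phi>) (cgrad \<phi>) - lam * ip M \<phi> \<phi>"
    by (simp add: energy_def jet_def)
  ultimately show "(l2 M (ground_grad (jet \<phi>)))\<^sup>2 = energy (jet \<phi>)"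
    by (simp add: l2_power2 ip_def power2_norm_eq_inner)
qed

text \<open>The factor 1 / \<Phi> makes the transformed gradient discontinuous in the Sobolev norm a
  priori, so the identity for test functions is passed to the limit by Fatou along an almost
  everywhere convergent subsequence. This gives one inequality.\<close>

lemma ground_grad_le_energy:
  assumes F: "H1 \<Omega> F"
  shows "sq_int M (ground_grad F)" "(l2 M (ground_grad F))\<^sup>2 \<le> energy F" "0 \<le> energy F"
proof -
  note s = H1_sq_int[OF F]
  obtain \<phi> where \<phi>: "\<And>n. test_fun \<Omega> (\<phi> n)" "(\<lambda>n. l2 M (\<lambda>x. jet (\<phi> n) x - F x)) \<longlonglongrightarrow> 0"
    using H1_approx[OF F] by blast
  note sJ = sq_int_jet[OF \<phi>(1)] and g = ground_grad_test_fun[OF \<phi>(1)]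
  obtain r where r: "strict_mono r" "AE x in M. (\<lambda>n. jet (\<phi> (r n)) x) \<longlonglongrightarrow> F x"
    using l2_tendsto_AE_subseq[OF sJ s \<phi>(2)] by blast
  have lim: "(\<lambda>n. energy (jet (\<phi> n))) \<longlonglongrightarrow> energy F" by (rule energy_tendsto[OF sJ s \<phi>(2)])
  have nn: "0 \<le> energy (jet (\<phi> n))" for n using g(2)[of n] by (metis zero_le_power2)
  show nonneg: "0 \<le> energy F" using lim nn LIMSEQ_le_const by blast
  have "(\<lambda>n. sqrt (energy (jet (\<phi> n)))) \<longlonglongrightarrow> sqrt (energy F)" using lim by (rule tendsto_real_sqrt)
  moreover have "sqrt (energy (jet (\<phi> n))) = l2 M (ground_grad (jet (\<phi> n)))" for n
    using g(2)[of n] by (metis l2_nonneg real_sqrt_abs abs_of_nonneg)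
  ultimately have l2lim: "(\<lambda>n. l2 M (ground_grad (jet (\<phi> n)))) \<longlonglongrightarrow> sqrt (energy F)" by simp
  have l2lim': "(\<lambda>n. l2 M (ground_grad (jet (\<phi> (r n))))) \<longlonglongrightarrow> sqrt (energy F)"
    using LIMSEQ_subseq_LIMSEQ[OF l2lim r(1)] by (simp add: o_def)
  have AE: "AE x in M. (\<lambda>n. ground_grad (jet (\<phi> (r n))) x) \<longlonglongrightarrow> ground_grad F x"
    using r(2)
  proof (eventually_elim)
    case (elim x)
    show ?case unfolding ground_grad_def divide_inverse by (intro tendsto_intros elim)
  qed
  \<comment> \<open>Only convergence of the norms is known, so Fatou is applied with the bound
    \<open>sqrt (energy F) + e\<close>, and \<open>e\<close> is removed afterwards.\<close>
  have fat: "sq_int M (ground_grad F) \<and> l2 M (ground_grad F) \<le> sqrt (energy F) + e" if e: "0 < e" for e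
  proof -
    have "\<forall>\<^sub>F n in sequentially. l2 M (ground_grad (jet (\<phi> (r n)))) < sqrt (energy F) + e"
      by (rule order_tendstoD(2)[OF l2lim']) (use e in simp)
    then obtain N where "\<And>n. n \<ge> N \<Longrightarrow> l2 M (ground_grad (jet (\<phi> (r n)))) \<le> sqrt (energy F) + e"
      unfolding eventually_sequentially by (meson less_imp_le)
    then show ?thesis
      using l2_Fatou[OF g(1) ground_grad_measurable[OF s] AE] by blast
  qed
  show "sq_int M (ground_grad F)" using fat[of 1] by simp
  have "l2 M (ground_grad F) \<le> sqrt (energy F)" by (rule field_le_epsilon) (use fat in blast)
  then have "(l2 M (ground_grad F))\<^sup>2 \<le> (sqrt (energy F))\<^sup>2" by (intro power_mono) auto
  then show "(l2 M (ground_grad F))\<^sup>2 \<le> energy F" using nonneg by simp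
qed

text \<open>For the reverse inequality the one already known is applied to the approximation error
  \<open>D n\<close>: its energy tends to 0, hence so does its transformed gradient, and the
  triangle inequality concludes.\<close>

lemma ground_grad_energy:
  assumes F: "H1 \<Omega> F"
  shows "(l2 M (ground_grad F))\<^sup>2 = energy F"
proof (rule antisym[OF ground_grad_le_energy(2)[OF F]])
  note s = H1_sq_int[OF F]
  obtain \<phi> where \<phi>: "\<And>n. test_fun \<Omega> (\<phi> n)" "(\<lambda>n. l2 M (\<lambda>x. jet (\<phi> n) x - F x)) \<longlonglongrightarrow> 0"
    using H1_approx[OF F] by blast
  note sJ = sq_int_jet[OF \<phi>(1)]
  define D where "D n x = jet (\<phi> n) x - F x" for n x
  have D: "H1 \<Omega> (D n)" for n unfolding D_def by (intro H1_diff H1_jet \<phi> F)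
  have "(\<lambda>n. energy (D n)) \<longlonglongrightarrow> energy (\<lambda>x. 0)"
    by (rule energy_tendsto[OF H1_sq_int[OF D]]) (use \<phi>(2) in \<open>simp_all add: D_def\<close>)
  then have "(\<lambda>n. sqrt (energy (D n))) \<longlonglongrightarrow> sqrt (energy (\<lambda>x. 0))" by (rule tendsto_real_sqrt)
  then have D0: "(\<lambda>n. sqrt (energy (D n))) \<longlonglongrightarrow> 0" by (simp add: energy_def ip_def)
  have le: "sqrt (energy (jet (\<phi> n))) \<le> l2 M (ground_grad F) + sqrt (energy (D n))" for n
  proof -
    have "sqrt (energy (jet (\<phi> n))) = l2 M (ground_grad (jet (\<phi> n)))"
      using ground_grad_test_fun(2)[OF \<phi>(1), of n] by (metis l2_nonneg real_sqrt_abs abs_of_nonneg)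
    also have "\<dots> \<le> l2 M (ground_grad F) + l2 M (ground_grad (D n))"
      using l2_le_diff[OF ground_grad_test_fun(1)[OF \<phi>(1)] ground_grad_le_energy(1)[OF F], of n]
      unfolding D_def[abs_def] ground_grad_diff .
    also have "l2 M (ground_grad (D n)) \<le> sqrt (energy (D n))"
      using ground_grad_le_energy(2)[OF D] by (rule real_le_rsqrt)
    finally show ?thesis by simp
  qed
  have "(\<lambda>n. sqrt (energy (jet (\<phi> n)))) \<longlonglongrightarrow> sqrt (energy F)"
    by (rule tendsto_real_sqrt[OF energy_tendsto[OF sJ s \<phi>(2)]])
  moreover have "(\<lambda>n. l2 M (ground_grad F) + sqrt (energy (D n))) \<longlonglongrightarrow> l2 M (ground_grad F) + 0"
    by (intro tendsto_intros D0)
  ultimately have "sqrt (energy F) \<le> l2 M (ground_grad F) + 0"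
    by (rule LIMSEQ_le) (use le in blast)
  then have "sqrt (energy F) \<le> l2 M (ground_grad F)" by simp
  then show "energy F \<le> (l2 M (ground_grad F))\<^sup>2" by (rule sqrt_le_D)
qed

section \<open>The weak gradient of a quotient by the ground state\<close>

lemma sq_int_quotient_parts:
  assumes "test_fun \<Omega> \<psi>"
  shows "sq_int M (\<lambda>x. \<psi> x / \<Phi> x)" "sq_int M (\<lambda>x. (cgrad \<psi> x \<bullet> b) / \<Phi> x)"
proof (rule_tac [!] test_funE[OF assms])
  fix K assume K: "compact K" "K \<subseteq> \<Omega>" "\<And>x. x \<notin> K \<Longrightarrow> \<psi> x = 0" "\<And>x. x \<notin> K \<Longrightarrow> cgrad \<psi> x = 0"
  note [measurable] = test_fun_measurable_M[OF assms]
  obtain c where c: "0 < c" "\<And>x. x \<in> K \<Longrightarrow> c \<le> \<Phi> x" using ground_lower[OF K(1,2)] by blast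
  have *: "\<bar>t\<bar> / \<bar>\<Phi> x\<bar> \<le> (1 / c) * \<bar>t\<bar>" if "x \<notin> K \<longrightarrow> t = 0" for t x
  proof (cases "x \<in> K")
    case True
    then have "\<bar>t\<bar> / \<bar>\<Phi> x\<bar> \<le> \<bar>t\<bar> / c" using c(1) c(2)[OF True] by (intro divide_left_mono) auto
    then show ?thesis by simp
  qed (use that in simp)
  show "sq_int M (\<lambda>x. \<psi> x / \<Phi> x)"
    by (rule sq_int_bound[OF sq_int_test_fun[OF assms], of _ "1 / c"])
      (measurable, use *[of _ "\<psi> _"] K(3) in \<open>auto intro!: AE_I2\<close>)
  have cb: "\<bar>(cgrad \<psi> x \<bullet> b) / \<Phi> x\<bar> \<le> (norm b / c) * norm (cgrad \<psi> x)" for x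
  proof -
    have "\<bar>(cgrad \<psi> x \<bullet> b) / \<Phi> x\<bar> \<le> (1 / c) * \<bar>cgrad \<psi> x \<bullet> b\<bar>" using *[of x "cgrad \<psi> x \<bullet> b"] K(4)[of x] by simp
    also have "\<dots> \<le> (1 / c) * (norm (cgrad \<psi> x) * norm b)"
      using c(1) by (intro mult_left_mono Cauchy_Schwarz_ineq2) simp
    finally show ?thesis by (simp add: mult.commute)
  qed
  show "sq_int M (\<lambda>x. (cgrad \<psi> x \<bullet> b) / \<Phi> x)"
    by (rule sq_int_bound[OF sq_int_test_fun_cgrad[OF assms], of _ "norm b / c"])
      (measurable, use cb in \<open>auto intro!: AE_I2\<close>)
qed

text \<open>Integration by parts between \<open>F\<close> and \<psi> / \<Phi> places the division on
  the compactly supported factor, where \<open>H1_quotient\<close> applies; no Sobolev regularity of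
  the quotient on the left is presupposed.\<close>

lemma ground_quotient_weak_gradient:
  assumes F: "H1 \<Omega> F" and \<psi>: "test_fun \<Omega> \<psi>"
  shows "(\<integral>x. fst (F x) / \<Phi> x * (cgrad \<psi> x \<bullet> b) \<partial>M) = - (\<integral>x. ((1 / \<Phi> x) *\<^sub>R ground_grad F x \<bullet> b) * \<psi> x \<partial>M)"
proof -
  note s = H1_sq_int[OF F]
  define P where "P x = (\<psi> x * (1 / \<Phi> x), (1 / \<Phi> x) *\<^sub>R cgrad \<psi> x + (\<psi> x * (- (1 / (\<Phi> x)\<^sup>2))) *\<^sub>R E x)" for x
  have P: "H1 \<Omega> P" unfolding P_def[abs_def] by (rule H1_quotient[OF \<psi>])
  have i1: "integrable M (\<lambda>x. fst (F x) / \<Phi> x * (cgrad \<psi> x \<bullet> b))"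
    using sq_int_mult_integrable[OF sq_int_fst[OF s] sq_int_quotient_parts(2)[OF \<psi>, of b]] by simp
  have "sq_int M (\<lambda>x. ground_grad F x \<bullet> b)"
  proof (rule sq_int_bound[OF ground_grad_le_energy(1)[OF F], of _ "norm b"])
    show "(\<lambda>x. ground_grad F x \<bullet> b) \<in> borel_measurable M"
      using ground_grad_measurable[OF s] by measurable
    show "AE x in M. norm (ground_grad F x \<bullet> b) \<le> norm b * norm (ground_grad F x)"
      by (intro AE_I2) (simp add: Cauchy_Schwarz_ineq2 mult.commute[of "norm b"])
  qed
  then have i2: "integrable M (\<lambda>x. ((1 / \<Phi> x) *\<^sub>R ground_grad F x \<bullet> b) * \<psi> x)"
    using sq_int_mult_integrable[OF _ sq_int_quotient_parts(1)[OF \<psi>]] by simp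
  have "0 = (\<integral>x. F x \<bullet> cross b (P x) \<partial>M)" using ip_cross_H1[OF F P] by (simp add: ip_def)
  also have "\<dots> = (\<integral>x. fst (F x) / \<Phi> x * (cgrad \<psi> x \<bullet> b) + ((1 / \<Phi> x) *\<^sub>R ground_grad F x \<bullet> b) * \<psi> x \<partial>M)"
  proof (rule Bochner_Integration.integral_cong[OF refl])
    fix x assume "x \<in> space M"
    then have "\<Phi> x \<noteq> 0" using ground_pos[of x] by simp
    then show "F x \<bullet> cross b (P x) = fst (F x) / \<Phi> x * (cgrad \<psi> x \<bullet> b) + ((1 / \<Phi> x) *\<^sub>R ground_grad F x \<bullet> b) * \<psi> x"
      unfolding inner_cross P_def ground_grad_def
      by (simp add: inner_diff_left inner_add_left field_simps power2_eq_square)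
  qed
  also have "\<dots> = (\<integral>x. fst (F x) / \<Phi> x * (cgrad \<psi> x \<bullet> b) \<partial>M) + (\<integral>x. ((1 / \<Phi> x) *\<^sub>R ground_grad F x \<bullet> b) * \<psi> x \<partial>M)"
    by (rule Bochner_Integration.integral_add[OF i1 i2])
  finally show ?thesis by simp
qed

lemma quotient_locally_integrable:
  fixes u :: "'a \<Rightarrow> 'b::euclidean_space"
  assumes u: "sq_int M u" and K: "compact K" "K \<subseteq> \<Omega>"
  shows "set_integrable lebesgue K (\<lambda>x. (1 / \<Phi> x) *\<^sub>R u x)"
proof -
  obtain c where c: "0 < c" "\<And>x. x \<in> K \<Longrightarrow> c \<le> \<Phi> x" using ground_lower[OF K] by blast
  note [measurable] = sq_int_measurable[OF u]
  have Km: "K \<in> sets lebesgue" using K(1) by (auto intro: lmeasurable_compact fmeasurableD)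
  have KM: "K \<in> sets M" using Km K(2) by (simp add: sets_restrict_space_iff)
  have bd: "norm (indicator K x *\<^sub>R (1 / \<Phi> x) *\<^sub>R u x) \<le> (1 / c) * norm (u x)" for x
  proof (cases "x \<in> K")
    case True
    have "1 / \<Phi> x \<le> 1 / c" using c(1) c(2)[OF True] by (intro divide_left_mono) auto
    then have "1 / \<Phi> x * norm (u x) \<le> 1 / c * norm (u x)" by (intro mult_right_mono) auto
    then show ?thesis using True c(1) c(2)[OF True] by simp
  qed (use c(1) in simp)
  have "(\<lambda>x. indicator K x *\<^sub>R (1 / \<Phi> x) *\<^sub>R u x) \<in> borel_measurable M" using KM by measurable
  then have "sq_int M (\<lambda>x. indicator K x *\<^sub>R (1 / \<Phi> x) *\<^sub>R u x)"
    by (rule sq_int_bound[OF u _ AE_I2[OF bd]])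
  then have "set_integrable lebesgue K (\<lambda>x. indicator K x *\<^sub>R (1 / \<Phi> x) *\<^sub>R u x)"
    by (rule sq_int_locally_integrable[OF _ K])
  moreover have "(\<lambda>x. indicator K x *\<^sub>R indicator K x *\<^sub>R (1 / \<Phi> x) *\<^sub>R u x) = (\<lambda>x. indicator K x *\<^sub>R (1 / \<Phi> x) *\<^sub>R u x)"
    by (auto simp: indicator_def)
  ultimately show ?thesis unfolding set_integrable_def by simp
qed

lemma zero_energy_proportional:
  assumes "connected \<Omega>" and F: "H1 \<Omega> F" and e: "energy F = 0"
  shows "\<exists>k. AE x in M. fst (F x) = k * \<Phi> x"
proof -
  have "AE x in M. ground_grad F x = 0"
    using l2_eq_0[OF ground_grad_le_energy(1)[OF F]] ground_grad_energy[OF F] e by simp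
  then have 0: "(\<integral>x. ((1 / \<Phi> x) *\<^sub>R ground_grad F x \<bullet> b) * \<psi> x \<partial>M) = 0" for b \<psi>
    by (intro integral_eq_zero_AE) (auto elim: eventually_mono)
  have "\<exists>k. AE x in M. (1 / \<Phi> x) *\<^sub>R fst (F x) = k"
  proof (rule zero_weak_gradient_constant[OF assms(1)])
    show "set_integrable lebesgue K (\<lambda>x. (1 / \<Phi> x) *\<^sub>R fst (F x))" if "compact K" "K \<subseteq> \<Omega>" for K
      by (rule quotient_locally_integrable[OF sq_int_fst[OF H1_sq_int[OF F]] that])
    show "(\<integral>x. (1 / \<Phi> x) *\<^sub>R fst (F x) * (cgrad \<psi> x \<bullet> z) \<partial>M) = 0" if "test_fun \<Omega> \<psi>" for \<psi> z
      using ground_quotient_weak_gradient[OF F that, of z] 0[of z \<psi>] by simp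
  qed
  then obtain k where k: "AE x in M. (1 / \<Phi> x) *\<^sub>R fst (F x) = k" by blast
  have "AE x in M. fst (F x) = k * \<Phi> x"
    using k AE_space by eventually_elim (use ground_pos in \<open>force simp: field_simps\<close>)
  then show ?thesis by blast
qed

text \<open>Both fields satisfy the same integration by parts formula, so
  \<open>du_Bois_Reymond\<close> applies to each coordinate of their difference. All integrability
  is local, on the support of the test function.\<close>

lemma weak_grad_quotient_unique:
  assumes F: "H1 \<Omega> F" and G: "weak_grad \<Omega> (\<lambda>x. fst (F x) / \<Phi> x) G"
  shows "AE x in M. G x = (1 / \<Phi> x) *\<^sub>R ground_grad F x"
proof -
  note sT = ground_grad_le_energy(1)[OF F]
  have Gi: "set_integrable lebesgue K G" if "compact K" "K \<subseteq> \<Omega>" for K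
    using G that unfolding weak_grad_def by blast
  have inner_i: "set_integrable lebesgue K (\<lambda>x. H x \<bullet> b)" if "set_integrable lebesgue K H" for H :: "'a \<Rightarrow> 'a" and b K
    using integrable_inner_left[of b lebesgue "\<lambda>x. indicator K x *\<^sub>R H x"] that by (simp add: set_integrable_def)
  have "AE x in M. (G x - (1 / \<Phi> x) *\<^sub>R ground_grad F x) \<bullet> b = 0" if b: "b \<in> Basis" for b
  proof (rule du_Bois_Reymond)
    show loc: "set_integrable lebesgue K (\<lambda>x. (G x - (1 / \<Phi> x) *\<^sub>R ground_grad F x) \<bullet> b)"
      if "compact K" "K \<subseteq> \<Omega>" for K
      by (intro inner_i set_integral_diff Gi quotient_locally_integrable[OF sT] that)
    fix \<psi> assume \<psi>: "test_fun \<Omega> \<psi>"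
    have ti: "integrable M (\<lambda>x. (H x \<bullet> b) * \<psi> x)"
      if H: "\<And>K. compact K \<Longrightarrow> K \<subseteq> \<Omega> \<Longrightarrow> set_integrable lebesgue K H" for H :: "'a \<Rightarrow> 'a"
    proof (rule test_funE[OF \<psi>])
      fix K assume K: "compact K" "K \<subseteq> \<Omega>" "\<And>x. x \<notin> K \<Longrightarrow> \<psi> x = 0"
      obtain B where B: "\<And>x. norm (\<psi> x) \<le> B" using test_fun_bounded[OF \<psi>] by blast
      have Km: "K \<in> sets lebesgue" using K(1) by (auto intro: lmeasurable_compact fmeasurableD)
      have "set_integrable lebesgue \<Omega> (\<lambda>x. indicator K x *\<^sub>R (H x \<bullet> b))"
      proof -
        have "(\<lambda>x. indicator \<Omega> x *\<^sub>R indicator K x *\<^sub>R (H x \<bullet> b)) = (\<lambda>x. indicator K x *\<^sub>R (H x \<bullet> b))"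
          using K(2) by (intro ext) (auto simp: indicator_def)
        then show ?thesis using inner_i[OF H[OF K(1,2)]] unfolding set_integrable_def by metis
      qed
      then have iK: "integrable M (\<lambda>x. indicator K x *\<^sub>R (H x \<bullet> b))" by (simp add: integrable_M_set)
      have Hm: "(\<lambda>x. H x \<bullet> b) \<in> borel_measurable M"
        by (rule locally_integrable_measurable[OF inner_i[OF H]])
      show ?thesis
      proof (rule Bochner_Integration.integrable_bound[where f="\<lambda>x. B * norm (indicator K x *\<^sub>R (H x \<bullet> b))"])
        show "integrable M (\<lambda>x. B * norm (indicator K x *\<^sub>R (H x \<bullet> b)))" using integrable_norm[OF iK] by simp
        show "(\<lambda>x. (H x \<bullet> b) * \<psi> x) \<in> borel_measurable M"
          by (rule borel_measurable_times[OF Hm test_fun_measurable_M(1)[OF \<psi>]])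
        show "AE x in M. norm ((H x \<bullet> b) * \<psi> x) \<le> norm (B * norm (indicator K x *\<^sub>R (H x \<bullet> b)))"
        proof (rule AE_I2)
          fix x
          have "\<bar>H x \<bullet> b\<bar> * \<bar>\<psi> x\<bar> \<le> \<bar>H x \<bullet> b\<bar> * \<bar>B\<bar>" using B[of x] by (intro mult_left_mono) auto
          then show "norm ((H x \<bullet> b) * \<psi> x) \<le> norm (B * norm (indicator K x *\<^sub>R (H x \<bullet> b)))"
            using K(3)[of x] by (cases "x \<in> K") (auto simp: abs_mult mult.commute)
        qed
      qed
    qed
    have "(\<integral>x. ((G x - (1 / \<Phi> x) *\<^sub>R ground_grad F x) \<bullet> b) * \<psi> x \<partial>M) =
        (\<integral>x. (G x \<bullet> b) * \<psi> x - ((1 / \<Phi> x) *\<^sub>R ground_grad F x \<bullet> b) * \<psi> x \<partial>M)"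
      by (simp add: inner_diff_left left_diff_distrib)
    also have "\<dots> = (\<integral>x. (G x \<bullet> b) * \<psi> x \<partial>M) - (\<integral>x. ((1 / \<Phi> x) *\<^sub>R ground_grad F x \<bullet> b) * \<psi> x \<partial>M)"
      by (rule Bochner_Integration.integral_diff[OF ti[OF Gi] ti[OF quotient_locally_integrable[OF sT]]])
    also have "(\<integral>x. (G x \<bullet> b) * \<psi> x \<partial>M) = - (\<integral>x. fst (F x) / \<Phi> x * pdiff b \<psi> x \<partial>M)"
      using G \<psi> b unfolding weak_grad_def integral_M_set by simp
    also have "\<dots> = (\<integral>x. ((1 / \<Phi> x) *\<^sub>R ground_grad F x \<bullet> b) * \<psi> x \<partial>M)"
      using ground_quotient_weak_gradient[OF F \<psi>, of b] by (simp add: cgrad_inner_Basis[OF b])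
    finally show "(\<integral>x. ((G x - (1 / \<Phi> x) *\<^sub>R ground_grad F x) \<bullet> b) * \<psi> x \<partial>M) = 0" by simp
  qed
  then have "AE x in M. \<forall>b\<in>Basis. (G x - (1 / \<Phi> x) *\<^sub>R ground_grad F x) \<bullet> b = 0"
    by (intro AE_finite_allI finite_Basis) auto
  then show ?thesis
    by eventually_elim (metis eq_iff_diff_eq_0 euclidean_all_zero_iff)
qed

end


section \<open>The spectral gap\<close>

context ground_state
begin

definition admissible :: "('a \<Rightarrow> real \<times> 'a) \<Rightarrow> bool" where
  "admissible F \<longleftrightarrow> H1 \<Omega> F \<and> ip M \<Phi> (\<lambda>x. fst (F x)) = 0"

lemma admissible_add_scaled:
  assumes "admissible F" "admissible G" shows "admissible (\<lambda>x. F x + t *\<^sub>R G x)"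
proof -
  have FG: "H1 \<Omega> F" "H1 \<Omega> G" using assms by (simp_all add: admissible_def)
  note s = FG[THEN H1_sq_int, THEN sq_int_fst]
  have "ip M \<Phi> (\<lambda>x. fst (F x) + t *\<^sub>R fst (G x)) = 0"
    unfolding ip_add_right[OF s(1) sq_int_scaleR[OF s(2)] sq_int_ground(1)] ip_scaleR_right
    using assms by (simp add: admissible_def)
  then show ?thesis unfolding admissible_def using FG by (auto intro!: H1_add H1_scaleR)
qed

text \<open>Rellich makes the values of a minimizing sequence Cauchy; near minimality then makes the
  gradients Cauchy too. The limit is strong, so constraint, normalization and infimum pass to it
  directly.\<close>

lemma Rayleigh_infimum_attained:
  assumes F: "\<And>n. admissible (F n)" and one: "\<And>n. l2 M (\<lambda>x. fst (F n x)) = 1"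
    and low: "\<And>H. admissible H \<Longrightarrow> \<nu> * (l2 M (\<lambda>x. fst (H x)))\<^sup>2 \<le> (l2 M (\<lambda>x. snd (H x)))\<^sup>2"
    and up: "\<And>n. (l2 M (\<lambda>x. snd (F n x)))\<^sup>2 \<le> \<nu> + inverse (real (Suc n))" and \<nu>: "0 \<le> \<nu>"
  obtains G where "admissible G" "l2 M (\<lambda>x. fst (G x)) = 1" "(l2 M (\<lambda>x. snd (G x)))\<^sup>2 = \<nu>"
proof -
  note H = F[unfolded admissible_def, THEN conjunct1]
  note s = H1_sq_int[OF H]
  have bd: "l2 M (F n) \<le> sqrt (\<nu> + 2)" for n
  proof (rule real_le_rsqrt)
    have "inverse (real (Suc n)) \<le> 1" by (simp add: inverse_eq_divide)
    then show "(l2 M (F n))\<^sup>2 \<le> \<nu> + 2" using up[of n] by (simp add: l2_pair_power2[OF s] one)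
  qed
  obtain k :: "nat \<Rightarrow> nat" where k: "strict_mono k"
      "\<And>e. 0 < e \<Longrightarrow> \<exists>N. \<forall>m\<ge>N. \<forall>n\<ge>N. l2 M (\<lambda>x. fst (F (k m) x) - fst (F (k n) x)) < e"
    using Rellich[of F, OF H bd] by auto
  text \<open>The parallelogram identity turns convergence of the values into convergence of gradients.\<close>
  have par: "(l2 M (\<lambda>x. F m x - F n x))\<^sup>2 \<le> 2 * inverse (real (Suc m)) + 2 * inverse (real (Suc n)) +
      (\<nu> + 1) * (l2 M (\<lambda>x. fst (F m x) - fst (F n x)))\<^sup>2" for m n
  proof -
    define d where "d = (l2 M (\<lambda>x. fst (F m x) - fst (F n x)))\<^sup>2"
    note sm = sq_int_fst[OF s[of m]] sq_int_snd[OF s[of m]] and sn = sq_int_fst[OF s[of n]] sq_int_snd[OF s[of n]]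
    have pl: "(l2 M (\<lambda>x. u x - v x))\<^sup>2 = 2 * (l2 M u)\<^sup>2 + 2 * (l2 M v)\<^sup>2 - (l2 M (\<lambda>x. u x + v x))\<^sup>2"
      if "sq_int M u" "sq_int M v" for u v :: "'a \<Rightarrow> 'c::euclidean_space"
      using ip_add_scaled[OF that, of 1] ip_add_scaled[OF that, of "-1"] by (simp add: l2_power2)
    \<comment> \<open>Both functions have norm 1, so the parallelogram identity gives 2 + 2 - d. In
      the gradient estimate below, the term \<open>4 * \<nu>\<close> cancels against the two nearly
      minimal gradients.\<close>
    have f: "(l2 M (\<lambda>x. fst (F m x) + fst (F n x)))\<^sup>2 = 4 - d"
      using pl[OF sm(1) sn(1)] one by (simp add: d_def)
    have "\<nu> * (4 - d) \<le> (l2 M (\<lambda>x. snd (F m x) + snd (F n x)))\<^sup>2"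
      using low[OF admissible_add_scaled[OF F F, of m 1 n]] f by simp
    then have "(l2 M (\<lambda>x. snd (F m x) - snd (F n x)))\<^sup>2 \<le>
        2 * inverse (real (Suc m)) + 2 * inverse (real (Suc n)) + \<nu> * d"
      using pl[OF sm(2) sn(2)] up[of m] up[of n] by (simp add: algebra_simps)
    then show ?thesis
      using l2_pair_power2[OF sq_int_diff[OF s[of m] s[of n]]] by (simp add: d_def[symmetric] algebra_simps)
  qed
  have cau: "\<exists>N. \<forall>m\<ge>N. \<forall>n\<ge>N. l2 M (\<lambda>x. F (k m) x - F (k n) x) < e" if e: "0 < e" for e
  proof -
    \<comment> \<open>The minimum with 1 turns d < \<eta> into d^2 \<le> \<eta>. The two reciprocals
      contribute less than e^2 / 4 each, and this term at most e^2 / 4, so the total stays below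
      e^2.\<close>
    define \<eta> where "\<eta> = min 1 (e\<^sup>2 / (4 * (\<nu> + 1)))"
    have \<eta>: "0 < \<eta>" "\<eta> \<le> 1" "(\<nu> + 1) * \<eta> \<le> e\<^sup>2 / 4"
    proof -
      show "0 < \<eta>" "\<eta> \<le> 1" using e \<nu> by (simp_all add: \<eta>_def)
      have "(\<nu> + 1) * \<eta> \<le> (\<nu> + 1) * (e\<^sup>2 / (4 * (\<nu> + 1)))" using \<nu> by (intro mult_left_mono) (simp_all add: \<eta>_def)
      also have "\<dots> = e\<^sup>2 / 4" using \<nu> by (simp add: divide_simps)
      finally show "(\<nu> + 1) * \<eta> \<le> e\<^sup>2 / 4" .
    qed
    obtain j where j: "inverse (real (Suc j)) < e\<^sup>2 / 8" using reals_Archimedean[of "e\<^sup>2 / 8"] e by auto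
    obtain N where N: "\<And>m n. m \<ge> N \<Longrightarrow> n \<ge> N \<Longrightarrow> l2 M (\<lambda>x. fst (F (k m) x) - fst (F (k n) x)) < \<eta>"
      using k(2)[OF \<eta>(1)] by blast
    have "l2 M (\<lambda>x. F (k m) x - F (k n) x) < e" if mn: "m \<ge> max N j" "n \<ge> max N j" for m n
    proof (rule power2_less_imp_less)
      have kj: "k i \<ge> j" if "i \<ge> max N j" for i using seq_suble[OF k(1), of i] that by simp
      have i: "inverse (real (Suc (k i))) < e\<^sup>2 / 8" if "i \<ge> max N j" for i
      proof -
        have "inverse (real (Suc (k i))) \<le> inverse (real (Suc j))"
          using kj[OF that] by (intro le_imp_inverse_le) auto
        then show ?thesis using j by linarith
      qed
      define d where "d = l2 M (\<lambda>x. fst (F (k m) x) - fst (F (k n) x))"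
      have d: "0 \<le> d" "d < \<eta>" using N[of m n] mn by (simp_all add: d_def)
      have "d\<^sup>2 \<le> \<eta> * 1" unfolding power2_eq_square using d \<eta> by (intro mult_mono) auto
      then have "(\<nu> + 1) * d\<^sup>2 \<le> (\<nu> + 1) * \<eta>" using \<nu> by (intro mult_left_mono) auto
      then show "(l2 M (\<lambda>x. F (k m) x - F (k n) x))\<^sup>2 < e\<^sup>2"
        using par[of "k m" "k n"] i[OF mn(1)] i[OF mn(2)] \<eta>(3) zero_less_power[OF e, of 2] unfolding d_def by linarith
    qed (use e in simp)
    then show ?thesis by blast
  qed
  obtain G where G: "sq_int M G" "(\<lambda>n. l2 M (\<lambda>x. F (k n) x - G x)) \<longlonglongrightarrow> 0"
    using l2_complete[of "\<lambda>n. F (k n)", OF s cau] by blast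
  have HG: "H1 \<Omega> G" by (rule H1_closed[OF H G])
  have dsq: "sq_int M (\<lambda>x. F (k n) x - G x)" for n by (rule sq_int_diff[OF s G(1)])
  have fl: "(\<lambda>n. l2 M (\<lambda>x. fst (F (k n) x) - fst (G x))) \<longlonglongrightarrow> 0"
    by (rule Lim_null_comparison[OF _ G(2)]) (use l2_fst_le[OF dsq] in simp)
  have sl: "(\<lambda>n. l2 M (\<lambda>x. snd (F (k n) x) - snd (G x))) \<longlonglongrightarrow> 0"
    by (rule Lim_null_comparison[OF _ G(2)]) (use l2_snd_le[OF dsq] in simp)
  have "(\<lambda>n. ip M (\<lambda>x. fst (F (k n) x)) \<Phi>) \<longlonglongrightarrow> ip M (\<lambda>x. fst (G x)) \<Phi>"
    by (rule l2_tendsto_ip[OF sq_int_fst[OF s] sq_int_fst[OF G(1)] sq_int_ground(1) fl])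
  then have "ip M \<Phi> (\<lambda>x. fst (G x)) = 0"
    using F by (simp add: admissible_def ip_commute[of M \<Phi>] LIMSEQ_const_iff)
  then have adm: "admissible G" using HG by (simp add: admissible_def)
  have "(\<lambda>n. l2 M (\<lambda>x. fst (F (k n) x))) \<longlonglongrightarrow> l2 M (\<lambda>x. fst (G x))"
    by (rule l2_tendsto_l2[OF sq_int_fst[OF s] sq_int_fst[OF G(1)] fl])
  then have 1: "l2 M (\<lambda>x. fst (G x)) = 1" by (simp add: one LIMSEQ_const_iff)
  have "(\<lambda>n. (l2 M (\<lambda>x. snd (F (k n) x)))\<^sup>2) \<longlonglongrightarrow> (l2 M (\<lambda>x. snd (G x)))\<^sup>2"
    by (intro tendsto_power l2_tendsto_l2[OF sq_int_snd[OF s] sq_int_snd[OF G(1)] sl])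
  moreover have "(\<lambda>n. \<nu> + inverse (real (Suc n))) \<longlonglongrightarrow> \<nu> + 0"
    by (intro tendsto_intros LIMSEQ_inverse_real_of_nat)
  moreover have "(l2 M (\<lambda>x. snd (F (k n) x)))\<^sup>2 \<le> \<nu> + inverse (real (Suc n))" for n
  proof -
    have "inverse (real (Suc (k n))) \<le> inverse (real (Suc n))"
      using seq_suble[OF k(1), of n] by (intro le_imp_inverse_le) auto
    then show ?thesis using up[of "k n"] by linarith
  qed
  ultimately have "(l2 M (\<lambda>x. snd (G x)))\<^sup>2 \<le> \<nu> + 0"
    by (intro LIMSEQ_le[of "\<lambda>n. (l2 M (\<lambda>x. snd (F (k n) x)))\<^sup>2"]) auto
  then have "(l2 M (\<lambda>x. snd (G x)))\<^sup>2 = \<nu>" using low[OF adm] 1 by simp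
  then show ?thesis by (rule that[OF adm 1])
qed

text \<open>Minimality along the line \<open>G + t H\<close> gives a nonnegative quadratic in
  \<open>t\<close> without constant term, so its linear coefficient vanishes. For an arbitrary test
  function the component along the ground state contributes nothing: the eigenvalue equation turns
  orthogonality of the values of \<open>G\<close> to \<Phi> into orthogonality of its gradient to
  \<open>E\<close>.\<close>

lemma minimizer_is_eigenfunction:
  assumes norm: "ip M \<Phi> \<Phi> = 1"
    and low: "\<And>H. admissible H \<Longrightarrow> \<nu> * (l2 M (\<lambda>x. fst (H x)))\<^sup>2 \<le> (l2 M (\<lambda>x. snd (H x)))\<^sup>2"
    and G: "admissible G" "l2 M (\<lambda>x. fst (G x)) = 1" "(l2 M (\<lambda>x. snd (G x)))\<^sup>2 = \<nu>"
  shows "dirichlet_eigenvalue \<Omega> \<nu>"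
proof (rule dirichlet_eigenvalueI)
  show HG: "H1 \<Omega> G" and "l2 M (\<lambda>x. fst (G x)) \<noteq> 0" using G by (simp_all add: admissible_def)
  note sG = sq_int_fst[OF H1_sq_int[OF HG]] sq_int_snd[OF H1_sq_int[OF HG]]
  have orth: "ip M \<Phi> (\<lambda>x. fst (G x)) = 0" using G(1) by (simp add: admissible_def)
  fix \<phi> assume \<phi>: "test_fun \<Omega> \<phi>"
  note s\<phi> = sq_int_test_fun[OF \<phi>] sq_int_test_fun_cgrad[OF \<phi>]
  define c where "c = ip M \<Phi> \<phi>"
  \<comment> \<open>Orthogonal projection makes the test function admissible; the normalization of
    \<Phi> makes \<open>c\<close> the right coefficient.\<close>
  define H where "H x = jet \<phi> x + (- c) *\<^sub>R (\<Phi> x, E x)" for x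
  have fH: "fst (H x) = \<phi> x + (- c) *\<^sub>R \<Phi> x" and sH: "snd (H x) = cgrad \<phi> x + (- c) *\<^sub>R E x" for x
    by (simp_all add: H_def jet_def)
  have "H1 \<Omega> H" unfolding H_def by (intro H1_add H1_scaleR H1_jet \<phi> H1_ground)
  then have H: "admissible H"
    unfolding admissible_def fH
    using norm ip_add_right[OF s\<phi>(1) sq_int_scaleR[OF sq_int_ground(1), of "- c"] sq_int_ground(1)]
      ip_scaleR_right[of M \<Phi> "- c" \<Phi>] by (simp add: c_def)
  note sqH = sq_int_fst[OF H1_sq_int[OF \<open>H1 \<Omega> H\<close>]] sq_int_snd[OF H1_sq_int[OF \<open>H1 \<Omega> H\<close>]]
  define \<beta> where "\<beta> = ip M (\<lambda>x. snd (G x)) (\<lambda>x. snd (H x)) - \<nu> * ip M (\<lambda>x. fst (G x)) (\<lambda>x. fst (H x))"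
  define \<gamma> where "\<gamma> = ip M (\<lambda>x. snd (H x)) (\<lambda>x. snd (H x)) - \<nu> * ip M (\<lambda>x. fst (H x)) (\<lambda>x. fst (H x))"
  have "\<beta>\<^sup>2 \<le> 0 * \<gamma>"
  proof (rule quadratic_nonneg_discriminant)
    show "0 \<le> \<gamma>" using low[OF H] by (simp add: \<gamma>_def l2_power2)
    fix t :: real
    have "\<nu> * ip M (\<lambda>x. fst (G x) + t *\<^sub>R fst (H x)) (\<lambda>x. fst (G x) + t *\<^sub>R fst (H x)) \<le>
        ip M (\<lambda>x. snd (G x) + t *\<^sub>R snd (H x)) (\<lambda>x. snd (G x) + t *\<^sub>R snd (H x))"
      using low[OF admissible_add_scaled[OF G(1) H, of t]] by (simp add: l2_power2)
    then show "0 \<le> 0 + 2 * t * \<beta> + t\<^sup>2 * \<gamma>"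
      unfolding ip_add_scaled[OF sG(1) sqH(1)] ip_add_scaled[OF sG(2) sqH(2)]
      using G(2,3) l2_power2[of M "\<lambda>x. fst (G x)"] l2_power2[of M "\<lambda>x. snd (G x)"]
      by (simp add: \<beta>_def \<gamma>_def algebra_simps)
  qed
  then have "\<beta> = 0" by simp
  moreover have "ip M (\<lambda>x. snd (G x)) (\<lambda>x. snd (H x)) = ip M (\<lambda>x. snd (G x)) (cgrad \<phi>)"
    unfolding sH using eigen_H1[OF HG] orth
    by (simp add: ip_add_right[OF s\<phi>(2) sq_int_scaleR[OF sq_int_ground(2)] sG(2)] ip_scaleR_right
        ip_commute[of M _ E] del: scaleR_minus_left)
  moreover have "ip M (\<lambda>x. fst (G x)) (\<lambda>x. fst (H x)) = ip M (\<lambda>x. fst (G x)) \<phi>"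
    unfolding fH using orth
    by (simp add: ip_add_right[OF s\<phi>(1) sq_int_scaleR[OF sq_int_ground(1)] sG(1)] ip_scaleR_right
        ip_commute[of M _ \<Phi>] del: scaleR_minus_left real_scaleR_def)
  ultimately show "ip M (\<lambda>x. snd (G x)) (cgrad \<phi>) = \<nu> * ip M (\<lambda>x. fst (G x)) \<phi>"
    by (simp add: \<beta>_def)
qed

text \<open>If the values of \<open>F\<close> have norm 0 the claim is trivial; otherwise the
  normalized \<open>F\<close> shows that there are competitors and the infimum \<nu> makes sense.
  What remains is to compare \<nu> with \<open>lam2\<close>.\<close>

lemma gap_orthogonal:
  assumes conn: "connected \<Omega>" and norm: "ip M \<Phi> \<Phi> = 1"
    and second: "\<And>\<mu>. dirichlet_eigenvalue \<Omega> \<mu> \<Longrightarrow> \<mu> \<noteq> lam \<Longrightarrow> lam2 \<le> \<mu>"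
    and F: "admissible F"
  shows "lam2 * (l2 M (\<lambda>x. fst (F x)))\<^sup>2 \<le> (l2 M (\<lambda>x. snd (F x)))\<^sup>2"
proof -
  define W where "W = {F. admissible F \<and> l2 M (\<lambda>x. fst (F x)) = 1}"
  define Q where "Q F = (l2 M (\<lambda>x. snd (F x)))\<^sup>2" for F :: "'a \<Rightarrow> real \<times> 'a"
  define \<nu> where "\<nu> = Inf (Q ` W)"
  have bdd: "bdd_below (Q ` W)" by (rule bdd_belowI[of _ 0]) (auto simp: Q_def)
  have normalize: "(\<lambda>x. inverse (l2 M (\<lambda>x. fst (H x))) *\<^sub>R H x) \<in> W \<and>
      Q (\<lambda>x. inverse (l2 M (\<lambda>x. fst (H x))) *\<^sub>R H x) = Q H / (l2 M (\<lambda>x. fst (H x)))\<^sup>2"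
    if H: "admissible H" and nz: "l2 M (\<lambda>x. fst (H x)) \<noteq> 0" for H
  proof -
    let ?c = "inverse (l2 M (\<lambda>x. fst (H x)))"
    have "admissible (\<lambda>x. ?c *\<^sub>R H x)"
      using H ip_scaleR_right[of M \<Phi> ?c "\<lambda>x. fst (H x)"] by (auto simp: admissible_def intro: H1_scaleR)
    moreover have "l2 M (\<lambda>x. fst (?c *\<^sub>R H x)) = 1"
      using nz l2_scaleR[of M ?c "\<lambda>x. fst (H x)"] by simp
    moreover have "l2 M (\<lambda>x. snd (?c *\<^sub>R H x)) = ?c * l2 M (\<lambda>x. snd (H x))"
      using l2_scaleR[of M ?c "\<lambda>x. snd (H x)"] by simp
    ultimately show ?thesis by (simp add: W_def Q_def power_mult_distrib field_simps)
  qed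
  have low: "\<nu> * (l2 M (\<lambda>x. fst (H x)))\<^sup>2 \<le> Q H" if H: "admissible H" for H
  proof (cases "l2 M (\<lambda>x. fst (H x)) = 0")
    case False
    have "\<nu> \<le> Q H / (l2 M (\<lambda>x. fst (H x)))\<^sup>2"
      using normalize[OF H False] cInf_lower[OF _ bdd] unfolding \<nu>_def by (metis imageI)
    then show ?thesis using False by (simp add: field_simps)
  qed (simp add: Q_def)
  show ?thesis
  proof (cases "l2 M (\<lambda>x. fst (F x)) = 0")
    case False
    then have ne: "Q ` W \<noteq> {}" using normalize[OF F] by blast
    have \<nu>0: "0 \<le> \<nu>" unfolding \<nu>_def by (rule cInf_greatest[OF ne]) (auto simp: Q_def)
    have "\<exists>F\<in>W. Q F < \<nu> + inverse (real (Suc n))" for n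
      using cInf_lessD[OF ne, of "\<nu> + inverse (real (Suc n))"] by (auto simp: \<nu>_def)
    then obtain S where S: "\<And>n. S n \<in> W" "\<And>n. Q (S n) < \<nu> + inverse (real (Suc n))" by metis
    obtain G where G: "admissible G" "l2 M (\<lambda>x. fst (G x)) = 1" "(l2 M (\<lambda>x. snd (G x)))\<^sup>2 = \<nu>"
    proof (rule Rayleigh_infimum_attained[of S \<nu>])
      show "admissible (S n)" "l2 M (\<lambda>x. fst (S n x)) = 1" for n using S(1)[of n] by (simp_all add: W_def)
      show "(l2 M (\<lambda>x. snd (S n x)))\<^sup>2 \<le> \<nu> + inverse (real (Suc n))" for n
        using S(2)[of n] by (simp add: Q_def)
    qed (use low \<nu>0 in \<open>auto simp: Q_def\<close>)
    have eig: "dirichlet_eigenvalue \<Omega> \<nu>"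
      by (rule minimizer_is_eigenfunction[OF norm _ G]) (use low in \<open>auto simp: Q_def\<close>)
    have HG: "H1 \<Omega> G" and orth: "ip M \<Phi> (\<lambda>x. fst (G x)) = 0" using G(1) by (simp_all add: admissible_def)
    have "\<nu> \<noteq> lam"
    proof
      \<comment> \<open>The minimizer would have energy 0, hence be a multiple of \<Phi>; being
        orthogonal to \<Phi>, it would be orthogonal to itself.\<close>
      assume "\<nu> = lam"
      then have "energy G = 0" using G(2,3) by (simp add: energy_def l2_power2[symmetric])
      then obtain k where k: "AE x in M. fst (G x) = k * \<Phi> x" using zero_energy_proportional[OF conn HG] by blast
      note sG = sq_int_fst[OF H1_sq_int[OF HG]]
      have "ip M (\<lambda>x. fst (G x)) (\<lambda>x. fst (G x)) = ip M (\<lambda>x. fst (G x)) (\<lambda>x. k *\<^sub>R \<Phi> x)"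
        unfolding ip_def
      proof (rule integral_cong_AE)
        show "AE x in M. fst (G x) \<bullet> fst (G x) = fst (G x) \<bullet> (k *\<^sub>R \<Phi> x)" using k by eventually_elim simp
      qed (use sq_int_measurable[OF sG] ground_measurable(1) in measurable)
      also have "\<dots> = 0" using orth by (simp only: ip_scaleR_right ip_commute[of M _ \<Phi>])
      finally show False using G(2) by (simp add: l2_power2[symmetric])
    qed
    then have "lam2 \<le> \<nu>" using second[OF eig] by blast
    then have "lam2 * (l2 M (\<lambda>x. fst (F x)))\<^sup>2 \<le> \<nu> * (l2 M (\<lambda>x. fst (F x)))\<^sup>2"
      by (intro mult_right_mono) auto
    then show ?thesis using low[OF F] by (simp add: Q_def)
  qed simp
qed

text \<open>Subtracting the component along \<Phi> makes \<open>F\<close> admissible without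
  changing its energy, since the ground state lies in the kernel of the form.\<close>

lemma spectral_gap:
  assumes conn: "connected \<Omega>" and norm: "ip M \<Phi> \<Phi> = 1"
    and second: "\<And>\<mu>. dirichlet_eigenvalue \<Omega> \<mu> \<Longrightarrow> \<mu> \<noteq> lam \<Longrightarrow> lam2 \<le> \<mu>"
    and F: "H1 \<Omega> F"
  shows "(lam2 - lam) * (l2 M (\<lambda>x. fst (F x) - ip M \<Phi> (\<lambda>x. fst (F x)) * \<Phi> x))\<^sup>2 \<le> energy F"
proof -
  define s where "s = ip M \<Phi> (\<lambda>x. fst (F x))"
  define H where "H x = F x + (- s) *\<^sub>R (\<Phi> x, E x)" for x
  note sF = sq_int_fst[OF H1_sq_int[OF F]] sq_int_snd[OF H1_sq_int[OF F]]
  have fH: "fst (H x) = fst (F x) + (- s) *\<^sub>R \<Phi> x" and sH: "snd (H x) = snd (F x) + (- s) *\<^sub>R E x" for x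
    by (simp_all add: H_def)
  have "H1 \<Omega> H" unfolding H_def by (intro H1_add H1_scaleR F H1_ground)
  then have H: "admissible H"
    unfolding admissible_def fH
    using norm ip_add_right[OF sF(1) sq_int_scaleR[OF sq_int_ground(1), of "- s"] sq_int_ground(1)]
      ip_scaleR_right[of M \<Phi> "- s" \<Phi>] by (simp add: s_def)
  have EE: "ip M E E = lam" using eigen_H1[OF H1_ground] norm by simp
  have EF: "ip M (\<lambda>x. snd (F x)) E = lam * s" using eigen_H1[OF F] by (simp add: s_def ip_commute[of M _ E])
  have fs: "ip M (\<lambda>x. fst (F x)) \<Phi> = s" by (simp add: s_def ip_commute[of M _ \<Phi>])
  \<comment> \<open>The terms linear and quadratic in \<open>s\<close> both cancel, as
    \<open>E\<close> pairs to \<open>lam * s\<close> with the gradient of \<open>F\<close> and to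
    \<open>lam\<close> with itself.\<close>
  have "energy H = energy F"
    unfolding energy_def fH sH ip_add_scaled[OF sF(1) sq_int_ground(1)] ip_add_scaled[OF sF(2) sq_int_ground(2)]
      EE EF fs norm by (simp add: algebra_simps power2_eq_square)
  moreover have "lam2 * (l2 M (\<lambda>x. fst (H x)))\<^sup>2 \<le> (l2 M (\<lambda>x. snd (H x)))\<^sup>2"
    by (rule gap_orthogonal[OF conn norm second H])
  then have "(lam2 - lam) * (l2 M (\<lambda>x. fst (H x)))\<^sup>2 \<le> energy H"
    by (simp add: energy_def l2_power2 algebra_simps)
  moreover have "(\<lambda>x. fst (H x)) = (\<lambda>x. fst (F x) - s * \<Phi> x)" by (simp add: fH)
  ultimately show ?thesis by (simp add: s_def)
qed

text \<open>The first claim gives substance to the second: the Bochner integral on the right would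
  be 0 if its integrand were not integrable.\<close>

lemma weighted_Poincare:
  assumes conn: "connected \<Omega>" and norm: "ip M \<Phi> \<Phi> = 1"
    and second: "\<And>\<mu>. dirichlet_eigenvalue \<Omega> \<mu> \<Longrightarrow> \<mu> \<noteq> lam \<Longrightarrow> lam2 \<le> \<mu>"
    and F: "H1 \<Omega> F" and G: "weak_grad \<Omega> (\<lambda>x. fst (F x) / \<Phi> x) G"
  shows "sq_int M (\<lambda>x. \<Phi> x *\<^sub>R G x)"
    "(lam2 - lam) * (\<integral>x. (fst (F x) / \<Phi> x - ip M \<Phi> (\<lambda>x. fst (F x)))\<^sup>2 * (\<Phi> x)\<^sup>2 \<partial>M) \<le>
      (\<integral>x. (norm (\<Phi> x *\<^sub>R G x))\<^sup>2 \<partial>M)"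
proof -
  have AE: "AE x in M. ground_grad F x = \<Phi> x *\<^sub>R G x"
    using weak_grad_quotient_unique[OF F G] AE_space
    by eventually_elim (use ground_pos in force)
  have Gm: "G \<in> borel_measurable M"
    using G unfolding weak_grad_def by (intro locally_integrable_measurable) blast
  then have m: "(\<lambda>x. \<Phi> x *\<^sub>R G x) \<in> borel_measurable M" by measurable
  show "sq_int M (\<lambda>x. \<Phi> x *\<^sub>R G x)"
  proof (rule sq_int_bound[OF ground_grad_le_energy(1)[OF F] m])
    show "AE x in M. norm (\<Phi> x *\<^sub>R G x) \<le> 1 * norm (ground_grad F x)" using AE by eventually_elim simp
  qed
  have "(\<integral>x. (norm (\<Phi> x *\<^sub>R G x))\<^sup>2 \<partial>M) = (\<integral>x. (norm (ground_grad F x))\<^sup>2 \<partial>M)"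
  proof (rule integral_cong_AE)
    show "AE x in M. (norm (\<Phi> x *\<^sub>R G x))\<^sup>2 = (norm (ground_grad F x))\<^sup>2" using AE by eventually_elim simp
  qed (use m ground_grad_measurable[OF H1_sq_int[OF F]] in measurable)
  also have "\<dots> = energy F" using ground_grad_energy[OF F] by (simp add: l2_def)
  finally have 1: "(\<integral>x. (norm (\<Phi> x *\<^sub>R G x))\<^sup>2 \<partial>M) = energy F" .
  have "(\<integral>x. (fst (F x) / \<Phi> x - ip M \<Phi> (\<lambda>x. fst (F x)))\<^sup>2 * (\<Phi> x)\<^sup>2 \<partial>M) =
      (l2 M (\<lambda>x. fst (F x) - ip M \<Phi> (\<lambda>x. fst (F x)) * \<Phi> x))\<^sup>2"
    unfolding l2_power2 ip_def
  proof (rule Bochner_Integration.integral_cong[OF refl])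
    fix x assume "x \<in> space M"
    then have "\<Phi> x \<noteq> 0" using ground_pos[of x] by simp
    then have "(fst (F x) / \<Phi> x - c) * \<Phi> x = fst (F x) - c * \<Phi> x" for c by (simp add: left_diff_distrib)
    then show "(fst (F x) / \<Phi> x - (\<integral>x. \<Phi> x \<bullet> fst (F x) \<partial>M))\<^sup>2 * (\<Phi> x)\<^sup>2 =
        (fst (F x) - (\<integral>x. \<Phi> x \<bullet> fst (F x) \<partial>M) * \<Phi> x) \<bullet> (fst (F x) - (\<integral>x. \<Phi> x \<bullet> fst (F x) \<partial>M) * \<Phi> x)"
      unfolding power_mult_distrib[symmetric] by (simp only: inner_real_def power2_eq_square)
  qed
  then show "(lam2 - lam) * (\<integral>x. (fst (F x) / \<Phi> x - ip M \<Phi> (\<lambda>x. fst (F x)))\<^sup>2 * (\<Phi> x)\<^sup>2 \<partial>M) \<le>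
      (\<integral>x. (norm (\<Phi> x *\<^sub>R G x))\<^sup>2 \<partial>M)"
    using spectral_gap[OF conn norm second F] 1 by simp
qed

end


section \<open>The weighted Poincare inequality\<close>

text \<open>As a function of the constant \<open>t\<close> the integral is the quadratic Q - 2 t a +
  t^2 W, whose vertex is \<open>a / W\<close>.\<close>

lemma weighted_mean_minimizes:
  fixes g w :: "'b \<Rightarrow> real"
  assumes "integrable M w" "integrable M (\<lambda>x. g x * w x)" "integrable M (\<lambda>x. (g x)\<^sup>2 * w x)"
    and W: "0 < (\<integral>x. w x \<partial>M)"
  shows "(\<integral>x. (g x - (\<integral>y. g y * w y \<partial>M) / (\<integral>y. w y \<partial>M))\<^sup>2 * w x \<partial>M) \<le> (\<integral>x. (g x - c)\<^sup>2 * w x \<partial>M)"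
proof -
  define W where "W = (\<integral>y. w y \<partial>M)"
  define a where "a = (\<integral>y. g y * w y \<partial>M)"
  define Q where "Q = (\<integral>y. (g y)\<^sup>2 * w y \<partial>M)"
  have eq: "(\<integral>x. (g x - t)\<^sup>2 * w x \<partial>M) = Q - 2 * t * a + t\<^sup>2 * W" for t
  proof -
    have "(\<integral>x. (g x - t)\<^sup>2 * w x \<partial>M) = (\<integral>x. (g x)\<^sup>2 * w x - (2 * t) * (g x * w x) + t\<^sup>2 * w x \<partial>M)"
      by (rule Bochner_Integration.integral_cong) (auto simp: power2_eq_square algebra_simps)
    then show ?thesis using assms(1-3) by (simp add: Q_def a_def W_def)
  qed
  have "Q - 2 * (a / W) * a + (a / W)\<^sup>2 * W \<le> Q - 2 * c * a + c\<^sup>2 * W"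
  proof -
    have "0 \<le> (c - a / W)\<^sup>2 * W" using W by (simp add: W_def)
    also have "(c - a / W)\<^sup>2 * W = (Q - 2 * c * a + c\<^sup>2 * W) - (Q - 2 * (a / W) * a + (a / W)\<^sup>2 * W)"
      using W by (simp add: W_def[symmetric] power2_eq_square field_simps)
    finally show ?thesis by simp
  qed
  then show ?thesis unfolding eq W_def[symmetric] a_def[symmetric] .
qed

text \<open>Nonnegative extended integrals keep the inequality meaningful without integrability
  hypotheses. The proof shows that both integrals are finite and then compares real
  integrals.\<close>

theorem mainTheorem13:
  fixes \<Omega> :: "'a::euclidean_space set"
    and S \<Phi>1 f :: "'a \<Rightarrow> real"
    and G :: "'a \<Rightarrow> 'a"
    and m c \<mu> k0 k1 lam1 lam2 :: real
  assumes dim: "DIM('a) \<ge> 3"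
    and dom: "bounded_domain \<Omega>" and bdry: "smooth_boundary \<Omega>"
    and m_low: "(real DIM('a) - 2) / (real DIM('a) + 2) < m" and m_up: "m < 1"
    and c_pos: "c > 0"
    \<comment> \<open>S = S_{c,m}: positive classical solution of -Delta S^m = c S, S = 0 on the boundary\<close>
    and S_pos: "\<forall>x\<in>\<Omega>. S x > 0"
    and S_cont: "continuous_on (closure \<Omega>) S"
    and S_bdry: "\<forall>x\<in>frontier \<Omega>. S x = 0"
    and S_C2: "C2_on \<Omega> (\<lambda>x. S x powr m)"
    and S_eq: "\<forall>x\<in>\<Omega>. - laplacian (\<lambda>y. S y powr m) x = c * S x"
    \<comment> \<open>first two Dirichlet eigenvalues and the normalized positive first eigenfunction\<close>
    and eig1: "dirichlet_eigenvalue \<Omega> lam1"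
    and eig2: "dirichlet_eigenvalue \<Omega> lam2"
    and lam_order: "0 < lam1" "lam1 < lam2"
    and lam1_least: "\<forall>lam. dirichlet_eigenvalue \<Omega> lam \<longrightarrow> lam1 \<le> lam"
    and lam2_second: "\<forall>lam. dirichlet_eigenvalue \<Omega> lam \<and> lam \<noteq> lam1 \<longrightarrow> lam2 \<le> lam"
    and Phi1_eig: "dirichlet_eigenfun \<Omega> lam1 \<Phi>1"
    and Phi1_pos: "\<forall>x\<in>\<Omega>. \<Phi>1 x > 0"
    and Phi1_norm: "(LINT x:\<Omega>|lebesgue. (\<Phi>1 x)\<^sup>2) = 1"
    \<comment> \<open>S_m = mu S normalized in L^{1+m}, and k0 Phi1 <= S_m^m <= k1 Phi1\<close>
    and mu_pos: "\<mu> > 0"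
    and Sm_norm: "(LINT x:\<Omega>|lebesgue. (\<mu> * S x) powr (1 + m)) = 1"
    and k_pos: "0 < k0" "k0 \<le> k1"
    and k_bounds: "\<forall>x\<in>\<Omega>. k0 * \<Phi>1 x \<le> (\<mu> * S x) powr m \<and> (\<mu> * S x) powr m \<le> k1 * \<Phi>1 x"
    \<comment> \<open>f in W^{1,2}_0, g = f / Phi1 with weak gradient G\<close>
    and f_H10: "H10 \<Omega> f"
    and G_grad: "weak_grad \<Omega> (\<lambda>x. f x / \<Phi>1 x) G"
  shows "ennreal ((lam2 - lam1) * k0\<^sup>2 / (k1\<^sup>2 * (Sup (S ` \<Omega>)) powr (1 - m))) *
           (\<integral>\<^sup>+ x. ennreal (indicator \<Omega> x *
              (f x / \<Phi>1 x - (LINT y:\<Omega>|lebesgue. f y / \<Phi>1 y * S y powr (1 + m)) /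
                             (LINT y:\<Omega>|lebesgue. S y powr (1 + m)))\<^sup>2 * S x powr (1 + m)) \<partial>lebesgue)
         \<le> (\<integral>\<^sup>+ x. ennreal (indicator \<Omega> x * (norm (G x))\<^sup>2 * S x powr (2 * m)) \<partial>lebesgue)"
proof -
  have m0: "0 < m"
  proof -
    have "0 < (real DIM('a) - 2) / (real DIM('a) + 2)" using dim by (intro divide_pos_pos) auto
    then show ?thesis using m_low by simp
  qed
  have \<Omega>: "open \<Omega>" "connected \<Omega>" "bounded \<Omega>" "\<Omega> \<noteq> {}" using dom by (auto simp: bounded_domain_def)
  interpret bounded_open \<Omega> by standard (rule \<Omega>)+
  have Sx: "0 < S x" if "x \<in> \<Omega>" for x using S_pos that by blast
  have \<Phi>x: "0 < \<Phi>1 x" if "x \<in> \<Omega>" for x using Phi1_pos that by blast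
  have k1: "0 < k1" using k_pos by simp
  have S\<Omega>: "continuous_on \<Omega> S" using S_cont closure_subset by (rule continuous_on_subset)
  have Sm: "S \<in> borel_measurable M"
    using S\<Omega> by (rule continuous_imp_measurable_on_sets_lebesgue) simp
  have Spow: "(\<lambda>x. S x powr p) \<in> borel_measurable M" for p using Sm by measurable
  obtain E where E: "H10_grad \<Omega> \<Phi>1 E"
      "\<And>\<phi>. test_fun \<Omega> \<phi> \<Longrightarrow> (LINT x:\<Omega>|lebesgue. E x \<bullet> cgrad \<phi> x) = lam1 * (LINT x:\<Omega>|lebesgue. \<Phi>1 x * \<phi> x)"
    using Phi1_eig unfolding dirichlet_eigenfun_def by blast
  interpret ground_state \<Omega> \<Phi>1 E lam1
  proof
    show "H1 \<Omega> (\<lambda>x. (\<Phi>1 x, E x))" by (rule H10_grad_imp_H1[OF E(1)])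
    show "ip M E (cgrad \<phi>) = lam1 * ip M \<Phi>1 \<phi>" if "test_fun \<Omega> \<phi>" for \<phi>
      using E(2)[OF that] by (simp add: ip_def integral_M_set)
    show "0 < \<Phi>1 x" if "x \<in> \<Omega>" for x by (rule \<Phi>x[OF that])
    fix K :: "'a set" assume K: "compact K" "K \<subseteq> \<Omega>"
    show "\<exists>c>0. \<forall>x\<in>K. c \<le> \<Phi>1 x"
    proof (cases "K = {}")
      case False
      obtain y where y: "y \<in> K" "\<And>x. x \<in> K \<Longrightarrow> S y \<le> S x"
        using continuous_attains_inf[OF K(1) False continuous_on_subset[OF S\<Omega> K(2)]] by blast
      have Sy: "0 < S y" using Sx K(2) y(1) by blast
      show ?thesis
      \<comment> \<open>The bound is taken at a minimum point \<open>y\<close> of \<open>S\<close>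
        on \<open>K\<close>, where (\<mu> S)^m is still positive; dividing by \<open>k1\<close>
        transfers it to \<Phi>1.\<close>
      proof (intro exI[of _ "(\<mu> * S y) powr m / k1"] conjI ballI)
        show "0 < (\<mu> * S y) powr m / k1" using Sy mu_pos k1 by simp
        fix x assume x: "x \<in> K"
        have "(\<mu> * S y) powr m \<le> (\<mu> * S x) powr m"
          using y(2)[OF x] Sy mu_pos m0 by (intro powr_mono2 mult_left_mono) auto
        also have "\<dots> \<le> k1 * \<Phi>1 x" using k_bounds x K(2) by blast
        finally show "(\<mu> * S y) powr m / k1 \<le> \<Phi>1 x" using k1 by (simp add: field_simps)
      qed
    qed (auto intro: exI[of _ 1])
  qed
  obtain Gf where "H10_grad \<Omega> f Gf" using f_H10 unfolding H10_def by blast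
  then have F: "H1 \<Omega> (\<lambda>x. (f x, Gf x))" by (rule H10_grad_imp_H1)
  have fsq: "sq_int M f" using sq_int_fst[OF H1_sq_int[OF F]] by simp
  have norm1: "ip M \<Phi>1 \<Phi>1 = 1"
    using Phi1_norm by (simp add: ip_def integral_M_set power2_eq_square)
  have second: "lam2 \<le> \<nu>" if "dirichlet_eigenvalue \<Omega> \<nu>" "\<nu> \<noteq> lam1" for \<nu>
    using lam2_second that by blast
  define g where "g x = f x / \<Phi>1 x" for x
  define a where "a = ip M \<Phi>1 f"
  have Gm: "G \<in> borel_measurable M"
    using G_grad unfolding weak_grad_def by (intro locally_integrable_measurable) blast
  have WP: "sq_int M (\<lambda>x. \<Phi>1 x *\<^sub>R G x)"
    "(lam2 - lam1) * (\<integral>x. (g x - a)\<^sup>2 * (\<Phi>1 x)\<^sup>2 \<partial>M) \<le> (\<integral>x. (norm (\<Phi>1 x *\<^sub>R G x))\<^sup>2 \<partial>M)"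
    using weighted_Poincare[OF \<Omega>(2) norm1 second F] G_grad by (simp_all add: g_def a_def)
  have fm: "f \<in> borel_measurable M" by (rule sq_int_measurable[OF fsq])
  have gm: "g \<in> borel_measurable M" unfolding g_def using fm ground_measurable(1) by measurable
  have "compact (closure \<Omega>)" using \<Omega>(3) by (simp add: compact_closure)
  then have "bounded (S ` closure \<Omega>)" using S_cont by (intro compact_imp_bounded compact_continuous_image)
  then have bdd: "bdd_above (S ` \<Omega>)"
    by (meson bdd_above_mono bounded_imp_bdd_above closure_subset image_mono)
  define B where "B = Sup (S ` \<Omega>)"
  have SB: "S x \<le> B" if "x \<in> \<Omega>" for x unfolding B_def using that bdd by (intro cSup_upper) auto
  have B: "0 < B" using \<Omega>(4) Sx SB by (meson all_not_in_conv less_le_trans)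
  \<comment> \<open>The factor between S^(2m) and the square of (\<mu> S)^m. It enters the bounds
    for both sides as 1 / q and cancels in the end.\<close>
  define q where "q = \<mu> powr (2 * m)"
  have q: "0 < q" using mu_pos by (simp add: q_def)
  have S2m: "q * S x powr (2 * m) = ((\<mu> * S x) powr m)\<^sup>2" if "x \<in> \<Omega>" for x
  proof -
    have "q * S x powr (2 * m) = (\<mu> * S x) powr (2 * m)" using Sx[OF that] mu_pos by (simp add: q_def powr_mult)
    then show ?thesis by (simp add: power2_eq_square flip: powr_add)
  qed
  have low: "k0\<^sup>2 * (\<Phi>1 x)\<^sup>2 \<le> q * S x powr (2 * m)" if "x \<in> \<Omega>" for x
    unfolding S2m[OF that] power_mult_distrib[symmetric]
    using k_bounds that k_pos(1) \<Phi>x[OF that] by (intro power_mono) auto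
  have high: "q * S x powr (2 * m) \<le> k1\<^sup>2 * (\<Phi>1 x)\<^sup>2" if "x \<in> \<Omega>" for x
    unfolding S2m[OF that] power_mult_distrib[symmetric]
    using k_bounds that by (intro power_mono) auto
  have split: "S x powr (1 + m) \<le> B powr (1 - m) * S x powr (2 * m)" if "x \<in> \<Omega>" for x
  proof -
    have "S x powr (1 + m) = S x powr (1 - m) * S x powr (2 * m)"
      using Sx[OF that] by (simp add: powr_add[symmetric] add.commute)
    also have "\<dots> \<le> B powr (1 - m) * S x powr (2 * m)"
      using Sx[OF that] SB[OF that] m_up by (intro mult_right_mono powr_mono2) auto
    finally show ?thesis .
  qed
  define w where "w x = S x powr (1 + m)" for x
  \<comment> \<open>Combines S^(1+m) \<le> B^(1-m) S^(2m) with q S^(2m) \<le> k1^2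
    \<Phi>1^2.\<close>
  define D where "D = B powr (1 - m) * k1\<^sup>2 / q"
  have D: "0 < D" using B k1 q by (simp add: D_def)
  have w0: "0 \<le> w x" for x by (simp add: w_def)
  have wD: "w x \<le> D * (\<Phi>1 x)\<^sup>2" if "x \<in> \<Omega>" for x
  proof -
    have "S x powr (2 * m) \<le> k1\<^sup>2 * (\<Phi>1 x)\<^sup>2 / q" using high[OF that] q by (simp add: field_simps)
    then have "B powr (1 - m) * S x powr (2 * m) \<le> B powr (1 - m) * (k1\<^sup>2 * (\<Phi>1 x)\<^sup>2 / q)"
      by (intro mult_left_mono) auto
    then show ?thesis using split[OF that] by (simp add: w_def D_def)
  qed
  have wm: "w \<in> borel_measurable M" unfolding w_def by (rule Spow)
  have \<Phi>2: "integrable M (\<lambda>x. (\<Phi>1 x)\<^sup>2)" using sq_int_integrable[OF sq_int_ground(1)] by simp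
  have f2: "integrable M (\<lambda>x. (f x)\<^sup>2)" using sq_int_integrable[OF fsq] by simp
  have iw: "integrable M w"
    by (rule Bochner_Integration.integrable_bound[of M "\<lambda>x. D * (\<Phi>1 x)\<^sup>2"])
      (use \<Phi>2 wm wD w0 D in \<open>auto intro!: AE_I2\<close>)
  have ig2: "integrable M (\<lambda>x. (g x)\<^sup>2 * w x)"
  proof (rule Bochner_Integration.integrable_bound[of M "\<lambda>x. D * (f x)\<^sup>2"])
    show "AE x in M. norm ((g x)\<^sup>2 * w x) \<le> norm (D * (f x)\<^sup>2)"
    proof (rule AE_I2)
      fix x assume "x \<in> space M"
      then have x: "x \<in> \<Omega>" by simp
      have "(g x)\<^sup>2 * w x \<le> (g x)\<^sup>2 * (D * (\<Phi>1 x)\<^sup>2)" by (intro mult_left_mono wD[OF x]) simp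
      also have "\<dots> = D * (f x)\<^sup>2" using \<Phi>x[OF x] by (simp add: g_def power_divide)
      finally show "norm ((g x)\<^sup>2 * w x) \<le> norm (D * (f x)\<^sup>2)" using w0[of x] D by simp
    qed
  qed (use f2 gm wm in \<open>auto intro!: borel_measurable_times borel_measurable_power\<close>)
  have ig: "integrable M (\<lambda>x. g x * w x)"
  proof (rule Bochner_Integration.integrable_bound[of M "\<lambda>x. w x + (g x)\<^sup>2 * w x"])
    show "AE x in M. norm (g x * w x) \<le> norm (w x + (g x)\<^sup>2 * w x)"
    proof (rule AE_I2)
      fix x
      \<comment> \<open>The bound |g| \<le> 1 + g^2 reduces integrability of g w to that of w and of
        g^2 w.\<close>
      have "0 \<le> (\<bar>g x\<bar> - 1)\<^sup>2" by simp
      then have "\<bar>g x\<bar> \<le> 1 + (g x)\<^sup>2" by (simp add: power2_diff)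
      then have "\<bar>g x\<bar> * w x \<le> (1 + (g x)\<^sup>2) * w x" by (intro mult_right_mono w0)
      then show "norm (g x * w x) \<le> norm (w x + (g x)\<^sup>2 * w x)" using w0[of x] by (simp add: abs_mult algebra_simps)
    qed
  qed (use iw ig2 gm wm in \<open>auto intro!: borel_measurable_times\<close>)
  \<comment> \<open>The normalization of \<mu> S says that this integral times \<mu>^(1+m) equals 1,
    so it is positive.\<close>
  have W: "0 < (\<integral>x. w x \<partial>M)"
  proof -
    have "(\<integral>x. (\<mu> * S x) powr (1 + m) \<partial>M) = (\<integral>x. \<mu> powr (1 + m) * w x \<partial>M)"
      by (rule Bochner_Integration.integral_cong[OF refl])
        (use Sx mu_pos in \<open>auto simp: w_def powr_mult less_imp_le\<close>)
    then have "\<mu> powr (1 + m) * (\<integral>x. w x \<partial>M) = 1" using Sm_norm by (simp add: integral_M_set[symmetric])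
    then show ?thesis using mu_pos by (metis powr_gt_zero less_irrefl zero_less_mult_pos zero_less_one)
  qed
  define b where "b = (\<integral>y. g y * w y \<partial>M) / (\<integral>y. w y \<partial>M)"
  have ibd: "integrable M (\<lambda>x. (g x - t)\<^sup>2 * w x)" for t
  proof -
    have "integrable M (\<lambda>x. (g x)\<^sup>2 * w x - (2 * t) * (g x * w x) + t\<^sup>2 * w x)" using iw ig ig2 by simp
    then show ?thesis by (simp add: power2_eq_square algebra_simps)
  qed
  have ga2: "integrable M (\<lambda>x. (g x - a)\<^sup>2 * (\<Phi>1 x)\<^sup>2)"
  proof -
    have "sq_int M (\<lambda>x. f x - a *\<^sub>R \<Phi>1 x)" by (intro sq_int_diff sq_int_scaleR fsq sq_int_ground)
    then have i: "integrable M (\<lambda>x. (f x - a * \<Phi>1 x)\<^sup>2)" using sq_int_integrable by fastforce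
    have eq: "(g x - a)\<^sup>2 * (\<Phi>1 x)\<^sup>2 = (f x - a * \<Phi>1 x)\<^sup>2" if "x \<in> space M" for x
      using \<Phi>x[of x] that by (simp add: g_def power_mult_distrib[symmetric] left_diff_distrib)
    show ?thesis by (rule iffD2[OF Bochner_Integration.integrable_cong[OF refl eq] i])
  qed
  have iG: "integrable M (\<lambda>x. (norm (\<Phi>1 x *\<^sub>R G x))\<^sup>2)" by (rule sq_int_integrable[OF WP(1)])
  have GS: "(norm (G x))\<^sup>2 * S x powr (2 * m) \<le> (k1\<^sup>2 / q) * (norm (\<Phi>1 x *\<^sub>R G x))\<^sup>2"
    "(k0\<^sup>2 / q) * (norm (\<Phi>1 x *\<^sub>R G x))\<^sup>2 \<le> (norm (G x))\<^sup>2 * S x powr (2 * m)" if "x \<in> \<Omega>" for x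
  proof -
    have "(norm (G x))\<^sup>2 * (q * S x powr (2 * m)) \<le> (norm (G x))\<^sup>2 * (k1\<^sup>2 * (\<Phi>1 x)\<^sup>2)"
      "(norm (G x))\<^sup>2 * (k0\<^sup>2 * (\<Phi>1 x)\<^sup>2) \<le> (norm (G x))\<^sup>2 * (q * S x powr (2 * m))"
      using low[OF that] high[OF that] by (auto intro!: mult_left_mono)
    then show "(norm (G x))\<^sup>2 * S x powr (2 * m) \<le> (k1\<^sup>2 / q) * (norm (\<Phi>1 x *\<^sub>R G x))\<^sup>2"
      "(k0\<^sup>2 / q) * (norm (\<Phi>1 x *\<^sub>R G x))\<^sup>2 \<le> (norm (G x))\<^sup>2 * S x powr (2 * m)"
      using q by (simp_all add: power_mult_distrib field_simps)
  qed
  have iGS: "integrable M (\<lambda>x. (norm (G x))\<^sup>2 * S x powr (2 * m))"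
  proof (rule Bochner_Integration.integrable_bound[of M "\<lambda>x. (k1\<^sup>2 / q) * (norm (\<Phi>1 x *\<^sub>R G x))\<^sup>2"])
    show "integrable M (\<lambda>x. (k1\<^sup>2 / q) * (norm (\<Phi>1 x *\<^sub>R G x))\<^sup>2)" using iG by simp
    show "(\<lambda>x. (norm (G x))\<^sup>2 * S x powr (2 * m)) \<in> borel_measurable M" using Gm Spow[of "2 * m"] by measurable
    show "AE x in M. norm ((norm (G x))\<^sup>2 * S x powr (2 * m)) \<le> norm ((k1\<^sup>2 / q) * (norm (\<Phi>1 x *\<^sub>R G x))\<^sup>2)"
    proof (rule AE_I2)
      fix x assume "x \<in> space M"
      then have x: "x \<in> \<Omega>" by simp
      have n: "norm ((norm (G x))\<^sup>2 * S x powr (2 * m)) = (norm (G x))\<^sup>2 * S x powr (2 * m)" by simp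
      show "norm ((norm (G x))\<^sup>2 * S x powr (2 * m)) \<le> norm ((k1\<^sup>2 / q) * (norm (\<Phi>1 x *\<^sub>R G x))\<^sup>2)"
        unfolding n using GS(1)[OF x] by (rule order_trans) (simp only: real_norm_def abs_ge_self)
    qed
  qed
  define C where "C = (lam2 - lam1) * k0\<^sup>2 / (k1\<^sup>2 * B powr (1 - m))"
  have C: "0 \<le> C" unfolding C_def using lam_order(2) by (intro divide_nonneg_nonneg mult_nonneg_nonneg) auto
  \<comment> \<open>In this product k1^2 and B^(1-m) cancel; the remaining factor k0^2 / q is the
    one that compares \<Phi>1^2 with S^(2m) in the gradient term.\<close>
  have CD: "C * D = (lam2 - lam1) * (k0\<^sup>2 / q)"
    using k1 q B by (simp add: C_def D_def field_simps)
  have main: "C * (\<integral>x. (g x - b)\<^sup>2 * w x \<partial>M) \<le> (\<integral>x. (norm (G x))\<^sup>2 * S x powr (2 * m) \<partial>M)"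
  proof -
    \<comment> \<open>The gap estimate comes with \<open>a\<close>, the mean of \<open>g\<close> for
      the weight \<Phi>1^2; the mean \<open>b\<close> for the weight \<open>w\<close> can only lower
      the left-hand side.\<close>
    have "(\<integral>x. (g x - b)\<^sup>2 * w x \<partial>M) \<le> (\<integral>x. (g x - a)\<^sup>2 * w x \<partial>M)"
      unfolding b_def by (rule weighted_mean_minimizes[OF iw ig ig2 W])
    also have "\<dots> \<le> (\<integral>x. D * ((g x - a)\<^sup>2 * (\<Phi>1 x)\<^sup>2) \<partial>M)"
    proof (rule integral_mono[OF ibd])
      show "integrable M (\<lambda>x. D * ((g x - a)\<^sup>2 * (\<Phi>1 x)\<^sup>2))" using ga2 by simp
      fix x assume "x \<in> space M"
      then have "(g x - a)\<^sup>2 * w x \<le> (g x - a)\<^sup>2 * (D * (\<Phi>1 x)\<^sup>2)" by (intro mult_left_mono wD) auto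
      then show "(g x - a)\<^sup>2 * w x \<le> D * ((g x - a)\<^sup>2 * (\<Phi>1 x)\<^sup>2)" by (simp add: mult_ac)
    qed
    finally have "C * (\<integral>x. (g x - b)\<^sup>2 * w x \<partial>M) \<le> C * (D * (\<integral>x. (g x - a)\<^sup>2 * (\<Phi>1 x)\<^sup>2 \<partial>M))"
      using C by (intro mult_left_mono) simp_all
    also have "\<dots> = (k0\<^sup>2 / q) * ((lam2 - lam1) * (\<integral>x. (g x - a)\<^sup>2 * (\<Phi>1 x)\<^sup>2 \<partial>M))"
      unfolding mult.assoc[symmetric] CD by (simp add: mult_ac)
    also have "\<dots> \<le> (k0\<^sup>2 / q) * (\<integral>x. (norm (\<Phi>1 x *\<^sub>R G x))\<^sup>2 \<partial>M)"
      using q by (intro mult_left_mono WP(2)) simp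
    also have "\<dots> = (\<integral>x. (k0\<^sup>2 / q) * (norm (\<Phi>1 x *\<^sub>R G x))\<^sup>2 \<partial>M)" by simp
    also have "\<dots> \<le> (\<integral>x. (norm (G x))\<^sup>2 * S x powr (2 * m) \<partial>M)"
    proof (rule integral_mono[OF _ iGS])
      show "integrable M (\<lambda>x. (k0\<^sup>2 / q) * (norm (\<Phi>1 x *\<^sub>R G x))\<^sup>2)" using iG by simp
    qed (use GS(2) in simp)
    finally show ?thesis .
  qed
  \<comment> \<open>The bridge between the extended integrals of the statement and the real
    integrals of the estimate.\<close>
  have nn: "(\<integral>\<^sup>+x. ennreal (indicator \<Omega> x * u x) \<partial>lebesgue) = ennreal (\<integral>x. u x \<partial>M)"
    if "integrable M u" "\<And>x. 0 \<le> u x" for u :: "'a \<Rightarrow> real"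
  proof -
    have "(\<integral>\<^sup>+x. ennreal (indicator \<Omega> x * u x) \<partial>lebesgue) = (\<integral>\<^sup>+x. ennreal (u x) * indicator \<Omega> x \<partial>lebesgue)"
      by (rule nn_integral_cong) (simp add: indicator_def)
    also have "\<dots> = (\<integral>\<^sup>+x. ennreal (u x) \<partial>M)" by (rule nn_integral_restrict_space[symmetric]) simp
    also have "\<dots> = ennreal (\<integral>x. u x \<partial>M)" using that by (intro nn_integral_eq_integral) auto
    finally show ?thesis .
  qed
  have "ennreal C * (\<integral>\<^sup>+x. ennreal (indicator \<Omega> x * ((g x - b)\<^sup>2 * w x)) \<partial>lebesgue)
      = ennreal (C * (\<integral>x. (g x - b)\<^sup>2 * w x \<partial>M))"
    using C w0 by (subst nn[OF ibd]) (auto simp: ennreal_mult'')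
  also have "\<dots> \<le> ennreal (\<integral>x. (norm (G x))\<^sup>2 * S x powr (2 * m) \<partial>M)" by (rule ennreal_leI[OF main])
  also have "\<dots> = (\<integral>\<^sup>+x. ennreal (indicator \<Omega> x * ((norm (G x))\<^sup>2 * S x powr (2 * m))) \<partial>lebesgue)"
    by (rule nn[OF iGS, symmetric]) simp
  finally show ?thesis
    unfolding C_def B_def b_def g_def w_def integral_M_set by (simp only: mult.assoc)
qed

end
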